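(* Let $\frac12\le\alpha<1$ and $\delta\in[0,\alpha)$, and set $$s(\delta)=\begin{cases}\frac14+\delta, & 0\le\delta\le\frac14,\\ 2\delta, & \delta>\frac14.\end{cases}$$ (i) Let $\gamma:\mathbb{R}\times[-1,1]\to\mathbb{R}$ be any continuous map with $\gamma(x,0)=x$ for all $x$ which is bilipschitz continuous in $x$ (uniformly in $t$) and $\alpha$-Hölder continuous in $t$ (uniformly in $x$). Then for every $s>s(\delta)$ and every $f\in H^s(\mathbb{R})$, $$\lim_{t\to0^+}\frac{U_\gamma f(x,t)-f(x)}{t^\delta}=0\quad\text{for a.e. }x\in\mathbb{R}.$$ (ii) Conversely, there exists a map $\gamma$ satisfying all the assumptions in (i) such that for every $s<s(\delta)$ the statement "for every $f\in H^s(\mathbb{R})$, $\lim_{t\to0^+}\frac{U_\gamma f(x,t)-f(x)}{t^\delta}=0$ for a.e. $x\in\mathbb{R}$" is false.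
   Context: For a map $\gamma:\mathbb{R}\times[-1,1]\to\mathbb{R}$, define $$U_\gamma f(x,t)=\frac{1}{2\pi}\int_{\mathbb{R}}e^{i(\gamma(x,t)\xi+t|\xi|^2)}\widehat f(\xi)\,d\xi,\qquad \widehat f(\xi)=\int_{\mathbb{R}}e^{-ix\xi}f(x)\,dx.$$ When $\widehat f$ is not integrable, the integral is understood as the limit, as $N\to\infty$ through powers of $2$, of the integrals over $\{|\xi|\le N\}$; $f(x)$ is understood as $U_\gamma f(x,0)$. Bilipschitz continuous in $x$: there are constants $C_1,C_2>0$ with $\frac{1}{C_1}|x-x'|\le|\gamma(x,t)-\gamma(x',t)|\le C_2|x-x'|$ for all $t\in[-1,1]$, $x,x'\in\mathbb{R}$. $\alpha$-Hölder continuous in $t$: there is a constant $C_3>0$ with $|\gamma(x,t)-\gamma(x,t')|\le C_3|t-t'|^\alpha$ for all $x\in\mathbb{R}$, $t,t'\in[-1,1]$. $H^s(\mathbb{R})$ is the $L^2$-based Sobolev space with norm $\|(1+|\xi|^2)^{s/2}\widehat f\|_{L^2}$. *)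

theory Defs
  imports "HOL-Analysis.Analysis"
begin

section \<open>Schwartz functions and tempered distributions on the real line\<close>

definition nth_vderiv :: "nat \<Rightarrow> (real \<Rightarrow> complex) \<Rightarrow> real \<Rightarrow> complex" where
  "nth_vderiv k \<phi> = ((\<lambda>h x. vector_derivative h (at x)) ^^ k) \<phi>"

definition schwartz :: "(real \<Rightarrow> complex) set" where
  "schwartz = {\<phi>. (\<forall>k x. nth_vderiv k \<phi> differentiable at x) \<and>
                  (\<forall>j k. bounded (range (\<lambda>x. x ^ j *\<^sub>R nth_vderiv k \<phi> x)))}"

definition schwartz_seminorm :: "nat \<Rightarrow> nat \<Rightarrow> (real \<Rightarrow> complex) \<Rightarrow> real" where
  "schwartz_seminorm j k \<phi> = (SUP x. norm (x ^ j *\<^sub>R nth_vderiv k \<phi> x))"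

text \<open>Only the action on Schwartz functions matters; the values of \<open>T\<close> elsewhere are irrelevant.
  Continuity in the Schwartz topology is expressed by a bound by finitely many seminorms.\<close>

definition tempered_distribution :: "((real \<Rightarrow> complex) \<Rightarrow> complex) \<Rightarrow> bool" where
  "tempered_distribution T \<longleftrightarrow>
     (\<forall>\<phi>\<in>schwartz. \<forall>\<psi>\<in>schwartz. T (\<lambda>x. \<phi> x + \<psi> x) = T \<phi> + T \<psi>) \<and>
     (\<forall>c. \<forall>\<phi>\<in>schwartz. T (\<lambda>x. c * \<phi> x) = c * T \<phi>) \<and>
     (\<exists>C m. \<forall>\<phi>\<in>schwartz. norm (T \<phi>) \<le> C * (\<Sum>j\<le>m. \<Sum>k\<le>m. schwartz_seminorm j k \<phi>))"

definition fourier :: "(real \<Rightarrow> complex) \<Rightarrow> real \<Rightarrow> complex" where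
  "fourier \<phi> \<xi> = (LINT x|lborel. exp (- \<i> * complex_of_real (x * \<xi>)) * \<phi> x)"

text \<open>The Fourier transform of the tempered distribution \<open>T\<close>, i.e. \<open>\<phi> \<mapsto> T (fourier \<phi>)\<close>,
  is the function \<open>g\<close>.\<close>

definition has_fourier_function ::
  "((real \<Rightarrow> complex) \<Rightarrow> complex) \<Rightarrow> (real \<Rightarrow> complex) \<Rightarrow> bool" where
  "has_fourier_function T g \<longleftrightarrow> g \<in> borel_measurable lborel \<and>
     (\<forall>\<phi>\<in>schwartz. integrable lborel (\<lambda>\<xi>. g \<xi> * \<phi> \<xi>) \<and>
        T (fourier \<phi>) = (LINT \<xi>|lborel. g \<xi> * \<phi> \<xi>))"

text \<open>The function representing the Fourier transform is determined up to a null set, which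
  affects none of the integrals below; we choose one representative.\<close>

definition fourier_function :: "((real \<Rightarrow> complex) \<Rightarrow> complex) \<Rightarrow> real \<Rightarrow> complex" where
  "fourier_function T = (SOME g. has_fourier_function T g)"

text \<open>Every real order \<open>s\<close> is allowed, so the elements are tempered distributions rather than
  square-integrable functions.\<close>

definition sobolev :: "real \<Rightarrow> ((real \<Rightarrow> complex) \<Rightarrow> complex) set" where
  "sobolev s = {f. tempered_distribution f \<and> (\<exists>g. has_fourier_function f g) \<and>
     integrable lborel
       (\<lambda>\<xi>. (norm (complex_of_real ((1 + \<xi>\<^sup>2) powr (s / 2)) * fourier_function f \<xi>))\<^sup>2)}"

section \<open>The Schroedinger propagator along a path\<close>

text \<open>A map \<open>\<real> \<times> [-1,1] \<rightarrow> \<real>\<close> is a total function on pairs, used only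
  for \<open>t \<in> [-1,1]\<close>.\<close>

definition propagator_integrand ::
  "(real \<times> real \<Rightarrow> real) \<Rightarrow> ((real \<Rightarrow> complex) \<Rightarrow> complex) \<Rightarrow> real \<Rightarrow> real \<Rightarrow> real \<Rightarrow> complex" where
  "propagator_integrand \<gamma> f x t \<xi> =
     exp (\<i> * complex_of_real (\<gamma> (x, t) * \<xi> + t * \<bar>\<xi>\<bar>\<^sup>2)) * fourier_function f \<xi>"

definition dyadic_truncation ::
  "(real \<times> real \<Rightarrow> real) \<Rightarrow> ((real \<Rightarrow> complex) \<Rightarrow> complex) \<Rightarrow> real \<Rightarrow> real \<Rightarrow> nat \<Rightarrow> complex" where
  "dyadic_truncation \<gamma> f x t n =
     (LINT \<xi>:{\<xi>. \<bar>\<xi>\<bar> \<le> 2 ^ n}|lborel. propagator_integrand \<gamma> f x t \<xi>)"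

definition propagator ::
  "(real \<times> real \<Rightarrow> real) \<Rightarrow> ((real \<Rightarrow> complex) \<Rightarrow> complex) \<Rightarrow> real \<Rightarrow> real \<Rightarrow> complex" where
  "propagator \<gamma> f x t = 1 / (2 * complex_of_real pi) *
     (if integrable lborel (fourier_function f)
      then (LINT \<xi>|lborel. propagator_integrand \<gamma> f x t \<xi>)
      else lim (dyadic_truncation \<gamma> f x t))"

definition propagator_exists ::
  "(real \<times> real \<Rightarrow> real) \<Rightarrow> ((real \<Rightarrow> complex) \<Rightarrow> complex) \<Rightarrow> real \<Rightarrow> real \<Rightarrow> bool" where
  "propagator_exists \<gamma> f x t \<longleftrightarrow>
     integrable lborel (fourier_function f) \<or> convergent (dyadic_truncation \<gamma> f x t)"

text \<open>The limit relation includes that the expressions occurring in it make sense (for small \<open>t\<close>),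
  since \<^const>\<open>lim\<close> has an arbitrary value on a divergent sequence. The value \<open>f(x)\<close> is
  \<^term>\<open>propagator \<gamma> f x 0\<close>.\<close>

definition converges_with_rate ::
  "(real \<times> real \<Rightarrow> real) \<Rightarrow> real \<Rightarrow> ((real \<Rightarrow> complex) \<Rightarrow> complex) \<Rightarrow> real \<Rightarrow> bool" where
  "converges_with_rate \<gamma> \<delta> f x \<longleftrightarrow>
     propagator_exists \<gamma> f x 0 \<and>
     (\<forall>\<^sub>F t in at_right 0. propagator_exists \<gamma> f x t) \<and>
     ((\<lambda>t. (propagator \<gamma> f x t - propagator \<gamma> f x 0) / complex_of_real (t powr \<delta>))
        \<longlongrightarrow> 0) (at_right 0)"

section \<open>Hypotheses on the path\<close>

definition bilipschitz_in_x :: "(real \<times> real \<Rightarrow> real) \<Rightarrow> bool" where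
  "bilipschitz_in_x \<gamma> \<longleftrightarrow> (\<exists>C1>0. \<exists>C2>0. \<forall>t\<in>{-1..1}. \<forall>x x'.
     1 / C1 * \<bar>x - x'\<bar> \<le> \<bar>\<gamma> (x, t) - \<gamma> (x', t)\<bar> \<and>
     \<bar>\<gamma> (x, t) - \<gamma> (x', t)\<bar> \<le> C2 * \<bar>x - x'\<bar>)"

definition hoelder_in_t :: "real \<Rightarrow> (real \<times> real \<Rightarrow> real) \<Rightarrow> bool" where
  "hoelder_in_t \<alpha> \<gamma> \<longleftrightarrow> (\<exists>C3>0. \<forall>x. \<forall>t\<in>{-1..1}. \<forall>t'\<in>{-1..1}.
     \<bar>\<gamma> (x, t) - \<gamma> (x, t')\<bar> \<le> C3 * \<bar>t - t'\<bar> powr \<alpha>)"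

definition admissible_path :: "real \<Rightarrow> (real \<times> real \<Rightarrow> real) \<Rightarrow> bool" where
  "admissible_path \<alpha> \<gamma> \<longleftrightarrow>
     continuous_on (UNIV \<times> {-1..1}) \<gamma> \<and> (\<forall>x. \<gamma> (x, 0) = x) \<and>
     bilipschitz_in_x \<gamma> \<and> hoelder_in_t \<alpha> \<gamma>"

definition critical_exponent :: "real \<Rightarrow> real" where
  "critical_exponent \<delta> = (if \<delta> \<le> 1 / 4 then 1 / 4 + \<delta> else 2 * \<delta>)"

end

theory Submission
  imports Defs "HOL-Probability.Probability"
begin

text \<open>
  For the positive result, split the Fourier transform into dyadic pieces \<open>\<bar>\<xi>\<bar> \<sim> \<lambda>\<close>. For times
  \<open>t \<le> 1 / \<lambda>\<^sup>2\<close> apply the mean value theorem on the segment from \<open>(x, 0)\<close> to \<open>(\<gamma> (x, t), t)\<close>, whose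
  length is of order \<open>t powr \<alpha>\<close>; as \<open>\<delta> < \<alpha>\<close>, one can divide by \<open>t powr \<delta>\<close>. For \<open>t \<sim> T \<ge> 1 / \<lambda>\<^sup>2\<close>
  estimate the two terms separately, at the cost of \<open>T powr (- \<delta>)\<close>. Either way a maximal function has to
  be bounded in \<open>L\<^sup>2\<close>: linearise it and apply Schur's test to \<open>T T\<^sup>*\<close>, whose kernel is explicit for a
  Gaussian cutoff. The resulting constant is a power of \<open>\<lambda>\<close> arbitrarily close to the critical one, and the
  remaining decay of the Sobolev weight makes the pieces summable almost everywhere.

  For the negative result take \<open>\<gamma> (x, t) = x\<close> and a lacunary sum of Gaussian wave packets at frequencies
  \<open>\<omega>\<^sub>k\<close>. If \<open>\<delta> > 1/4\<close>, packets of unit frequency width change sign by time \<open>\<pi> / \<omega>\<^sub>k\<^sup>2\<close> because of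
  their oscillation. If \<open>\<delta> \<le> 1/4\<close>, packets of width \<open>\<omega>\<^sub>k powr (-1/2)\<close> start at the origin and travel with speed
  \<open>2 \<omega>\<^sub>k\<close>, so that they pass through every \<open>x \<in> [-2, -1]\<close> at a time of order \<open>1 / \<omega>\<^sub>k\<close>.\<close>

section \<open>Gaussian integrals with a quadratic phase\<close>

text \<open>Why the critical exponent has two branches: on times of order
  \<open>T >= 1 / l^2\<close>, two points that the path keeps apart contribute a kernel of size
  \<open>l^(1/2+p) * T^p * |x-y|^(-1/2-p)\<close> at frequency \<open>l\<close>; Schur's test needs
  local integrability, hence \<open>p < 1/2\<close>. Dividing by \<open>T^(2*\<delta>)\<close>, the
  choice \<open>p = 2*\<delta>\<close> cancels \<open>T\<close> and costs
  \<open>l^(1/2+2*\<delta>)\<close> in the square. For \<open>\<delta> \<ge> 1/4\<close> this choice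
  is barred, the shortest times \<open>T = 1 / l^2\<close> dominate, and the cost is
  \<open>l^(4*\<delta>)\<close> up to small powers. The condition \<open>\<alpha> \<ge> 1/2\<close>
  matches parabolic scaling: up to time \<open>1 / l^2\<close> the path moves by at most a constant
  times the wavelength \<open>1 / l\<close>, and points that it fails to keep apart satisfy
  \<open>|x-y| <= C * |t-t'|^(1/2)\<close>, where dispersion takes over. The propagator is a limit
  of truncated integrals whose existence is part of the claim. So the positive half must also make
  the dyadic sums converge, and the negative half must evaluate the propagator as a series of
  packets before a contradiction can be drawn.\<close>

lemma borel_measurable_cnj [measurable (raw)]:
  assumes "f \<in> borel_measurable M"
  shows "(\<lambda>x. cnj (f x)) \<in> borel_measurable M"
  by (rule borel_measurable_continuous_on[OF _ assms]) (intro continuous_intros)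

text \<open>Most later interchanges of two integrals have this shape: two integrable densities and a
  bounded factor, typically a phase of modulus one. A multiple of the product of the densities is
  then an integrable majorant on the plane.\<close>

lemma integrable_bounded_kernel:
  fixes u v :: "real \<Rightarrow> complex" and m :: "real \<times> real \<Rightarrow> complex"
  assumes u: "integrable lborel u" and v: "integrable lborel v"
    and m [measurable]: "m \<in> borel_measurable (borel \<Otimes>\<^sub>M borel)" and C: "\<And>x y. norm (m (x, y)) \<le> C"
  shows "integrable (lborel \<Otimes>\<^sub>M lborel) (\<lambda>(x, y). u x * v y * m (x, y))"
proof -
  have [measurable]: "u \<in> borel_measurable borel" "v \<in> borel_measurable borel"
    using u v by auto
  have "integrable (lborel \<Otimes>\<^sub>M lborel) (\<lambda>(x, y). u x * v y)"
  proof (rule lborel_pair.Fubini_integrable)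
    show "integrable lborel (\<lambda>x. LINT y|lborel. norm (case (x, y) of (x, y) \<Rightarrow> u x * v y))"
      using u by (simp add: norm_mult)
    show "AE x in lborel. integrable lborel (\<lambda>y. case (x, y) of (x, y) \<Rightarrow> u x * v y)"
      using v by simp
  qed simp
  then have "integrable (lborel \<Otimes>\<^sub>M lborel) (\<lambda>z. of_real C * (case z of (x, y) \<Rightarrow> u x * v y) :: complex)"
    by (rule integrable_mult_right)
  then show ?thesis
  proof (rule Bochner_Integration.integrable_bound, goal_cases)
    case 1 show ?case by simp
  next
    case 2
    have "norm (u x * v y * m (x, y)) \<le> norm (of_real C * (u x * v y) :: complex)" for x y
      using C[of x y] mult_left_mono[OF order_trans[OF C[of x y] abs_ge_self], of "norm (u x) * norm (v y)"]
      by (simp add: norm_mult mult.commute mult.left_commute)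
    then show ?case by auto
  qed
qed

lemma integral_swap_bounded_kernel:
  fixes u v :: "real \<Rightarrow> complex" and m :: "real \<times> real \<Rightarrow> complex"
  assumes "integrable lborel u" "integrable lborel v"
    "m \<in> borel_measurable (borel \<Otimes>\<^sub>M borel)" "\<And>x y. norm (m (x, y)) \<le> C"
  shows "(LINT x|lborel. u x * (LINT y|lborel. v y * m (x, y))) =
    (LINT y|lborel. v y * (LINT x|lborel. u x * m (x, y)))"
proof -
  have "(LINT y|lborel. LINT x|lborel. u x * v y * m (x, y)) = (LINT x|lborel. LINT y|lborel. u x * v y * m (x, y))"
    using lborel_pair.Fubini_integral[OF integrable_bounded_kernel[OF assms]] by simp
  moreover have "(LINT x|lborel. u x * v y * m (x, y)) = v y * (LINT x|lborel. u x * m (x, y))" for y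
    by (subst integral_mult_right_zero[symmetric]) (auto intro!: Bochner_Integration.integral_cong simp: mult_ac)
  moreover have "(LINT y|lborel. u x * v y * m (x, y)) = u x * (LINT y|lborel. v y * m (x, y))" for x
    by (subst integral_mult_right_zero[symmetric]) (auto intro!: Bochner_Integration.integral_cong simp: mult_ac)
  ultimately show ?thesis by simp
qed

section \<open>Real Gaussians and their Fourier transforms\<close>

lemma integrable_gaussian:
  assumes "c > 0"
  shows "integrable lborel (\<lambda>x::real. exp (- c * x\<^sup>2))"
proof -
  have "integrable lborel (\<lambda>x::real. exp (- x\<^sup>2))"
    using gaussian_moment_even_pos[of 0] has_bochner_integral_even_function[OF gaussian_moment_even_pos[where k=0]]
    by (auto simp: has_bochner_integral_iff)
  then have "integrable lborel (\<lambda>x::real. exp (- (0 + sqrt c * x)\<^sup>2))"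
    using assms by (subst lborel_integrable_real_affine_iff) auto
  then show ?thesis using assms by (simp add: power_mult_distrib)
qed

lemma integrable_gaussian_complex:
  "c > 0 \<Longrightarrow> integrable lborel (\<lambda>x::real. complex_of_real (exp (- c * x\<^sup>2)))"
  using integrable_gaussian by auto

text \<open>Read off from the characteristic function of the standard normal law: rescaling by
  \<open>s = sqrt (2 * c)\<close> turns the normal density into a multiple of
  \<open>exp (- c * x^2)\<close>.\<close>

lemma gaussian_fourier:
  assumes "c > 0"
  shows "(LINT x|lborel. exp (\<i> * complex_of_real (a * x)) * exp (- c * x\<^sup>2)) =
    complex_of_real (sqrt (pi / c) * exp (- a\<^sup>2 / (4 * c)))"
proof -
  define s where "s = sqrt (2 * c)"
  have s: "s > 0" "s\<^sup>2 = 2 * c" using assms by (auto simp: s_def)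
  have dens: "std_normal_density (0 + s * x) = 1 / sqrt (2 * pi) * exp (- c * x\<^sup>2)" for x
  proof -
    have "- (s * x)\<^sup>2 / 2 = - c * x\<^sup>2" using s by (simp add: power_mult_distrib)
    then show ?thesis by (simp add: std_normal_density_def)
  qed
  have phase: "a / s * (0 + s * x) = a * x" for x using s by simp
  have "complex_of_real (exp (- ((a/s)^2) / 2)) = char std_normal_distribution (a/s)"
    by (simp add: char_std_normal_distribution)
  also have "\<dots> = (LINT x|lborel. std_normal_density x *\<^sub>R iexp (a/s * x))"
    unfolding char_def by (subst integral_density) auto
  also have "\<dots> = \<bar>s\<bar> *\<^sub>R (LINT x|lborel. std_normal_density (0 + s * x) *\<^sub>R iexp (a/s * (0 + s * x)))"
    using s by (subst lborel_integral_real_affine[where c=s and t=0]) auto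
  also have "\<dots> = \<bar>s\<bar> *\<^sub>R (LINT x|lborel. (1 / sqrt (2 * pi)) *\<^sub>R (exp (\<i> * complex_of_real (a * x)) * exp (- c * x\<^sup>2)))"
    by (simp only: dens phase) (simp add: scaleR_conv_of_real mult_ac)
  also have "\<dots> = (s / sqrt (2 * pi)) *\<^sub>R (LINT x|lborel. (exp (\<i> * complex_of_real (a * x)) * exp (- c * x\<^sup>2)))"
    using s by simp
  finally have "(LINT x|lborel. (exp (\<i> * complex_of_real (a * x)) * exp (- c * x\<^sup>2))) = (sqrt (2 * pi) / s) *\<^sub>R complex_of_real (exp (- ((a/s)^2) / 2))"
    using s by (simp add: field_simps)
  moreover have "sqrt (2 * pi) / s = sqrt (pi / c)"
    using assms unfolding s_def by (simp add: real_sqrt_divide[symmetric] real_sqrt_mult)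
  moreover have "- ((a/s)^2) / 2 = - a\<^sup>2 / (4 * c)"
    using s by (simp add: power_divide)
  ultimately show ?thesis by (simp add: scaleR_conv_of_real)
qed

text \<open>Up to the factor \<open>1 / (2 * pi)\<close> this is the propagator at the point
  \<open>a\<close> and time \<open>b\<close>, for a datum with Fourier transform \<open>g\<close>.
  With \<open>a\<close> and \<open>b\<close> free, the same integral serves for curved paths, for
  the segments of the mean value theorem, and for the kernels of the dual estimate, where
  \<open>a\<close> and \<open>b\<close> are differences.\<close>

definition chirp :: "(real \<Rightarrow> complex) \<Rightarrow> real \<Rightarrow> real \<Rightarrow> complex" where
  "chirp g a b = (LINT \<xi>|lborel. exp (\<i> * complex_of_real (a * \<xi> + b * \<xi>\<^sup>2)) * g \<xi>)"

abbreviation chirp_gaussian :: "real \<Rightarrow> real \<Rightarrow> real \<Rightarrow> complex" where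
  "chirp_gaussian \<mu> \<equiv> chirp (\<lambda>\<xi>. complex_of_real (exp (- \<mu> * \<xi>\<^sup>2)))"

lemma integrable_chirp:
  "\<mu> > 0 \<Longrightarrow> integrable lborel (\<lambda>\<xi>. exp (\<i> * complex_of_real (a * \<xi> + b * \<xi>\<^sup>2)) * exp (- \<mu> * \<xi>\<^sup>2))"
  by (rule Bochner_Integration.integrable_bound[OF integrable_gaussian[of \<mu>]]) (auto simp: norm_mult)

text \<open>The square of the modulus becomes a double integral in which the sum and the difference of the
  two variables can be integrated out one after the other, each time against a real Gaussian.\<close>

lemma norm_chirp_gaussian:
  assumes mu: "\<mu> > 0"
  shows "(norm (chirp_gaussian \<mu> a b))\<^sup>2 =
    pi / sqrt (\<mu>\<^sup>2 + b\<^sup>2) * exp (- (a\<^sup>2 * \<mu>) / (2 * (\<mu>\<^sup>2 + b\<^sup>2)))"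
proof -
  define h where "h = (\<lambda>\<xi>. exp (\<i> * complex_of_real (a * \<xi> + b * \<xi>\<^sup>2)) * exp (- \<mu> * \<xi>\<^sup>2))"
  have hi: "integrable lborel h" unfolding h_def by (rule integrable_chirp[OF mu])
  have [measurable]: "h \<in> borel_measurable borel" unfolding h_def by measurable
  define I where "I = integral\<^sup>L lborel h"
  \<comment> \<open>The rate left after the first integration: \<open>\<mu> / 2\<close> from the
    damping, plus \<open>b^2 / (2 * \<mu>)\<close> from the Fourier transform of the inner Gaussian
    at frequency \<open>2 * b * u\<close>.\<close>
  define c where "c = (\<mu>\<^sup>2 + b\<^sup>2) / (2 * \<mu>)"
  have c: "c > 0" using mu by (auto simp: c_def add_pos_nonneg)
  define p where "p = (\<lambda>x::real. exp (\<i> * complex_of_real (a * x)) * exp (- c * x\<^sup>2))"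
  have shift: "(LINT \<xi>|lborel. h \<xi> * cnj (h \<eta>)) = (LINT u|lborel. h (\<eta> + u) * cnj (h \<eta>))" for \<eta>
    by (subst lborel_integral_real_affine[where c=1 and t=\<eta>]) auto
  have inner: "(LINT \<eta>|lborel. h (\<eta> + u) * cnj (h \<eta>)) = sqrt (pi / (2*\<mu>)) * p u" for u
  proof -
    \<comment> \<open>Centring the two arguments at \<open>\<eta>\<close> makes the phase difference
      linear in \<open>\<eta>\<close>, because the squares cancel. The chirp becomes an ordinary
      Fourier integral of a Gaussian.\<close>
    have "(LINT \<eta>|lborel. h (\<eta> + u) * cnj (h \<eta>)) = (LINT \<eta>|lborel. h (\<eta> + u/2) * cnj (h (\<eta> - u/2)))"
      by (subst lborel_integral_real_affine[where c=1 and t="-u/2"]) (auto simp: add_ac)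
    also have "\<dots> = (LINT \<eta>|lborel. (exp (\<i> * (a*u)) * exp (-\<mu>*u\<^sup>2/2)) * (exp (\<i> * complex_of_real ((2*b*u) * \<eta>)) * exp (- (2*\<mu>) * \<eta>\<^sup>2)))"
    proof (intro Bochner_Integration.integral_cong refl)
      fix \<eta> :: real
      have "h (\<eta> + u/2) * cnj (h (\<eta> - u/2)) = exp (\<i> * complex_of_real ((a * (\<eta>+u/2) + b * (\<eta>+u/2)\<^sup>2) - (a * (\<eta>-u/2) + b * (\<eta>-u/2)\<^sup>2)))
         * exp (complex_of_real (- \<mu> * (\<eta>+u/2)\<^sup>2 - \<mu> * (\<eta>-u/2)\<^sup>2))"
        unfolding h_def by (simp add: exp_of_real[symmetric] exp_cnj exp_add[symmetric] algebra_simps)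
      also have "(a * (\<eta>+u/2) + b * (\<eta>+u/2)\<^sup>2) - (a * (\<eta>-u/2) + b * (\<eta>-u/2)\<^sup>2) = a*u + (2*b*u)*\<eta>"
        by (simp add: power2_eq_square algebra_simps)
      also have "- \<mu> * (\<eta>+u/2)\<^sup>2 - \<mu> * (\<eta>-u/2)\<^sup>2 = -\<mu>*u\<^sup>2/2 + (-(2*\<mu>) * \<eta>\<^sup>2)"
        by (simp add: power2_eq_square algebra_simps)
      also have "exp (\<i> * complex_of_real (a*u + (2*b*u)*\<eta>)) * exp (complex_of_real (-\<mu>*u\<^sup>2/2 + (-(2*\<mu>) * \<eta>\<^sup>2))) =
         (exp (\<i> * (a*u)) * exp (-\<mu>*u\<^sup>2/2)) * (exp (\<i> * complex_of_real ((2*b*u) * \<eta>)) * exp (- (2*\<mu>) * \<eta>\<^sup>2))"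
        by (simp add: exp_of_real[symmetric] exp_add[symmetric] algebra_simps)
      finally show "h (\<eta> + u/2) * cnj (h (\<eta> - u/2)) = \<dots>" .
    qed
    also have "\<dots> = (exp (\<i> * (a*u)) * exp (-\<mu>*u\<^sup>2/2)) * complex_of_real (sqrt (pi / (2*\<mu>)) * exp (- (2*b*u)\<^sup>2 / (4 * (2*\<mu>))))"
      using mu by (subst integral_mult_right_zero, subst gaussian_fourier) auto
    also have "\<dots> = sqrt (pi / (2*\<mu>)) * (exp (\<i> * (a*u)) * exp (complex_of_real (-\<mu>*u\<^sup>2/2 + (- (2*b*u)\<^sup>2 / (4 * (2*\<mu>))))))"
      by (simp add: exp_of_real[symmetric] exp_add[symmetric] algebra_simps)
    also have "-\<mu>*u\<^sup>2/2 + (- (2*b*u)\<^sup>2 / (4 * (2*\<mu>))) = - c * u\<^sup>2"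
      using mu by (simp add: c_def field_simps power2_eq_square)
    finally show ?thesis by (simp only: p_def exp_of_real)
  qed
  \<comment> \<open>\<open>G\<close> serves Fubini only: the double integrand is written as
    \<open>G \<eta> * G u\<close> times the bounded factor \<open>m\<close>. The rate
    \<open>\<mu> / 4\<close> is slow enough for that by the inequality \<open>*\<close>
    below.\<close>
  define G where "G = (\<lambda>\<eta>::real. complex_of_real (exp (- (\<mu>/4) * \<eta>\<^sup>2)))"
  have Gi: "integrable lborel G" unfolding G_def by (rule integrable_gaussian_complex) (use mu in auto)
  have [measurable]: "G \<in> borel_measurable borel" unfolding G_def by measurable
  have G0: "G x \<noteq> 0" for x by (simp add: G_def)
  define m where "m = (\<lambda>(\<eta>,u). h (\<eta> + u) * cnj (h \<eta>) / (G \<eta> * G u))"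
  have m_meas: "m \<in> borel_measurable (borel \<Otimes>\<^sub>M borel)" 
  proof -
    show ?thesis unfolding m_def split_beta' by measurable
  qed
  have m_bd: "norm (m (\<eta>, u)) \<le> 1" for \<eta> u
  proof -
    have *: "(\<eta>+u)\<^sup>2 + \<eta>\<^sup>2 \<ge> (\<eta>\<^sup>2 + u\<^sup>2) / 4"
    proof -
      have "0 \<le> (2*\<eta> + u)^2" "0 \<le> \<eta>^2" "0 \<le> u^2" by auto
      moreover have "(\<eta>+u)\<^sup>2 + \<eta>\<^sup>2 = ((2*\<eta> + u)^2 + u^2) / 2" by (simp add: power2_eq_square algebra_simps)
      moreover have "(\<eta>+u)\<^sup>2 \<ge> 0" by auto
      ultimately show ?thesis by argo
    qed
    have "norm (m (\<eta>, u)) = exp (- \<mu> * (\<eta>+u)\<^sup>2) * exp (- \<mu> * \<eta>\<^sup>2) / (exp (- (\<mu>/4) * \<eta>\<^sup>2) * exp (- (\<mu>/4) * u\<^sup>2))"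
      by (simp add: m_def h_def G_def norm_mult norm_divide del: of_real_exp)
    also have "\<dots> = exp (- \<mu> * ((\<eta>+u)\<^sup>2 + \<eta>\<^sup>2) + \<mu> * ((\<eta>\<^sup>2 + u\<^sup>2)/4))"
      by (simp add: exp_add[symmetric] exp_diff[symmetric] algebra_simps)
    also have "\<dots> \<le> 1" using mult_left_mono[OF *, of \<mu>] mu by simp
    finally show ?thesis .
  qed
  have mm: "G \<eta> * (G u * m (\<eta>, u)) = h (\<eta> + u) * cnj (h \<eta>)" "G u * (G \<eta> * m (\<eta>, u)) = h (\<eta> + u) * cnj (h \<eta>)" for \<eta> u
    using G0 by (simp_all add: m_def)
  have "I * cnj I = (LINT \<eta>|lborel. I * cnj (h \<eta>))"
    unfolding I_def by (subst integral_mult_right_zero) (simp add: integral_cnj)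
  also have "\<dots> = (LINT \<eta>|lborel. (LINT u|lborel. h (\<eta> + u) * cnj (h \<eta>)))"
    unfolding I_def by (simp only: integral_mult_left_zero[symmetric] shift)
  also have "\<dots> = (LINT \<eta>|lborel. G \<eta> * (LINT u|lborel. G u * m (\<eta>, u)))"
    by (simp only: integral_mult_right_zero[symmetric] mm)
  also have "\<dots> = (LINT u|lborel. G u * (LINT \<eta>|lborel. G \<eta> * m (\<eta>, u)))"
    by (rule integral_swap_bounded_kernel[OF Gi Gi m_meas m_bd])
  also have "\<dots> = (LINT u|lborel. (LINT \<eta>|lborel. h (\<eta> + u) * cnj (h \<eta>)))"
    by (simp only: integral_mult_right_zero[symmetric] mm)
  also have "\<dots> = sqrt (pi / (2*\<mu>)) * (sqrt (pi / c) * exp (- a\<^sup>2 / (4 * c)))"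
    unfolding inner p_def by (subst integral_mult_right_zero, subst gaussian_fourier[OF c]) auto
  finally have "complex_of_real ((norm I)^2) = complex_of_real (sqrt (pi / (2*\<mu>)) * (sqrt (pi / c) * exp (- a\<^sup>2 / (4 * c))))"
    by (simp add: complex_mult_cnj cmod_power2)
  then have "(norm I)^2 = sqrt (pi / (2*\<mu>)) * (sqrt (pi / c) * exp (- a\<^sup>2 / (4 * c)))"
    unfolding of_real_eq_iff .
  also have "sqrt (pi / (2*\<mu>)) * (sqrt (pi / c) * exp (- a\<^sup>2 / (4 * c))) = sqrt (pi / (2*\<mu>) * (pi / c)) * exp (- a\<^sup>2 / (4 * c))"
    by (simp add: real_sqrt_mult real_sqrt_divide)
  also have "pi / (2*\<mu>) * (pi / c) = pi\<^sup>2 / (\<mu>\<^sup>2 + b\<^sup>2)"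
    using mu by (simp add: c_def power2_eq_square)
  also have "- a\<^sup>2 / (4 * c) = - (a\<^sup>2 * \<mu>) / (2 * (\<mu>\<^sup>2 + b\<^sup>2))"
  proof -
    have "\<mu>\<^sup>2 + b\<^sup>2 > 0" using mu by (simp add: add_pos_nonneg)
    then show ?thesis using mu by (simp add: c_def divide_simps)
  qed
  also have "sqrt (pi\<^sup>2 / (\<mu>\<^sup>2 + b\<^sup>2)) = pi / sqrt (\<mu>\<^sup>2 + b\<^sup>2)" by (simp add: real_sqrt_divide)
  finally show ?thesis by (simp add: I_def h_def chirp_def)
qed

section \<open>Maximal estimates by the \<open>T T\<^sup>*\<close> method\<close>

lemma integrable_phase:
  assumes "integrable lborel g"
  shows "integrable lborel (\<lambda>\<xi>. exp (\<i> * complex_of_real (a * \<xi> + b * \<xi>\<^sup>2)) * g \<xi>)"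
proof -
  have [measurable]: "g \<in> borel_measurable borel" using assms by auto
  show ?thesis by (rule Bochner_Integration.integrable_bound[OF assms]) (auto simp: norm_mult)
qed

lemma norm_chirp_le: "norm (chirp g a b) \<le> (LINT \<xi>|lborel. norm (g \<xi>))"
  unfolding chirp_def by (rule order_trans[OF integral_norm_bound]) (simp add: norm_mult)

lemma continuous_chirp:
  assumes g: "integrable lborel g"
  shows "continuous_on UNIV (\<lambda>z. chirp g (fst z) (snd z))"
proof (rule continuous_on_sequentiallyI)
  fix u :: "nat \<Rightarrow> real \<times> real" and z :: "real \<times> real" assume u: "u \<longlonglongrightarrow> z"
  have [measurable]: "g \<in> borel_measurable borel" using g by auto
  have "(\<lambda>n. fst (u n)) \<longlonglongrightarrow> fst z" "(\<lambda>n. snd (u n)) \<longlonglongrightarrow> snd z"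
    using u by (auto intro: tendsto_fst tendsto_snd)
  then show "(\<lambda>n. chirp g (fst (u n)) (snd (u n))) \<longlonglongrightarrow> chirp g (fst z) (snd z)"
    unfolding chirp_def
    by (intro integral_dominated_convergence[where w="\<lambda>\<xi>. norm (g \<xi>)"])
      (auto intro!: tendsto_intros simp: norm_mult g)
qed

lemma measurable_chirp:
  assumes "integrable lborel g" and [measurable]: "a \<in> borel_measurable borel" "b \<in> borel_measurable borel"
  shows "(\<lambda>x. chirp g (a x) (b x)) \<in> borel_measurable borel"
proof -
  have "(\<lambda>x. (a x, b x)) \<in> borel_measurable borel" by (rule borel_measurable_Pair) measurable
  from borel_measurable_continuous_on[OF continuous_chirp[OF assms(1)] this]
  show ?thesis by simp
qed

lemma integrable_indicator_Icc: "integrable lborel (indicator {a..b::real} :: real \<Rightarrow> real)"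
  by (rule integrable_real_indicator) (auto simp: emeasure_lborel_Icc_eq)

lemma integrable_of_square:
  fixes g :: "real \<Rightarrow> complex"
  assumes [measurable]: "g \<in> borel_measurable borel" and g2: "integrable lborel (\<lambda>\<xi>. (norm (g \<xi>))\<^sup>2)"
    and supp: "\<And>\<xi>. \<bar>\<xi>\<bar> > l \<Longrightarrow> g \<xi> = 0"
  shows "integrable lborel g"
proof (rule Bochner_Integration.integrable_bound)
  show "integrable lborel (\<lambda>\<xi>. indicator {-l..l} \<xi> + (norm (g \<xi>))\<^sup>2)"
    using g2 by (intro Bochner_Integration.integrable_add integrable_indicator_Icc)
  have "norm (g \<xi>) \<le> 1 + (norm (g \<xi>))\<^sup>2" for \<xi>
  proof -
    have "0 \<le> (norm (g \<xi>) - 1)\<^sup>2" by simp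
    then have "2 * norm (g \<xi>) \<le> 1 + (norm (g \<xi>))\<^sup>2" by (simp add: power2_eq_square algebra_simps)
    then show ?thesis using norm_ge_zero[of "g \<xi>"] by linarith
  qed
  moreover have "g \<xi> = 0" if "\<xi> \<notin> {-l..l}" for \<xi> using supp[of \<xi>] that by auto
  ultimately show "AE \<xi> in lborel. norm (g \<xi>) \<le> norm (indicator {-l..l} \<xi> + (norm (g \<xi>))\<^sup>2)"
    by (auto split: split_indicator)
qed simp

lemma ennreal_norm_integral_le:
  fixes f :: "real \<Rightarrow> complex"
  shows "ennreal (norm (integral\<^sup>L lborel f)) \<le> (\<integral>\<^sup>+x. ennreal (norm (f x)) \<partial>lborel)"
  by (cases "integrable lborel f") (auto simp: integral_norm_bound_ennreal not_integrable_integral_eq)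

text \<open>The product of the two norms is at most half the sum of their squares, and a convolution
  kernel has the same mass in either variable. So each half contributes the mass of \<open>k\<close>
  times half the integral of the square.\<close>

lemma schur_test:
  fixes F :: "real \<Rightarrow> complex" and k :: "real \<Rightarrow> real"
  assumes [measurable]: "F \<in> borel_measurable borel" "k \<in> borel_measurable borel"
    and k0: "\<And>z. k z \<ge> 0" and A: "(\<integral>\<^sup>+z. ennreal (k z) \<partial>lborel) \<le> ennreal A"
  shows "(\<integral>\<^sup>+x. \<integral>\<^sup>+y. ennreal (norm (F x) * norm (F y) * k (x - y)) \<partial>lborel \<partial>lborel)
    \<le> ennreal A * (\<integral>\<^sup>+x. ennreal ((norm (F x))\<^sup>2) \<partial>lborel)"
proof -
  let ?f = "\<lambda>x. ennreal ((norm (F x))\<^sup>2)"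
  have k1: "(\<integral>\<^sup>+y. ennreal (k (x - y)) \<partial>lborel) = (\<integral>\<^sup>+z. ennreal (k z) \<partial>lborel)" for x
    using nn_integral_real_affine[of "\<lambda>z. ennreal (k z)" "-1" x] by simp
  have k2: "(\<integral>\<^sup>+x. ennreal (k (x - y)) \<partial>lborel) = (\<integral>\<^sup>+z. ennreal (k z) \<partial>lborel)" for y
    using nn_integral_real_affine[of "\<lambda>z. ennreal (k z)" 1 "-y"] by simp
  have "(\<integral>\<^sup>+x. \<integral>\<^sup>+y. ennreal (norm (F x) * norm (F y) * k (x - y)) \<partial>lborel \<partial>lborel)
    \<le> (\<integral>\<^sup>+x. \<integral>\<^sup>+y. ennreal (1/2) * (?f x * ennreal (k (x - y)) + ?f y * ennreal (k (x - y))) \<partial>lborel \<partial>lborel)"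
  proof (intro nn_integral_mono)
    fix x y :: real
    have "norm (F x) * norm (F y) \<le> 1/2 * ((norm (F x))\<^sup>2 + (norm (F y))\<^sup>2)"
      using sum_squares_ge_zero[of "norm (F x) - norm (F y)" 0] by (simp add: power2_eq_square algebra_simps)
    from mult_right_mono[OF this k0[of "x - y"]]
    have "ennreal (norm (F x) * norm (F y) * k (x - y)) \<le> ennreal (1/2 * ((norm (F x))\<^sup>2 * k (x - y) + (norm (F y))\<^sup>2 * k (x - y)))"
      by (intro ennreal_leI) (simp add: algebra_simps)
    also have "\<dots> = ennreal (1/2) * (?f x * ennreal (k (x - y)) + ?f y * ennreal (k (x - y)))"
      using k0[of "x - y"] by (simp only: ennreal_mult ennreal_plus mult_nonneg_nonneg add_nonneg_nonneg
          zero_le_power2 divide_nonneg_nonneg zero_le_one zero_le_numeral)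
    finally show "ennreal (norm (F x) * norm (F y) * k (x - y)) \<le> \<dots>" .
  qed
  also have "\<dots> = ennreal (1/2) * ((\<integral>\<^sup>+x. \<integral>\<^sup>+y. ?f x * ennreal (k (x - y)) \<partial>lborel \<partial>lborel)
      + (\<integral>\<^sup>+x. \<integral>\<^sup>+y. ?f y * ennreal (k (x - y)) \<partial>lborel \<partial>lborel))"
    by (simp add: nn_integral_cmult nn_integral_add)
  also have "(\<integral>\<^sup>+x. \<integral>\<^sup>+y. ?f y * ennreal (k (x - y)) \<partial>lborel \<partial>lborel) =
      (\<integral>\<^sup>+y. \<integral>\<^sup>+x. ?f y * ennreal (k (x - y)) \<partial>lborel \<partial>lborel)"
    using lborel_pair.Fubini'[of "\<lambda>x y. ?f y * ennreal (k (x - y))"] by simp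
  also have "ennreal (1/2) * ((\<integral>\<^sup>+x. \<integral>\<^sup>+y. ?f x * ennreal (k (x - y)) \<partial>lborel \<partial>lborel)
      + (\<integral>\<^sup>+y. \<integral>\<^sup>+x. ?f y * ennreal (k (x - y)) \<partial>lborel \<partial>lborel)) =
      (ennreal (1/2) + ennreal (1/2)) * ((\<integral>\<^sup>+z. ennreal (k z) \<partial>lborel) * (\<integral>\<^sup>+x. ?f x \<partial>lborel))"
    by (simp add: nn_integral_cmult nn_integral_multc k1 k2 algebra_simps)
  also have "ennreal (1/2) + ennreal (1/2) = 1" by (subst ennreal_plus[symmetric]) auto
  finally show ?thesis using mult_right_mono[OF A, of "\<integral>\<^sup>+x. ?f x \<partial>lborel"] by (simp add: order_trans)
qed

lemma chirp_kernel:
  "exp (\<i> * complex_of_real (a * \<xi> + b * \<xi>\<^sup>2)) * cnj (exp (\<i> * complex_of_real (a' * \<xi> + b' * \<xi>\<^sup>2))) =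
   exp (\<i> * complex_of_real ((a - a') * \<xi> + (b - b') * \<xi>\<^sup>2))"
  by (simp add: exp_cnj exp_add[symmetric] algebra_simps)

text \<open>The \<open>T T\<^sup>*\<close> argument. The sharp frequency cutoff is replaced by a Gaussian, whose kernel is explicit,
  because the dual operator is only measured in \<open>L\<^sup>2\<close> of the frequency variable.\<close>

lemma chirp_square_bound:
  fixes g :: "real \<Rightarrow> complex" and a b :: "real \<Rightarrow> real"
  assumes lam: "l > 0" and gm [measurable]: "g \<in> borel_measurable borel"
    and g2: "integrable lborel (\<lambda>\<xi>. (norm (g \<xi>))\<^sup>2)" and supp: "\<And>\<xi>. \<bar>\<xi>\<bar> > l \<Longrightarrow> g \<xi> = 0"
    and [measurable]: "a \<in> borel_measurable borel" "b \<in> borel_measurable borel" "k \<in> borel_measurable borel"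
    and k0: "\<And>z. k z \<ge> 0" and kA: "(\<integral>\<^sup>+z. ennreal (k z) \<partial>lborel) \<le> ennreal A" and A: "A > 0"
    and ker: "\<And>x y. \<bar>x\<bar> \<le> R \<Longrightarrow> \<bar>y\<bar> \<le> R \<Longrightarrow> x \<noteq> y \<Longrightarrow>
      norm (chirp_gaussian (1 / l\<^sup>2) (a x - a y) (b x - b y)) \<le> k (x - y)"
  shows "(\<integral>\<^sup>+x. ennreal (indicator {-R..R} x * (norm (chirp g (a x) (b x)))\<^sup>2) \<partial>lborel)
     \<le> ennreal (exp 1 * A * (LINT \<xi>|lborel. (norm (g \<xi>))\<^sup>2))"
proof -
  have gi: "integrable lborel g" by (rule integrable_of_square[OF gm g2 supp])
  define G where "G = (LINT \<xi>|lborel. (norm (g \<xi>))\<^sup>2)"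
  define F where "F = (\<lambda>x. indicator {-R..R} x *\<^sub>R chirp g (a x) (b x))"
  define n1 where "n1 = (LINT \<xi>|lborel. norm (g \<xi>))"
  have n1: "n1 \<ge> 0" by (simp add: n1_def)
  have [measurable]: "(\<lambda>x. chirp g (a x) (b x)) \<in> borel_measurable borel" by (rule measurable_chirp[OF gi]) measurable
  have [measurable]: "F \<in> borel_measurable borel" unfolding F_def by measurable
  have Fle: "norm (F x) \<le> n1 * indicator {-R..R} x" for x
    using norm_chirp_le[of g "a x" "b x"] by (auto simp: F_def n1_def split: split_indicator)
  have Fi: "integrable lborel F"
    by (rule Bochner_Integration.integrable_bound[of _ "\<lambda>x. n1 * indicator {-R..R} x"])
      (use Fle n1 in \<open>auto simp: abs_mult integrable_indicator_Icc\<close>)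
  have F2i: "integrable lborel (\<lambda>x. (norm (F x))\<^sup>2)"
  proof (rule Bochner_Integration.integrable_bound[of _ "\<lambda>x. n1\<^sup>2 * indicator {-R..R} x"])
    have "(norm (F x))\<^sup>2 \<le> n1\<^sup>2 * indicator {-R..R} x" for x
      using power_mono[OF Fle[of x], of 2] by (auto simp: power_mult_distrib split: split_indicator_asm)
    then show "AE x in lborel. norm ((norm (F x))\<^sup>2) \<le> norm (n1\<^sup>2 * indicator {-R..R} x :: real)" by (auto simp: abs_mult)
  qed (auto simp: integrable_indicator_Icc)
  define I where "I = (LINT x|lborel. (norm (F x))\<^sup>2)"
  have I0: "I \<ge> 0" by (simp add: I_def)
  define e where "e = (\<lambda>(x, \<xi>). exp (\<i> * complex_of_real (a x * \<xi> + b x * \<xi>\<^sup>2)))"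
  have e_meas [measurable]: "e \<in> borel_measurable (borel \<Otimes>\<^sub>M borel)" unfolding e_def by measurable
  have e1: "norm (e (x, \<xi>)) \<le> 1" for x \<xi> by (simp add: e_def)
  define \<Phi> where "\<Phi> = (\<lambda>\<xi>. LINT x|lborel. cnj (F x) * e (x, \<xi>))"
  have \<Phi>_meas [measurable]: "\<Phi> \<in> borel_measurable borel" unfolding \<Phi>_def by measurable
  define n2 where "n2 = (LINT x|lborel. norm (F x))"
  have n2: "n2 \<ge> 0" by (simp add: n2_def)
  have \<Phi>le: "norm (\<Phi> \<xi>) \<le> n2" for \<xi>
    unfolding \<Phi>_def n2_def by (rule order_trans[OF integral_norm_bound]) (simp add: e_def norm_mult)
  \<comment> \<open>The Gaussian cutoff is at least \<open>1 / exp 1\<close> on the support of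
    \<open>g\<close>, which is where the factor \<open>exp 1\<close> of the conclusion comes
    from.\<close>
  define w where "w = (\<lambda>\<xi>::real. exp (- (1 / l\<^sup>2) * \<xi>\<^sup>2))"
  have wi: "integrable lborel w" unfolding w_def by (rule integrable_gaussian) (use lam in auto)
  have [measurable]: "w \<in> borel_measurable borel" unfolding w_def by measurable
  have w0: "w \<xi> \<ge> 0" for \<xi> by (simp add: w_def)
  have wci: "integrable lborel (\<lambda>\<xi>. complex_of_real (w \<xi>))" using wi by auto
  define W where "W = (\<lambda>\<xi>. complex_of_real (w \<xi>) * cnj (\<Phi> \<xi>))"
  have w\<Phi>: "w \<xi> * norm (\<Phi> \<xi>) \<le> n2 * w \<xi>" for \<xi>
    using mult_left_mono[OF \<Phi>le w0, of \<xi> \<xi>] by (simp add: mult.commute)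
  have w\<Phi>2: "w \<xi> * (norm (\<Phi> \<xi>))\<^sup>2 \<le> n2\<^sup>2 * w \<xi>" for \<xi>
    using mult_left_mono[OF power_mono[OF \<Phi>le norm_ge_zero, of \<xi> 2] w0, of \<xi>] by (simp add: mult.commute)
  have Wi: "integrable lborel W"
    unfolding W_def
    by (rule Bochner_Integration.integrable_bound[of _ "\<lambda>\<xi>. n2 * w \<xi>"])
      (use wi n2 w0 w\<Phi> in \<open>auto simp: norm_mult abs_mult\<close>)
  define J where "J = (LINT \<xi>|lborel. w \<xi> * (norm (\<Phi> \<xi>))\<^sup>2)"
  have wPi: "integrable lborel (\<lambda>\<xi>. w \<xi> * (norm (\<Phi> \<xi>))\<^sup>2)"
    by (rule Bochner_Integration.integrable_bound[of _ "\<lambda>\<xi>. n2\<^sup>2 * w \<xi>"])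
      (use wi n2 w0 w\<Phi>2 in \<open>auto simp: norm_mult abs_mult\<close>)
  have J0: "J \<ge> 0" unfolding J_def by (rule Bochner_Integration.integral_nonneg) (simp add: w0)
  have "complex_of_real J = (LINT \<xi>|lborel. W \<xi> * (LINT x|lborel. cnj (F x) * e (x, \<xi>)))"
    unfolding J_def integral_complex_of_real[symmetric]
  proof (intro Bochner_Integration.integral_cong refl)
    fix \<xi>
    have "(LINT x|lborel. cnj (F x) * e (x, \<xi>)) = \<Phi> \<xi>" by (simp add: \<Phi>_def)
    then show "complex_of_real (w \<xi> * (norm (\<Phi> \<xi>))\<^sup>2) = W \<xi> * (LINT x|lborel. cnj (F x) * e (x, \<xi>))"
      by (simp only: W_def of_real_mult complex_norm_square) (simp add: mult_ac)
  qed
  also have "\<dots> = (LINT x|lborel. cnj (F x) * (LINT \<xi>|lborel. W \<xi> * e (x, \<xi>)))"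
    by (rule integral_swap_bounded_kernel[symmetric, OF _ Wi e_meas e1]) (use Fi in auto)
  also have "\<dots> = (LINT x|lborel. cnj (F x) * (LINT y|lborel. F y * chirp_gaussian (1 / l\<^sup>2) (a x - a y) (b x - b y)))"
  proof (rule Bochner_Integration.integral_cong[OF refl], rule arg_cong2[where f="(*)", OF refl])
    fix x :: real
    have "(LINT \<xi>|lborel. W \<xi> * e (x, \<xi>)) = (LINT \<xi>|lborel. w \<xi> * (LINT y|lborel. F y * (cnj (e (y, \<xi>)) * e (x, \<xi>))))"
    proof (intro Bochner_Integration.integral_cong refl)
      fix \<xi>
      have "cnj (\<Phi> \<xi>) = (LINT y|lborel. F y * cnj (e (y, \<xi>)))"
        unfolding \<Phi>_def by (subst Bochner_Integration.integral_cnj[symmetric]) simp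
      then have "cnj (\<Phi> \<xi>) * e (x, \<xi>) = (LINT y|lborel. F y * cnj (e (y, \<xi>))) * e (x, \<xi>)" by simp
      also have "\<dots> = (LINT y|lborel. F y * (cnj (e (y, \<xi>)) * e (x, \<xi>)))"
        by (subst integral_mult_left_zero[symmetric]) (simp add: mult_ac)
      finally show "W \<xi> * e (x, \<xi>) = w \<xi> * (LINT y|lborel. F y * (cnj (e (y, \<xi>)) * e (x, \<xi>)))"
        by (simp add: W_def mult.assoc)
    qed
    also have "\<dots> = (LINT y|lborel. F y * (LINT \<xi>|lborel. w \<xi> * (cnj (e (y, \<xi>)) * e (x, \<xi>))))"
    proof -
      let ?m = "\<lambda>(y, \<xi>). cnj (e (y, \<xi>)) * e (x, \<xi>)"
      have "?m \<in> borel_measurable (borel \<Otimes>\<^sub>M borel)" by measurable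
      from integral_swap_bounded_kernel[OF Fi wci this, of 1] show ?thesis by (simp add: e_def norm_mult)
    qed
    also have "\<dots> = (LINT y|lborel. F y * chirp_gaussian (1 / l\<^sup>2) (a x - a y) (b x - b y))"
    proof -
      have "(LINT \<xi>|lborel. w \<xi> * (cnj (e (y, \<xi>)) * e (x, \<xi>))) = chirp_gaussian (1 / l\<^sup>2) (a x - a y) (b x - b y)" for y
        unfolding chirp_def chirp_kernel[symmetric]
        by (intro Bochner_Integration.integral_cong refl) (simp add: e_def w_def mult_ac)
      then show ?thesis by simp
    qed
    finally show "(LINT \<xi>|lborel. W \<xi> * e (x, \<xi>)) = \<dots>" .
  qed
  finally have "ennreal J = ennreal (norm \<dots>)" using J0 by (metis norm_of_real abs_of_nonneg)
  also have "\<dots> \<le> (\<integral>\<^sup>+x. ennreal (norm (cnj (F x) * (LINT y|lborel. F y * chirp_gaussian (1 / l\<^sup>2) (a x - a y) (b x - b y)))) \<partial>lborel)"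
    by (rule ennreal_norm_integral_le)
  also have "\<dots> \<le> (\<integral>\<^sup>+x. \<integral>\<^sup>+y. ennreal (norm (F x) * norm (F y) * k (x - y)) \<partial>lborel \<partial>lborel)"
  proof (intro nn_integral_mono)
    fix x :: real
    let ?Z = "\<lambda>y. F y * chirp_gaussian (1 / l\<^sup>2) (a x - a y) (b x - b y)"
    have "ennreal (norm (cnj (F x) * integral\<^sup>L lborel ?Z)) = ennreal (norm (F x)) * ennreal (norm (integral\<^sup>L lborel ?Z))"
      by (simp only: norm_mult complex_mod_cnj ennreal_mult norm_ge_zero)
    also have "\<dots> \<le> ennreal (norm (F x)) * (\<integral>\<^sup>+y. ennreal (norm (?Z y)) \<partial>lborel)"
      by (intro mult_left_mono ennreal_norm_integral_le) simp
    also have "\<dots> \<le> (\<integral>\<^sup>+y. ennreal (norm (F x)) * ennreal (norm (F y * chirp_gaussian (1 / l\<^sup>2) (a x - a y) (b x - b y))) \<partial>lborel)"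
    proof -
      have [measurable]: "(\<lambda>y. chirp_gaussian (1 / l\<^sup>2) (a x - a y) (b x - b y)) \<in> borel_measurable borel"
        by (rule measurable_chirp) (use wci in \<open>auto simp: w_def\<close>)
      have "(\<lambda>y. ennreal (norm (?Z y))) \<in> borel_measurable lborel" by measurable
      from nn_integral_cmult[OF this] show ?thesis by simp
    qed
    also have "\<dots> \<le> (\<integral>\<^sup>+y. ennreal (norm (F x) * norm (F y) * k (x - y)) \<partial>lborel)"
    proof (rule nn_integral_mono_AE)
      \<comment> \<open>The kernel is controlled by \<open>k\<close> off the diagonal only; the
        diagonal is a null set for each fixed \<open>x\<close>.\<close>
      have "AE y in lborel. y \<noteq> x" by (rule AE_lborel_singleton)
      then show "AE y in lborel. ennreal (norm (F x)) * ennreal (norm (F y * chirp_gaussian (1 / l\<^sup>2) (a x - a y) (b x - b y)))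
         \<le> ennreal (norm (F x) * norm (F y) * k (x - y))"
      proof (eventually_elim)
        case (elim y)
        show ?case
        proof (cases "\<bar>x\<bar> \<le> R \<and> \<bar>y\<bar> \<le> R")
          case True
          then have "norm (F x) * (norm (F y) * norm (chirp_gaussian (1 / l\<^sup>2) (a x - a y) (b x - b y))) \<le> norm (F x) * (norm (F y) * k (x - y))"
            using ker[of x y] elim by (intro mult_left_mono) auto
          then show ?thesis by (simp add: ennreal_mult[symmetric] norm_mult mult.assoc ennreal_leI)
        next
          case False
          then have "F x = 0 \<or> F y = 0" by (auto simp: F_def abs_le_iff split: split_indicator)
          then show ?thesis by auto
        qed
      qed
    qed
    finally show "ennreal (norm (cnj (F x) * (LINT y|lborel. F y * chirp_gaussian (1 / l\<^sup>2) (a x - a y) (b x - b y)))) \<le> \<dots>" .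
  qed
  also have "\<dots> \<le> ennreal A * (\<integral>\<^sup>+x. ennreal ((norm (F x))\<^sup>2) \<partial>lborel)"
    by (rule schur_test[OF _ _ k0 kA]) measurable
  also have "\<dots> = ennreal (A * I)"
    using F2i A by (subst nn_integral_eq_integral) (auto simp: I_def ennreal_mult)
  finally have J: "J \<le> A * I" using A I0 by (simp add: ennreal_le_iff)
  have "complex_of_real I = (LINT x|lborel. cnj (F x) * (LINT \<xi>|lborel. g \<xi> * e (x, \<xi>)))"
    unfolding I_def integral_complex_of_real[symmetric]
  proof (intro Bochner_Integration.integral_cong refl)
    fix x
    have "(LINT \<xi>|lborel. g \<xi> * e (x, \<xi>)) = chirp g (a x) (b x)"
      unfolding chirp_def by (intro Bochner_Integration.integral_cong refl) (simp add: e_def mult.commute)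
    then show "complex_of_real ((norm (F x))\<^sup>2) = cnj (F x) * (LINT \<xi>|lborel. g \<xi> * e (x, \<xi>))"
      unfolding complex_norm_square by (simp add: F_def split: split_indicator)
  qed
  also have "\<dots> = (LINT \<xi>|lborel. g \<xi> * \<Phi> \<xi>)"
    unfolding \<Phi>_def by (rule integral_swap_bounded_kernel[OF _ gi e_meas e1]) (use Fi in auto)
  finally have Ieq: "complex_of_real I = (LINT \<xi>|lborel. g \<xi> * \<Phi> \<xi>)" .
  have g\<Phi>: "norm (g \<xi> * \<Phi> \<xi>) \<le> norm (complex_of_real n2 * g \<xi>)" for \<xi>
    using mult_right_mono[OF \<Phi>le, of "norm (g \<xi>)" \<xi>] n2 by (simp add: norm_mult mult.commute[of "norm (g \<xi>)"])
  have "I = norm (LINT \<xi>|lborel. g \<xi> * \<Phi> \<xi>)" using I0 by (metis Ieq norm_of_real abs_of_nonneg)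
  also have "\<dots> \<le> (LINT \<xi>|lborel. norm (g \<xi> * \<Phi> \<xi>))" by (rule integral_norm_bound)
  \<comment> \<open>Weighted arithmetic-geometric mean in place of Cauchy-Schwarz. The weights are
    tuned so that \<open>J \<le> A * I\<close> turns the second term into \<open>I / 2\<close>,
    which is absorbed on the left. This is legitimate since \<open>I\<close> is finite:
    \<open>F\<close> is bounded with bounded support.\<close>
  also have "\<dots> \<le> (LINT \<xi>|lborel. (exp 1 * A / 2) * (norm (g \<xi>))\<^sup>2 + (1 / (2 * A)) * (w \<xi> * (norm (\<Phi> \<xi>))\<^sup>2))"
  proof (rule integral_mono)
    show "integrable lborel (\<lambda>\<xi>. norm (g \<xi> * \<Phi> \<xi>))"
      by (rule integrable_norm, rule Bochner_Integration.integrable_bound[of _ "\<lambda>\<xi>. of_real n2 * g \<xi>"])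
        (use gi g\<Phi> in auto)
    show "integrable lborel (\<lambda>\<xi>. (exp 1 * A / 2) * (norm (g \<xi>))\<^sup>2 + (1 / (2 * A)) * (w \<xi> * (norm (\<Phi> \<xi>))\<^sup>2))"
      by (intro Bochner_Integration.integrable_add integrable_mult_right g2 wPi)
    fix \<xi> :: real
    show "norm (g \<xi> * \<Phi> \<xi>) \<le> (exp 1 * A / 2) * (norm (g \<xi>))\<^sup>2 + (1 / (2 * A)) * (w \<xi> * (norm (\<Phi> \<xi>))\<^sup>2)"
    proof (cases "\<bar>\<xi>\<bar> > l")
      case True
      then show ?thesis using A w0[of \<xi>] supp[of \<xi>] by simp
    next
      case False
      then have "\<xi>\<^sup>2 \<le> l\<^sup>2" using lam by (simp add: abs_le_square_iff[symmetric])
      then have "exp (-1) \<le> w \<xi>" using lam by (simp add: w_def)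
      then have w1: "1 / exp 1 \<le> w \<xi>" by (simp add: exp_minus field_simps)
      let ?u = "norm (g \<xi>)" and ?v = "norm (\<Phi> \<xi>)" and ?c = "exp 1 * A"
      have c: "?c > 0" using A by simp
      have "0 \<le> (?c * ?u - ?v)\<^sup>2 / (2 * ?c)" using c by (intro divide_nonneg_pos) auto
      also have "\<dots> = ?c / 2 * ?u\<^sup>2 + 1 / (2 * ?c) * ?v\<^sup>2 - ?u * ?v"
        using c A by (simp add: power2_eq_square field_simps)
      finally have "?u * ?v \<le> ?c / 2 * ?u\<^sup>2 + 1 / (2 * A) * (1 / exp 1 * ?v\<^sup>2)" by (simp add: mult_ac)
      also have "\<dots> \<le> ?c / 2 * ?u\<^sup>2 + 1 / (2 * A) * (w \<xi> * ?v\<^sup>2)"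
        using A by (intro add_left_mono mult_left_mono mult_right_mono w1) auto
      finally show ?thesis by (simp add: norm_mult)
    qed
  qed
  also have "\<dots> = (exp 1 * A / 2) * G + (1 / (2 * A)) * J"
    unfolding G_def J_def using g2 wPi by (subst Bochner_Integration.integral_add) auto
  also have "\<dots> \<le> (exp 1 * A / 2) * G + (1 / (2 * A)) * (A * I)"
    using J A by (intro add_left_mono mult_left_mono) auto
  also have "\<dots> = (exp 1 * A / 2) * G + I / 2" using A by simp
  finally have "I \<le> exp 1 * A * G" by simp
  moreover have "(\<integral>\<^sup>+x. ennreal (indicator {-R..R} x * (norm (chirp g (a x) (b x)))\<^sup>2) \<partial>lborel) = (\<integral>\<^sup>+x. ennreal ((norm (F x))\<^sup>2) \<partial>lborel)"
    by (intro nn_integral_cong) (auto simp: F_def split: split_indicator)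
  moreover have "\<dots> = ennreal I" using F2i by (subst nn_integral_eq_integral) (auto simp: I_def)
  ultimately show ?thesis by (simp add: G_def ennreal_leI)
qed

text \<open>Linearisation of a maximum over finitely many parameters. Both functions must select the
  same index at each point, since the kernel bound is available only for pairs that come from a
  common parameter.\<close>

lemma measurable_argmax:
  fixes a b :: "nat \<Rightarrow> real \<Rightarrow> real"
  assumes gi: "integrable lborel g"
    and m [measurable]: "\<And>i. a i \<in> borel_measurable borel" "\<And>i. b i \<in> borel_measurable borel"
  shows "\<exists>a' \<in> borel_measurable borel. \<exists>b' \<in> borel_measurable borel.
    (\<forall>x. \<exists>i. a' x = a i x \<and> b' x = b i x) \<and>
    (\<forall>x. \<forall>i\<le>N. norm (chirp g (a i x) (b i x)) \<le> norm (chirp g (a' x) (b' x)))"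
proof (induction N)
  case 0
  show ?case by (rule bexI[of _ "a 0"], rule bexI[of _ "b 0"]) auto
next
  case (Suc N)
  then obtain a' b' where [measurable]: "a' \<in> borel_measurable borel" "b' \<in> borel_measurable borel"
    and ex: "\<And>x. \<exists>i. a' x = a i x \<and> b' x = b i x"
    and le: "\<And>x i. i \<le> N \<Longrightarrow> norm (chirp g (a i x) (b i x)) \<le> norm (chirp g (a' x) (b' x))"
    by metis
  note [measurable] = measurable_chirp[OF gi]
  let ?P = "\<lambda>x. norm (chirp g (a' x) (b' x)) < norm (chirp g (a (Suc N) x) (b (Suc N) x))"
  have [measurable]: "Measurable.pred borel ?P" by measurable
  show ?case
  proof (rule bexI[of _ "\<lambda>x. if ?P x then a (Suc N) x else a' x"],
      rule bexI[of _ "\<lambda>x. if ?P x then b (Suc N) x else b' x"], intro conjI allI impI)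
    fix x
    show "\<exists>i. (if ?P x then a (Suc N) x else a' x) = a i x \<and> (if ?P x then b (Suc N) x else b' x) = b i x"
      using ex[of x] by auto
    fix i assume "i \<le> Suc N"
    then consider "i \<le> N" | "i = Suc N" by linarith
    then show "norm (chirp g (a i x) (b i x)) \<le>
       norm (chirp g (if ?P x then a (Suc N) x else a' x) (if ?P x then b (Suc N) x else b' x))"
      by cases (use le[of i x] in auto)
  qed measurable
qed

text \<open>The bound for a linearised maximum does not depend on the number of parameters. Monotone
  convergence therefore extends it to a countable dense set, where the supremum is measurable, and
  continuity of the chirp extends the pointwise bound to all of \<Theta>.\<close>

lemma chirp_maximal:
  fixes g :: "real \<Rightarrow> complex" and a b :: "'p::{metric_space, second_countable_topology} \<Rightarrow> real \<Rightarrow> real"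
  assumes lam: "l > 0" and gm [measurable]: "g \<in> borel_measurable borel"
    and g2: "integrable lborel (\<lambda>\<xi>. (norm (g \<xi>))\<^sup>2)" and supp: "\<And>\<xi>. \<bar>\<xi>\<bar> > l \<Longrightarrow> g \<xi> = 0"
    and ne: "\<Theta> \<noteq> {}"
    and m: "\<And>\<theta>. \<theta> \<in> \<Theta> \<Longrightarrow> a \<theta> \<in> borel_measurable borel" "\<And>\<theta>. \<theta> \<in> \<Theta> \<Longrightarrow> b \<theta> \<in> borel_measurable borel"
    and cont: "\<And>x. continuous_on \<Theta> (\<lambda>\<theta>. a \<theta> x)" "\<And>x. continuous_on \<Theta> (\<lambda>\<theta>. b \<theta> x)"
    and [measurable]: "k \<in> borel_measurable borel"
    and k0: "\<And>z. k z \<ge> 0" and kA: "(\<integral>\<^sup>+z. ennreal (k z) \<partial>lborel) \<le> ennreal A" and A: "A > 0"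
    and ker: "\<And>x y \<theta> \<theta>'. \<bar>x\<bar> \<le> R \<Longrightarrow> \<bar>y\<bar> \<le> R \<Longrightarrow> x \<noteq> y \<Longrightarrow> \<theta> \<in> \<Theta> \<Longrightarrow> \<theta>' \<in> \<Theta> \<Longrightarrow>
      norm (chirp_gaussian (1 / l\<^sup>2) (a \<theta> x - a \<theta>' y) (b \<theta> x - b \<theta>' y)) \<le> k (x - y)"
  shows "\<exists>M \<in> borel_measurable borel.
    (\<forall>x \<theta>. \<bar>x\<bar> \<le> R \<longrightarrow> \<theta> \<in> \<Theta> \<longrightarrow> ennreal ((norm (chirp g (a \<theta> x) (b \<theta> x)))\<^sup>2) \<le> M x) \<and>
    (\<integral>\<^sup>+x. M x \<partial>lborel) \<le> ennreal (exp 1 * A * (LINT \<xi>|lborel. (norm (g \<xi>))\<^sup>2))"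
proof -
  have gi: "integrable lborel g" by (rule integrable_of_square[OF gm g2 supp])
  obtain T where T: "countable T" "T \<subseteq> \<Theta>" "\<Theta> \<subseteq> closure T" using separable by blast
  have "T \<noteq> {}" using T ne by auto
  define d where "d = from_nat_into T"
  have rd: "range d = T" unfolding d_def using T \<open>T \<noteq> {}\<close> by simp
  have dT: "d i \<in> \<Theta>" for i using rd T by auto
  have [measurable]: "a (d i) \<in> borel_measurable borel" "b (d i) \<in> borel_measurable borel" for i
    using m dT by auto
  note [measurable] = measurable_chirp[OF gi]
  define f where "f = (\<lambda>i x. ennreal (indicator {-R..R} x * (norm (chirp g (a (d i) x) (b (d i) x)))\<^sup>2))"
  have [measurable]: "f i \<in> borel_measurable borel" for i unfolding f_def by measurable
  define S where "S = (\<lambda>N x. SUP i\<in>{..N::nat}. f i x)"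
  have [measurable]: "S N \<in> borel_measurable borel" for N unfolding S_def by measurable
  have incS: "incseq S" unfolding S_def incseq_def le_fun_def by (auto intro!: SUP_subset_mono)
  have intS: "(\<integral>\<^sup>+x. S N x \<partial>lborel) \<le> ennreal (exp 1 * A * (LINT \<xi>|lborel. (norm (g \<xi>))\<^sup>2))" for N
  proof -
    obtain a' b' where ab: "a' \<in> borel_measurable borel" "b' \<in> borel_measurable borel"
      and ex: "\<And>x. \<exists>i. a' x = a (d i) x \<and> b' x = b (d i) x"
      and le: "\<And>x i. i \<le> N \<Longrightarrow> norm (chirp g (a (d i) x) (b (d i) x)) \<le> norm (chirp g (a' x) (b' x))"
      using measurable_argmax[OF gi, of "\<lambda>i. a (d i)" "\<lambda>i. b (d i)" N] by auto
    have "(\<integral>\<^sup>+x. S N x \<partial>lborel) \<le> (\<integral>\<^sup>+x. ennreal (indicator {-R..R} x * (norm (chirp g (a' x) (b' x)))\<^sup>2) \<partial>lborel)"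
      unfolding S_def f_def
      by (intro nn_integral_mono SUP_least ennreal_leI mult_left_mono power_mono le) auto
    also have "\<dots> \<le> ennreal (exp 1 * A * (LINT \<xi>|lborel. (norm (g \<xi>))\<^sup>2))"
    proof (rule chirp_square_bound[OF lam gm g2 supp ab _ k0 kA A])
      fix x y :: real assume *: "\<bar>x\<bar> \<le> R" "\<bar>y\<bar> \<le> R" "x \<noteq> y"
      obtain i j where "a' x = a (d i) x" "b' x = b (d i) x" "a' y = a (d j) y" "b' y = b (d j) y" using ex by metis
      then show "norm (chirp_gaussian (1 / l\<^sup>2) (a' x - a' y) (b' x - b' y)) \<le> k (x - y)" using ker[OF * dT dT] by simp
    qed auto
    finally show ?thesis .
  qed
  define M where "M = (\<lambda>x. SUP N. S N x)"
  show ?thesis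
  proof (intro bexI conjI allI impI)
    show "M \<in> borel_measurable borel" unfolding M_def by measurable
    show "(\<integral>\<^sup>+x. M x \<partial>lborel) \<le> ennreal (exp 1 * A * (LINT \<xi>|lborel. (norm (g \<xi>))\<^sup>2))"
      unfolding M_def by (subst nn_integral_monotone_convergence_SUP[OF incS]) (auto intro!: SUP_least intS)
    fix x \<theta> assume x: "\<bar>x\<bar> \<le> R" and th: "\<theta> \<in> \<Theta>"
    have fM: "f i x \<le> M x" for i
      unfolding M_def S_def by (rule SUP_upper2[of i]) (auto intro: SUP_upper)
    have "\<theta> \<in> closure T" using T th by auto
    then obtain u where u: "\<And>n. u n \<in> T" "u \<longlonglongrightarrow> \<theta>" unfolding closure_sequential by auto
    have uT: "\<And>n. u n \<in> \<Theta>" using u T by auto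
    have "(\<lambda>n. (a (u n) x, b (u n) x)) \<longlonglongrightarrow> (a \<theta> x, b \<theta> x)"
      using continuous_on_tendsto_compose[OF cont(1) u(2) th] continuous_on_tendsto_compose[OF cont(2) u(2) th] uT
      by (intro tendsto_Pair) auto
    from continuous_on_tendsto_compose[OF continuous_chirp[OF gi] this]
    have "(\<lambda>n. ennreal ((norm (chirp g (a (u n) x) (b (u n) x)))\<^sup>2)) \<longlonglongrightarrow> ennreal ((norm (chirp g (a \<theta> x) (b \<theta> x)))\<^sup>2)"
      by (auto intro!: tendsto_intros)
    then show "ennreal ((norm (chirp g (a \<theta> x) (b \<theta> x)))\<^sup>2) \<le> M x"
    proof (rule LIMSEQ_le_const2, intro exI allI impI)
      fix n
      obtain i where "u n = d i" using rd u(1)[of n] by auto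
      then show "ennreal ((norm (chirp g (a (u n) x) (b (u n) x)))\<^sup>2) \<le> M x"
        using fM[of i] x by (simp add: f_def abs_le_iff)
    qed
  qed
qed

section \<open>Decay of the Gaussian kernel\<close>

text \<open>Weakens exponential decay to any chosen power between 0 and 1, so that Gaussian decay
  can be traded for exactly the singularity that Schur's test tolerates.\<close>

lemma exp_minus_le_powr:
  fixes y r :: real
  assumes "0 \<le> r" "r \<le> 1" "y > 0"
  shows "exp (- y) \<le> y powr (- r)"
proof -
  have "y powr r \<le> exp y"
  proof (cases "y \<le> 1")
    case True
    have "y powr r \<le> 1" using assms True powr_mono2[of r y 1] by auto
    then show ?thesis using assms by (smt (verit) one_le_exp_iff)
  next
    case False
    have "y powr r \<le> y powr 1" using assms False by (intro powr_mono) auto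
    also have "\<dots> = y" using assms by simp
    also have "\<dots> \<le> exp y" using exp_ge_add_one_self[of y] by linarith
    finally show ?thesis .
  qed
  then show ?thesis using assms by (simp add: exp_minus powr_minus le_imp_inverse_le)
qed

lemma powr_square: "(x powr y)\<^sup>2 = x powr (2 * y)" for x :: real
  by (simp add: power2_eq_square powr_add[symmetric])

lemma norm_chirp_gaussian_scaled:
  assumes l: "l > 0"
  shows "(norm (chirp_gaussian (1 / l\<^sup>2) a b))\<^sup>2 =
    pi * l\<^sup>2 / sqrt (1 + b\<^sup>2 * l ^ 4) * exp (- (a\<^sup>2 * l\<^sup>2 / (2 * (1 + b\<^sup>2 * l ^ 4))))"
proof -
  have D: "(1 / l\<^sup>2)\<^sup>2 + b\<^sup>2 = (1 + b\<^sup>2 * l ^ 4) / (l\<^sup>2)\<^sup>2"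
    using l by (simp add: field_simps power2_eq_square power4_eq_xxxx)
  have D0: "1 + b\<^sup>2 * l ^ 4 > 0" by (simp add: add_pos_nonneg)
  have "sqrt ((1 + b\<^sup>2 * l ^ 4) / (l\<^sup>2)\<^sup>2) = sqrt (1 + b\<^sup>2 * l ^ 4) / l\<^sup>2"
    by (subst real_sqrt_divide) (simp only: real_sqrt_abs abs_power2)
  moreover have "a\<^sup>2 * (1 / l\<^sup>2) / (2 * ((1 + b\<^sup>2 * l ^ 4) / (l\<^sup>2)\<^sup>2)) = a\<^sup>2 * l\<^sup>2 / (2 * (1 + b\<^sup>2 * l ^ 4))"
    using l D0 by (simp add: power2_eq_square)
  ultimately show ?thesis
    using norm_chirp_gaussian[of "1 / l\<^sup>2" a b] l unfolding D by simp
qed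

text \<open>The factor \<open>sqrt (1 + b^2 * l^4)\<close> measures how far the kernel has spread
  beyond its initial width \<open>1 / l\<close>. At \<open>r = 1/2\<close> it drops out and the
  bound is uniform in time; a larger \<open>r\<close> buys decay in \<open>a\<close> and in
  \<open>l\<close> at the price of growth in time.\<close>

lemma kernel_decay:
  assumes l: "l > 0" and r: "0 \<le> r" "r \<le> 1" and a: "a \<noteq> 0"
  shows "norm (chirp_gaussian (1 / l\<^sup>2) a b) \<le>
    3 * l powr (1 - r) * (1 + b\<^sup>2 * l ^ 4) powr ((r - 1/2) / 2) * \<bar>a\<bar> powr (- r)"
proof (rule power2_le_imp_le)
  define D where "D = 1 + b\<^sup>2 * l ^ 4"
  have D: "D > 0" unfolding D_def by (simp add: add_pos_nonneg)
  have "(norm (chirp_gaussian (1 / l\<^sup>2) a b))\<^sup>2 = pi * l\<^sup>2 / sqrt D * exp (- (a\<^sup>2 * l\<^sup>2 / (2 * D)))"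
    using norm_chirp_gaussian_scaled[OF l] by (simp add: D_def)
  also have "\<dots> \<le> pi * l\<^sup>2 / sqrt D * (a\<^sup>2 * l\<^sup>2 / (2 * D)) powr (- r)"
    using a l D r by (intro mult_left_mono exp_minus_le_powr) auto
  also have "(a\<^sup>2 * l\<^sup>2 / (2 * D)) powr (- r) = 2 powr r * (D powr r * l powr (- 2 * r) * \<bar>a\<bar> powr (- 2 * r))"
  proof -
    have "(a\<^sup>2) powr (- r) = (\<bar>a\<bar> powr 2) powr (- r)" using a by simp
    then have aa: "(a\<^sup>2) powr (- r) = \<bar>a\<bar> powr (- 2 * r)" by (simp only: powr_powr) simp
    have "(l\<^sup>2) powr (- r) = (l powr 2) powr (- r)" using l by simp
    then have ll: "(l\<^sup>2) powr (- r) = l powr (- 2 * r)" by (simp only: powr_powr) simp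
    have "(a\<^sup>2 * l\<^sup>2 / (2 * D)) powr (- r) = (a\<^sup>2) powr (- r) * (l\<^sup>2) powr (- r) * (2 * D) powr r"
      using a l D by (simp add: powr_divide powr_mult powr_minus divide_simps)
    then show ?thesis unfolding aa ll using D by (simp add: powr_mult mult_ac)
  qed
  also have "pi * l\<^sup>2 / sqrt D = pi * (l powr 2 * D powr (-1/2))"
    using l D by (simp add: powr_half_sqrt[symmetric] powr_minus divide_simps)
  also have "pi * (l powr 2 * D powr (-1/2)) * (2 powr r * (D powr r * l powr (- 2 * r) * \<bar>a\<bar> powr (- 2 * r)))
      = (pi * 2 powr r) * ((l powr 2 * l powr (- 2 * r)) * (D powr (-1/2) * D powr r) * \<bar>a\<bar> powr (- 2 * r))"
    by (simp add: mult_ac)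
  also have "\<dots> \<le> 9 * ((l powr 2 * l powr (- 2 * r)) * (D powr (-1/2) * D powr r) * \<bar>a\<bar> powr (- 2 * r))"
  proof (rule mult_right_mono)
    have "2 powr r \<le> (2::real) powr 1" using r by (intro powr_mono) auto
    then have "pi * 2 powr r \<le> 4 * 2" using pi_less_4 by (intro mult_mono) auto
    then show "pi * 2 powr r \<le> 9" by simp
  qed auto
  also have "\<dots> = (3 * l powr (1 - r) * D powr ((r - 1/2) / 2) * \<bar>a\<bar> powr (- r))\<^sup>2"
  proof -
    have e: "2 * ((r - 1/2) / 2) = -1/2 + r" "2 * (1 - r) = 2 + -2 * r" "2 * - r = -2 * r"
      by (simp_all add: field_simps)
    show ?thesis by (simp only: power_mult_distrib powr_square e powr_add) simp
  qed
  finally show "(norm (chirp_gaussian (1 / l\<^sup>2) a b))\<^sup>2 \<le> (3 * l powr (1 - r) * (1 + b\<^sup>2 * l ^ 4) powr ((r - 1/2) / 2) * \<bar>a\<bar> powr (- r))\<^sup>2"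
    by (simp add: D_def)
qed simp

text \<open>Interpolates between the dispersive decay at \<eta> = 0 and the trivial bound by
  \<open>l\<close> at \<eta> = 1. A small positive \<eta> is what makes the resulting singularity in
  \<open>x - y\<close> integrable when \<open>b\<close> is at least of order
  \<open>(x - y)^2\<close>.\<close>

lemma kernel_dispersive:
  assumes l: "l > 0" and eta: "0 \<le> \<eta>" "\<eta> \<le> 1" and b: "b \<noteq> 0"
  shows "norm (chirp_gaussian (1 / l\<^sup>2) a b) \<le> 2 * l powr \<eta> * \<bar>b\<bar> powr ((\<eta> - 1) / 2)"
proof (rule power2_le_imp_le)
  define S where "S = sqrt ((1/l\<^sup>2)\<^sup>2 + b\<^sup>2)"
  have S1: "S \<ge> 1 / l\<^sup>2" unfolding S_def by (rule real_le_rsqrt) simp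
  have S2: "S \<ge> \<bar>b\<bar>" unfolding S_def by (rule real_le_rsqrt) simp
  have S0: "S > 0" using S2 b by simp
  have "(1 / l\<^sup>2) powr \<eta> * \<bar>b\<bar> powr (1 - \<eta>) \<le> S powr \<eta> * S powr (1 - \<eta>)"
    using S1 S2 eta by (intro mult_mono powr_mono2) auto
  also have "\<dots> = S" using S0 by (simp add: powr_add[symmetric])
  finally have *: "(1 / l\<^sup>2) powr \<eta> * \<bar>b\<bar> powr (1 - \<eta>) \<le> S" .
  have pos: "(1 / l\<^sup>2) powr \<eta> * \<bar>b\<bar> powr (1 - \<eta>) > 0" using l b by simp
  have "(norm (chirp_gaussian (1 / l\<^sup>2) a b))\<^sup>2 = pi / S * exp (- (a\<^sup>2 * (1/l\<^sup>2)) / (2 * ((1/l\<^sup>2)\<^sup>2 + b\<^sup>2)))"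
    unfolding S_def using l by (subst norm_chirp_gaussian) auto
  also have "\<dots> \<le> pi / S * 1" using S0 by (intro mult_left_mono) (auto simp: divide_nonneg_nonneg)
  also have "\<dots> \<le> 4 / ((1 / l\<^sup>2) powr \<eta> * \<bar>b\<bar> powr (1 - \<eta>))"
    using * pos pi_less_4 S0 by (simp add: frac_le)
  also have "\<dots> = (2 * l powr \<eta> * \<bar>b\<bar> powr ((\<eta> - 1) / 2))\<^sup>2"
  proof -
    have "(1 / l\<^sup>2) powr \<eta> = (l powr (-2)) powr \<eta>" using l by (simp add: powr_minus divide_simps)
    also have "\<dots> = l powr (- (2 * \<eta>))" by (simp add: powr_powr)
    finally have "(1 / l\<^sup>2) powr \<eta> = 1 / l powr (2 * \<eta>)" by (simp add: powr_minus_divide)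
    moreover have "\<bar>b\<bar> powr (1 - \<eta>) = 1 / \<bar>b\<bar> powr (\<eta> - 1)" using powr_minus_divide[of "\<bar>b\<bar>" "\<eta> - 1"] by simp
    moreover have "2 * ((\<eta> - 1) / 2) = \<eta> - 1" by simp
    ultimately show ?thesis by (simp only: power_mult_distrib powr_square) simp
  qed
  finally show "(norm (chirp_gaussian (1 / l\<^sup>2) a b))\<^sup>2 \<le> (2 * l powr \<eta> * \<bar>b\<bar> powr ((\<eta> - 1) / 2))\<^sup>2" .
qed simp

lemma kernel_le:
  assumes l: "l > 0"
  shows "norm (chirp_gaussian (1 / l\<^sup>2) a b) \<le> 2 * l"
proof (rule power2_le_imp_le)
  have "0 \<le> b\<^sup>2 * l ^ 4" by simp
  then have "1 \<le> sqrt (1 + b\<^sup>2 * l ^ 4)" "0 < 1 + b\<^sup>2 * l ^ 4" by (auto intro: add_pos_nonneg)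
  then have "(norm (chirp_gaussian (1 / l\<^sup>2) a b))\<^sup>2 \<le> pi * l\<^sup>2 / 1 * 1"
    unfolding norm_chirp_gaussian_scaled[OF l] using l
    by (intro mult_mono divide_left_mono) (auto intro!: divide_nonneg_pos)
  also have "\<dots> \<le> 4 * l\<^sup>2" using pi_less_4 by (simp add: mult_right_mono)
  finally show "(norm (chirp_gaussian (1 / l\<^sup>2) a b))\<^sup>2 \<le> (2 * l)\<^sup>2" by (simp add: power_mult_distrib)
qed (use l in simp)

text \<open>The convolution kernel for Schur's test. Its value at 0 is 0, since
  \<open>0 powr e = 0\<close>; accordingly the kernel estimates are stated for distinct points
  only.\<close>

definition cutoff_power :: "real \<Rightarrow> real \<Rightarrow> real \<Rightarrow> real" where
  "cutoff_power \<eta> r z = indicator {-r..r} z * \<bar>z\<bar> powr (\<eta> - 1)"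

lemma measurable_cutoff_power [measurable]: "cutoff_power \<eta> r \<in> borel_measurable borel"
  unfolding cutoff_power_def by measurable

lemma cutoff_power_nonneg: "cutoff_power \<eta> r z \<ge> 0"
  by (simp add: cutoff_power_def)

lemma nn_integral_cutoff_power:
  assumes eta: "\<eta> > 0" and r: "r \<ge> 0"
  shows "(\<integral>\<^sup>+z. ennreal (cutoff_power \<eta> r z) \<partial>lborel) \<le> ennreal (2 * r powr \<eta> / \<eta>)"
proof -
  define f where "f = (\<lambda>z::real. indicator {0..r} z * z powr (\<eta> - 1))"
  have [measurable]: "f \<in> borel_measurable borel" unfolding f_def by measurable
  have "((\<lambda>z. z powr (\<eta> - 1)) has_integral (r powr (\<eta> - 1 + 1) / (\<eta> - 1 + 1))) {0..r}"
    using eta r by (intro has_integral_powr_from_0) auto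
  then have "((\<lambda>z. z powr (\<eta> - 1)) has_integral (r powr \<eta> / \<eta>)) {0..r}" by simp
  from nn_integral_has_integral_lebesgue[OF _ this]
  have I: "(\<integral>\<^sup>+z. ennreal (f z) \<partial>lborel) = ennreal (r powr \<eta> / \<eta>)"
    by (simp add: nn_integral_completion f_def mult.commute)
  have "(\<integral>\<^sup>+z. ennreal (cutoff_power \<eta> r z) \<partial>lborel) \<le> (\<integral>\<^sup>+z. ennreal (f z) + ennreal (f (- z)) \<partial>lborel)"
    by (intro nn_integral_mono) (auto simp: cutoff_power_def f_def split: split_indicator)
  also have "\<dots> = (\<integral>\<^sup>+z. ennreal (f z) \<partial>lborel) + (\<integral>\<^sup>+z. ennreal (f (- z)) \<partial>lborel)"
    by (rule nn_integral_add) auto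
  also have "(\<integral>\<^sup>+z. ennreal (f (- z)) \<partial>lborel) = (\<integral>\<^sup>+z. ennreal (f z) \<partial>lborel)"
    using nn_integral_real_affine[of "\<lambda>z. ennreal (f z)" "-1" 0] by simp
  also have "(\<integral>\<^sup>+z. ennreal (f z) \<partial>lborel) + (\<integral>\<^sup>+z. ennreal (f z) \<partial>lborel) = ennreal (2 * r powr \<eta> / \<eta>)"
    unfolding I using eta by (subst ennreal_plus[symmetric]) auto
  finally show ?thesis .
qed

text \<open>Points of \<open>[-R, R]\<close> differ by at most \<open>2 * R\<close>, so a power
  singularity may be cut off there, and the mass of the cut-off power is the constant of the maximal
  inequality.\<close>

lemma chirp_maximal_power:
  fixes g :: "real \<Rightarrow> complex" and a b :: "'p::{metric_space, second_countable_topology} \<Rightarrow> real \<Rightarrow> real"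
  assumes "l > 0" "g \<in> borel_measurable borel"
    "integrable lborel (\<lambda>\<xi>. (norm (g \<xi>))\<^sup>2)" "\<And>\<xi>. \<bar>\<xi>\<bar> > l \<Longrightarrow> g \<xi> = 0"
    "\<Theta> \<noteq> {}"
    "\<And>\<theta>. \<theta> \<in> \<Theta> \<Longrightarrow> a \<theta> \<in> borel_measurable borel" "\<And>\<theta>. \<theta> \<in> \<Theta> \<Longrightarrow> b \<theta> \<in> borel_measurable borel"
    "\<And>x. continuous_on \<Theta> (\<lambda>\<theta>. a \<theta> x)" "\<And>x. continuous_on \<Theta> (\<lambda>\<theta>. b \<theta> x)"
    and eta: "\<eta> > 0" and R: "R > 0" and c: "c > 0"
    and ker: "\<And>x y \<theta> \<theta>'. x \<noteq> y \<Longrightarrow> \<bar>x - y\<bar> \<le> 2 * R \<Longrightarrow> \<theta> \<in> \<Theta> \<Longrightarrow> \<theta>' \<in> \<Theta> \<Longrightarrow>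
      norm (chirp_gaussian (1 / l\<^sup>2) (a \<theta> x - a \<theta>' y) (b \<theta> x - b \<theta>' y)) \<le> c * \<bar>x - y\<bar> powr (\<eta> - 1)"
  shows "\<exists>M \<in> borel_measurable borel.
    (\<forall>x \<theta>. \<bar>x\<bar> \<le> R \<longrightarrow> \<theta> \<in> \<Theta> \<longrightarrow> ennreal ((norm (chirp g (a \<theta> x) (b \<theta> x)))\<^sup>2) \<le> M x) \<and>
    (\<integral>\<^sup>+x. M x \<partial>lborel) \<le> ennreal (exp 1 * (2 * (2 * R) powr \<eta> / \<eta>) * c * (LINT \<xi>|lborel. (norm (g \<xi>))\<^sup>2))"
proof -
  define k where "k = (\<lambda>z. c * cutoff_power \<eta> (2 * R) z)"
  have A: "c * (2 * (2 * R) powr \<eta> / \<eta>) > 0" using eta R c by simp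
  have kA: "(\<integral>\<^sup>+z. ennreal (k z) \<partial>lborel) \<le> ennreal (c * (2 * (2 * R) powr \<eta> / \<eta>))"
  proof -
    have "(\<integral>\<^sup>+z. ennreal (k z) \<partial>lborel) = ennreal c * (\<integral>\<^sup>+z. ennreal (cutoff_power \<eta> (2 * R) z) \<partial>lborel)"
      unfolding k_def using c by (simp add: ennreal_mult cutoff_power_nonneg nn_integral_cmult)
    also have "\<dots> \<le> ennreal c * ennreal (2 * (2 * R) powr \<eta> / \<eta>)"
      using eta R by (intro mult_left_mono nn_integral_cutoff_power) auto
    finally show ?thesis using c eta by (simp add: ennreal_mult[symmetric])
  qed
  have k0: "\<And>z. k z \<ge> 0" using c by (simp add: k_def cutoff_power_nonneg)
  have km: "k \<in> borel_measurable borel" unfolding k_def by measurable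
  have "norm (chirp_gaussian (1 / l\<^sup>2) (a \<theta> x - a \<theta>' y) (b \<theta> x - b \<theta>' y)) \<le> k (x - y)"
    if "\<bar>x\<bar> \<le> R" "\<bar>y\<bar> \<le> R" "x \<noteq> y" "\<theta> \<in> \<Theta>" "\<theta>' \<in> \<Theta>" for x y \<theta> \<theta>'
  proof -
    have xy: "\<bar>x - y\<bar> \<le> 2 * R" using that by linarith
    then have "k (x - y) = c * \<bar>x - y\<bar> powr (\<eta> - 1)"
      by (auto simp: k_def cutoff_power_def abs_le_iff split: split_indicator)
    then show ?thesis using ker[OF that(3) xy that(4,5)] by simp
  qed
  from chirp_maximal[OF assms(1-9) km k0 kA A this] show ?thesis by (simp add: mult_ac)
qed

section \<open>Maximal estimates along a path\<close>

locale hoelder_path =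
  fixes \<gamma> :: "real \<times> real \<Rightarrow> real" and \<alpha> \<kappa> L :: real
  assumes alpha: "1 / 2 \<le> \<alpha>" "\<alpha> < 1"
    and kappa: "\<kappa> > 0" and L: "L > 0"
    and cont: "continuous_on (UNIV \<times> {-1..1}) \<gamma>"
    and start: "\<gamma> (x, 0) = x"
    and lower: "t \<in> {-1..1} \<Longrightarrow> \<kappa> * \<bar>x - y\<bar> \<le> \<bar>\<gamma> (x, t) - \<gamma> (y, t)\<bar>"
    and hoelder: "t \<in> {-1..1} \<Longrightarrow> t' \<in> {-1..1} \<Longrightarrow> \<bar>\<gamma> (x, t) - \<gamma> (x, t')\<bar> \<le> L * \<bar>t - t'\<bar> powr \<alpha>"
begin

lemma continuous_x: "t \<in> {-1..1} \<Longrightarrow> continuous_on UNIV (\<lambda>x. \<gamma> (x, t))"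
  by (rule continuous_on_compose2[OF cont]) (auto intro!: continuous_intros)

lemma continuous_t: "continuous_on {-1..1} (\<lambda>t. \<gamma> (x, t))"
  by (rule continuous_on_compose2[OF cont]) (auto intro!: continuous_intros)

lemma measurable_x: "t \<in> {-1..1} \<Longrightarrow> (\<lambda>x. \<gamma> (x, t)) \<in> borel_measurable borel"
  by (intro borel_measurable_continuous_onI continuous_x)

lemma displacement: "t \<in> {0..1} \<Longrightarrow> \<bar>\<gamma> (x, t) - x\<bar> \<le> L * t powr \<alpha>"
  using hoelder[of t 0 x] by (simp add: start)

text \<open>If \<open>\<gamma> (x, t)\<close> and \<open>\<gamma> (y, t')\<close> are not separated at the scale \<open>\<bar>x - y\<bar>\<close>, then
  \<open>\<bar>x - y\<bar>\<close> is at most of order \<open>\<bar>t - t'\<bar> powr \<alpha>\<close>, and since \<open>\<alpha> \<ge> 1/2\<close> the dispersive decay in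
  \<open>t - t'\<close> suffices.\<close>

lemma kernel_large_time:
  assumes l: "l \<ge> 1" and T: "1 / l\<^sup>2 \<le> T" "T \<le> 1" and eta: "0 < \<eta>" "\<eta> < 1/2" and p: "0 \<le> p" "p \<le> 1/2 - \<eta>"
    and R: "R > 0" and xy: "x \<noteq> y" "\<bar>x - y\<bar> \<le> 2 * R"
    and t: "t \<in> {0..1} \<inter> {T..2*T}" "t' \<in> {0..1} \<inter> {T..2*T}"
  shows "norm (chirp_gaussian (1 / l\<^sup>2) (\<gamma> (x, t) - \<gamma> (y, t')) (t - t')) \<le>
    (6 * (\<kappa>/2) powr (- 1/2 - p) * (2 * R) powr (1/2 - \<eta> - p) + 2 * (\<kappa> / (2 * L)) powr (\<eta> - 1)) *
    (l powr (1/2 + p) * T powr p + l powr \<eta>) * \<bar>x - y\<bar> powr (\<eta> - 1)"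
proof -
  define z where "z = \<bar>x - y\<bar>"
  define \<tau> where "\<tau> = \<bar>t - t'\<bar>"
  have z: "z > 0" "z \<le> 2 * R" using xy by (auto simp: z_def)
  have \<tau>: "0 \<le> \<tau>" "\<tau> \<le> T" "\<tau> \<le> 1" using t T by (auto simp: \<tau>_def)
  have T0: "T > 0" using T l by (smt (verit) divide_pos_pos zero_less_power2)
  have ht: "\<bar>\<gamma> (y, t) - \<gamma> (y, t')\<bar> \<le> L * \<tau> powr \<alpha>" using hoelder[of t t' y] t by (auto simp: \<tau>_def)
  have lo: "\<bar>\<gamma> (x, t) - \<gamma> (y, t')\<bar> \<ge> \<kappa> * z - L * \<tau> powr \<alpha>"
    using lower[of t x y] t ht by (auto simp: z_def)
  let ?K = "norm (chirp_gaussian (1 / l\<^sup>2) (\<gamma> (x, t) - \<gamma> (y, t')) (t - t'))"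
  define C1 where "C1 = 6 * (\<kappa>/2) powr (- 1/2 - p) * (2 * R) powr (1/2 - \<eta> - p)"
  define C2 where "C2 = 2 * (\<kappa> / (2 * L)) powr (\<eta> - 1)"
  define A1 where "A1 = l powr (1/2 + p) * T powr p"
  have C0: "C1 \<ge> 0" "C2 \<ge> 0" "A1 \<ge> 0" by (auto simp: C1_def C2_def A1_def)
  \<comment> \<open>Half of the separation \<open>\<kappa> * z\<close> is reserved against the
    displacement between the times \<open>t\<close> and \<open>t'\<close>. If it survives, decay in
    space applies; if not, \<open>\<tau>\<close> is large compared with \<open>z\<close> and decay
    in time applies.\<close>
  have "?K \<le> C1 * A1 * z powr (\<eta> - 1) \<or> ?K \<le> C2 * l powr \<eta> * z powr (\<eta> - 1)"
  proof (cases "L * \<tau> powr \<alpha> \<le> \<kappa> * z / 2")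
    case True
    define a where "a = \<gamma> (x, t) - \<gamma> (y, t')"
    define D where "D = 1 + (t - t')\<^sup>2 * l ^ 4"
    have a: "\<bar>a\<bar> \<ge> \<kappa> / 2 * z" using lo True by (simp add: a_def)
    have kz: "\<kappa> / 2 * z > 0" using kappa z by simp
    have "(t - t')\<^sup>2 = \<tau>\<^sup>2" by (simp add: \<tau>_def)
    also have "\<dots> \<le> T\<^sup>2" using \<tau> by (intro power_mono) auto
    finally have D1: "D \<le> 1 + T\<^sup>2 * l ^ 4" unfolding D_def by (intro add_left_mono mult_right_mono) auto
    \<comment> \<open>Since \<open>T * l^2\<close> is at least 1, the summand 1 of \<open>D\<close>
      is absorbed, and \<open>D powr (p/2)\<close> costs only
      \<open>T powr p * l powr (2 * p)\<close>.\<close>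
    have "1 \<le> T * l\<^sup>2" using T l by (simp add: field_simps)
    then have Tl: "1 \<le> (T * l\<^sup>2)\<^sup>2" by (rule one_le_power)
    have "(T * l\<^sup>2)\<^sup>2 = T\<^sup>2 * l ^ 4" by (simp add: power2_eq_square power4_eq_xxxx)
    then have D2: "D \<le> 2 * (T * l\<^sup>2)\<^sup>2" using D1 Tl by simp
    have D0: "D \<ge> 1" unfolding D_def by simp
    have "D powr (p/2) \<le> (2 * (T * l\<^sup>2)\<^sup>2) powr (p/2)" using D2 D0 p by (intro powr_mono2) auto
    also have "\<dots> = 2 powr (p/2) * ((T * l\<^sup>2)\<^sup>2) powr (p/2)" by (simp add: powr_mult)
    also have "((T * l\<^sup>2)\<^sup>2) powr (p/2) = ((T * l powr 2) powr 2) powr (p/2)" using T0 l by simp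
    also have "\<dots> = T powr p * l powr (2 * p)" using T0 l by (simp only: powr_powr powr_mult) simp
    also have "2 powr (p/2) * (T powr p * l powr (2 * p)) \<le> 2 powr 1 * (T powr p * l powr (2 * p))"
      using p eta by (intro mult_right_mono powr_mono) auto
    finally have D3: "D powr (p/2) \<le> 2 * (T powr p * l powr (2 * p))" by simp
    have "?K \<le> 3 * l powr (1 - (1/2 + p)) * D powr ((1/2 + p - 1/2) / 2) * \<bar>a\<bar> powr (- (1/2 + p))"
      unfolding D_def a_def using l p eta a kz by (intro kernel_decay) (auto simp: a_def)
    also have "\<dots> = 3 * l powr (1/2 - p) * D powr (p / 2) * \<bar>a\<bar> powr (- 1/2 - p)" by simp
    also have "\<dots> \<le> 3 * l powr (1/2 - p) * (2 * (T powr p * l powr (2 * p))) * (\<kappa> / 2 * z) powr (- 1/2 - p)"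
    proof -
      have "\<bar>a\<bar> powr (- 1/2 - p) \<le> (\<kappa> / 2 * z) powr (- 1/2 - p)" using a kz p by (intro powr_mono2') auto
      then show ?thesis using D3 by (intro mult_mono) auto
    qed
    also have "\<dots> = 6 * (l powr (1/2 - p) * l powr (2 * p)) * T powr p * ((\<kappa> / 2) powr (- 1/2 - p) * z powr (- 1/2 - p))"
      by (simp only: powr_mult[of "\<kappa>/2" z]) (simp add: mult_ac add_ac)
    also have "l powr (1/2 - p) * l powr (2 * p) = l powr (1/2 + p)" by (simp add: powr_add[symmetric] add.commute)
    \<comment> \<open>The exponent \<open>1/2 - \<eta> - p\<close> is nonnegative by the bound on
      \<open>p\<close>, so this spare power of \<open>z\<close> is bounded by the same power of
      \<open>2 * R\<close>. Here the local integrability limits \<open>p\<close>.\<close>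
    also have "z powr (- 1/2 - p) = z powr (\<eta> - 1) * z powr (1/2 - \<eta> - p)" using z by (simp add: powr_add[symmetric])
    also have "6 * l powr (1/2 + p) * T powr p * ((\<kappa> / 2) powr (- 1/2 - p) * (z powr (\<eta> - 1) * z powr (1/2 - \<eta> - p)))
       \<le> 6 * l powr (1/2 + p) * T powr p * ((\<kappa> / 2) powr (- 1/2 - p) * (z powr (\<eta> - 1) * (2 * R) powr (1/2 - \<eta> - p)))"
      using z p by (intro mult_left_mono powr_mono2) auto
    also have "\<dots> = C1 * A1 * z powr (\<eta> - 1)" by (simp add: C1_def A1_def mult_ac)
    finally show ?thesis by blast
  next
    case False
    define w where "w = \<kappa> / (2 * L) * z"
    have w: "w > 0" using kappa L z by (simp add: w_def)
    have w\<tau>: "w < \<tau> powr \<alpha>" using False L by (simp add: w_def field_simps)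
    then have \<tau>0: "\<tau> > 0" using w \<tau> by (cases "\<tau> = 0") auto
    \<comment> \<open>For \<open>\<tau> \<le> 1\<close> and \<open>\<alpha> \<ge> 1/2\<close> the
      Hoelder displacement is dominated by the parabolic scale.\<close>
    have "\<tau> powr \<alpha> \<le> \<tau> powr (1/2)" using \<tau> \<tau>0 alpha by (intro powr_mono') auto
    then have w2: "w \<le> \<tau> powr (1/2)" using w\<tau> by simp
    have "?K \<le> 2 * l powr \<eta> * \<bar>t - t'\<bar> powr ((\<eta> - 1) / 2)"
      using l eta \<tau>0 by (intro kernel_dispersive) (auto simp: \<tau>_def)
    also have "\<dots> \<le> 2 * l powr \<eta> * ((\<kappa> / (2 * L)) powr (\<eta> - 1) * z powr (\<eta> - 1))"
    proof (rule mult_left_mono)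
      have "\<bar>t - t'\<bar> powr ((\<eta> - 1) / 2) = (\<tau> powr (1/2)) powr (\<eta> - 1)" by (simp add: \<tau>_def powr_powr)
      also have "\<dots> \<le> w powr (\<eta> - 1)" using w w2 eta by (intro powr_mono2') auto
      also have "\<dots> = (\<kappa> / (2 * L)) powr (\<eta> - 1) * z powr (\<eta> - 1)" unfolding w_def by (rule powr_mult)
      finally show "\<bar>t - t'\<bar> powr ((\<eta> - 1) / 2) \<le> (\<kappa> / (2 * L)) powr (\<eta> - 1) * z powr (\<eta> - 1)" .
    qed simp
    finally show ?thesis by (simp add: C2_def mult_ac)
  qed
  moreover have "C1 * A1 * z powr (\<eta> - 1) \<le> (C1 + C2) * (A1 + l powr \<eta>) * z powr (\<eta> - 1)"
    using C0 by (intro mult_mono) auto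
  moreover have "C2 * l powr \<eta> * z powr (\<eta> - 1) \<le> (C1 + C2) * (A1 + l powr \<eta>) * z powr (\<eta> - 1)"
    using C0 by (intro mult_mono) auto
  ultimately show ?thesis unfolding z_def[symmetric] C1_def[symmetric] C2_def[symmetric] A1_def[symmetric] by linarith
qed

text \<open>The assumptions describe times up to \<open>1 / l^2\<close>, when both points have moved
  by about a wavelength and the kernel has hardly spread. Beyond the distance
  \<open>4 * L / l\<close> the points stay apart and spatial decay of order
  \<open>1 - \<eta>\<close> applies; within it, \<open>l\<close> is itself below
  \<open>4 * L / |x - y|\<close> and the trivial bound suffices.\<close>

lemma kernel_small_time:
  assumes l: "l \<ge> 1" and eta: "0 < \<eta>" "\<eta> < 1/2" and xy: "x \<noteq> y"
    and a: "\<bar>a - x\<bar> \<le> L / l" "\<bar>a' - y\<bar> \<le> L / l" and b: "\<bar>b\<bar> \<le> 1 / l\<^sup>2"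
  shows "norm (chirp_gaussian (1 / l\<^sup>2) (a - a') b) \<le> (6 * (1/2) powr (\<eta> - 1) + 2 * (4 * L) powr (1 - \<eta>)) * l powr \<eta> * \<bar>x - y\<bar> powr (\<eta> - 1)"
proof -
  define z where "z = \<bar>x - y\<bar>"
  have z: "z > 0" using xy by (auto simp: z_def)
  let ?K = "norm (chirp_gaussian (1 / l\<^sup>2) (a - a') b)"
  define C1 where "C1 = 6 * (1/2) powr (\<eta> - 1)"
  define C2 where "C2 = 2 * (4 * L) powr (1 - \<eta>)"
  have C0: "C1 \<ge> 0" "C2 \<ge> 0" by (auto simp: C1_def C2_def)
  have "?K \<le> C1 * l powr \<eta> * z powr (\<eta> - 1) \<or> ?K \<le> C2 * l powr \<eta> * z powr (\<eta> - 1)"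
  proof (cases "z \<ge> 4 * (L / l)")
    case True
    then have az: "\<bar>a - a'\<bar> \<ge> z / 2" using a by (auto simp: z_def abs_if split: if_splits)
    define D where "D = 1 + b\<^sup>2 * l ^ 4"
    have "b\<^sup>2 \<le> (1 / l\<^sup>2)\<^sup>2" using power_mono[OF b, of 2] by simp
    then have "b\<^sup>2 * l ^ 4 \<le> (1 / l\<^sup>2)\<^sup>2 * l ^ 4" by (rule mult_right_mono) simp
    also have "\<dots> = 1" using l by (simp add: power2_eq_square power4_eq_xxxx)
    finally have D: "D \<le> 2" "D \<ge> 1" by (auto simp: D_def)
    have "D powr ((1 - \<eta> - 1/2) / 2) \<le> 2 powr ((1 - \<eta> - 1/2) / 2)" using D eta by (intro powr_mono2) auto
    also have "\<dots> \<le> 2 powr 1" using eta by (intro powr_mono) auto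
    finally have D3: "D powr ((1 - \<eta> - 1/2) / 2) \<le> 2" by simp
    have "?K \<le> 3 * l powr (1 - (1 - \<eta>)) * D powr ((1 - \<eta> - 1/2) / 2) * \<bar>a - a'\<bar> powr (- (1 - \<eta>))"
      unfolding D_def using l eta az z by (intro kernel_decay) auto
    also have "\<dots> \<le> 3 * l powr (1 - (1 - \<eta>)) * 2 * (z / 2) powr (- (1 - \<eta>))"
    proof -
      have "\<bar>a - a'\<bar> powr (- (1 - \<eta>)) \<le> (z / 2) powr (- (1 - \<eta>))" using az z eta by (intro powr_mono2') auto
      then show ?thesis using D3 by (intro mult_mono) auto
    qed
    also have "(z / 2) powr (- (1 - \<eta>)) = (1/2) powr (\<eta> - 1) * z powr (\<eta> - 1)" using z powr_mult[of "1/2" z "\<eta> - 1"] by simp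
    finally show ?thesis by (simp add: C1_def mult_ac)
  next
    case False
    then have lz: "l < 4 * L / z" using l z by (simp add: field_simps)
    have "l = l powr \<eta> * l powr (1 - \<eta>)" using l by (simp add: powr_add[symmetric])
    also have "l powr (1 - \<eta>) \<le> (4 * L / z) powr (1 - \<eta>)" using lz l eta by (intro powr_mono2) auto
    finally have "l \<le> l powr \<eta> * (4 * L / z) powr (1 - \<eta>)" by (simp add: mult_left_mono)
    also have "(4 * L / z) powr (1 - \<eta>) = (4 * L) powr (1 - \<eta>) * z powr (\<eta> - 1)"
    proof -
      have "z powr (\<eta> - 1) = 1 / z powr (1 - \<eta>)" using powr_minus_divide[of z "1 - \<eta>"] by simp
      then show ?thesis by (simp add: powr_divide)
    qed
    finally have "2 * l \<le> C2 * l powr \<eta> * z powr (\<eta> - 1)" by (simp add: C2_def mult_ac)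
    then show ?thesis using kernel_le[of l "a - a'" b] l by linarith
  qed
  moreover have "C1 * l powr \<eta> * z powr (\<eta> - 1) \<le> (C1 + C2) * l powr \<eta> * z powr (\<eta> - 1)"
    using C0 by (intro mult_mono) auto
  moreover have "C2 * l powr \<eta> * z powr (\<eta> - 1) \<le> (C1 + C2) * l powr \<eta> * z powr (\<eta> - 1)"
    using C0 by (intro mult_mono) auto
  ultimately show ?thesis unfolding z_def[symmetric] C1_def[symmetric] C2_def[symmetric] by linarith
qed

text \<open>\<open>C\<close> is fixed before \<open>l\<close>, \<open>T\<close> and
  \<open>g\<close>; this uniformity is what allows summation over dyadic times and over dyadic
  frequencies.\<close>

lemma maximal_large_time:
  assumes eta: "0 < \<eta>" "\<eta> < 1/2" and p: "0 \<le> p" "p \<le> 1/2 - \<eta>" and R: "R > 0"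
  obtains C where "C > 0" and
   "\<And>l T g. l \<ge> 1 \<Longrightarrow> 1 / l\<^sup>2 \<le> T \<Longrightarrow> T \<le> 1 \<Longrightarrow> g \<in> borel_measurable borel \<Longrightarrow>
     integrable lborel (\<lambda>\<xi>. (norm (g \<xi>))\<^sup>2) \<Longrightarrow> (\<And>\<xi>. \<bar>\<xi>\<bar> > l \<Longrightarrow> g \<xi> = 0) \<Longrightarrow>
     \<exists>M \<in> borel_measurable borel.
      (\<forall>x t. \<bar>x\<bar> \<le> R \<longrightarrow> t \<in> {0..1} \<inter> {T..2*T} \<longrightarrow> ennreal ((norm (chirp g (\<gamma> (x, t)) t))\<^sup>2) \<le> M x) \<and>
      (\<integral>\<^sup>+x. M x \<partial>lborel) \<le> ennreal (C * (l powr (1/2 + p) * T powr p + l powr \<eta>) * (LINT \<xi>|lborel. (norm (g \<xi>))\<^sup>2))"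
proof
  let ?C = "6 * (\<kappa>/2) powr (- 1/2 - p) * (2 * R) powr (1/2 - \<eta> - p) + 2 * (\<kappa> / (2 * L)) powr (\<eta> - 1)"
  have C: "?C > 0" using kappa L R by (intro add_pos_pos mult_pos_pos) auto
  then show "exp 1 * (2 * (2 * R) powr \<eta> / \<eta>) * ?C > 0" using R eta by simp
  fix l T :: real and g :: "real \<Rightarrow> complex"
  assume l: "l \<ge> 1" and T: "1 / l\<^sup>2 \<le> T" "T \<le> 1" and g: "g \<in> borel_measurable borel"
     "integrable lborel (\<lambda>\<xi>. (norm (g \<xi>))\<^sup>2)" "\<And>\<xi>. \<bar>\<xi>\<bar> > l \<Longrightarrow> g \<xi> = 0"
  have T0: "T > 0" using T l by (smt (verit) divide_pos_pos zero_less_power2)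
  have l0: "l > 0" using l by simp
  have c: "?C * (l powr (1/2 + p) * T powr p + l powr \<eta>) > 0"
    using l T0 by (intro mult_pos_pos[OF C] add_pos_pos mult_pos_pos) auto
  have ne: "{0..1} \<inter> {T..2*T} \<noteq> {}" using T T0 by (auto intro: exI[of _ T])
  have "\<exists>M \<in> borel_measurable borel.
    (\<forall>x t. \<bar>x\<bar> \<le> R \<longrightarrow> t \<in> {0..1} \<inter> {T..2*T} \<longrightarrow> ennreal ((norm (chirp g (\<gamma> (x, t)) t))\<^sup>2) \<le> M x) \<and>
    (\<integral>\<^sup>+x. M x \<partial>lborel) \<le> ennreal (exp 1 * (2 * (2 * R) powr \<eta> / \<eta>) * (?C * (l powr (1/2 + p) * T powr p + l powr \<eta>)) * (LINT \<xi>|lborel. (norm (g \<xi>))\<^sup>2))"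
  proof (rule chirp_maximal_power[OF l0 g ne _ _ _ _ eta(1) R c, of "\<lambda>t x. \<gamma> (x, t)" "\<lambda>t x. t"], goal_cases)
    case (6 x y t t')
    show ?case by (rule kernel_large_time[OF l T eta p R 6])
  qed (auto intro!: measurable_x continuous_on_subset[OF continuous_t] continuous_intros)
  then show "\<exists>M \<in> borel_measurable borel.
    (\<forall>x t. \<bar>x\<bar> \<le> R \<longrightarrow> t \<in> {0..1} \<inter> {T..2*T} \<longrightarrow> ennreal ((norm (chirp g (\<gamma> (x, t)) t))\<^sup>2) \<le> M x) \<and>
    (\<integral>\<^sup>+x. M x \<partial>lborel) \<le> ennreal (exp 1 * (2 * (2 * R) powr \<eta> / \<eta>) * ?C * (l powr (1/2 + p) * T powr p + l powr \<eta>) * (LINT \<xi>|lborel. (norm (g \<xi>))\<^sup>2))"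
    by (simp only: mult.assoc)
qed

text \<open>The parameter is a pair \<open>(t, u)\<close>: the mean value theorem evaluates
  derivatives at intermediate points of the segment from \<open>(x, 0)\<close> to
  \<open>(\<gamma> (x, t), t)\<close>, which need not lie on the path.\<close>

lemma maximal_small_time:
  assumes eta: "0 < \<eta>" "\<eta> < 1/2" and R: "R > 0"
  obtains C where "C > 0" and
   "\<And>l g. l \<ge> 1 \<Longrightarrow> g \<in> borel_measurable borel \<Longrightarrow>
     integrable lborel (\<lambda>\<xi>. (norm (g \<xi>))\<^sup>2) \<Longrightarrow> (\<And>\<xi>. \<bar>\<xi>\<bar> > l \<Longrightarrow> g \<xi> = 0) \<Longrightarrow>
     \<exists>M \<in> borel_measurable borel.
      (\<forall>x t u. \<bar>x\<bar> \<le> R \<longrightarrow> t \<in> {0..1 / l\<^sup>2} \<longrightarrow> u \<in> {0..1} \<longrightarrow>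
         ennreal ((norm (chirp g (x + u * (\<gamma> (x, t) - x)) (u * t)))\<^sup>2) \<le> M x) \<and>
      (\<integral>\<^sup>+x. M x \<partial>lborel) \<le> ennreal (C * l powr \<eta> * (LINT \<xi>|lborel. (norm (g \<xi>))\<^sup>2))"
proof
  let ?C = "6 * (1/2) powr (\<eta> - 1) + 2 * (4 * L) powr (1 - \<eta>)"
  have C: "?C > 0" using L by (intro add_pos_pos mult_pos_pos) auto
  then show "exp 1 * (2 * (2 * R) powr \<eta> / \<eta>) * ?C > 0" using R eta by simp
  fix l :: real and g :: "real \<Rightarrow> complex"
  assume l: "l \<ge> 1" and g: "g \<in> borel_measurable borel"
     "integrable lborel (\<lambda>\<xi>. (norm (g \<xi>))\<^sup>2)" "\<And>\<xi>. \<bar>\<xi>\<bar> > l \<Longrightarrow> g \<xi> = 0"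
  have l0: "l > 0" using l by simp
  have l2: "1 / l\<^sup>2 \<le> 1" using l by simp
  have c: "?C * l powr \<eta> > 0" using l by (intro mult_pos_pos[OF C]) auto
  have ne: "{0..1 / l\<^sup>2} \<times> {0..1::real} \<noteq> {}" by auto
  \<comment> \<open>Up to time \<open>1 / l^2\<close> the displacement is at most
    \<open>L * l powr (- 2 * \<alpha>)\<close>, hence at most \<open>L / l\<close> because
    \<open>\<alpha> \<ge> 1/2\<close>.\<close>
  have disp: "\<bar>(x + u * (\<gamma> (x, t) - x)) - x\<bar> \<le> L / l" if "t \<in> {0..1 / l\<^sup>2}" "u \<in> {0..1}" for x t u
  proof -
    have "\<bar>(x + u * (\<gamma> (x, t) - x)) - x\<bar> = u * \<bar>\<gamma> (x, t) - x\<bar>" using that by (simp add: abs_mult)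
    also have "\<dots> \<le> 1 * (L * t powr \<alpha>)" using that l2 by (intro mult_mono displacement) auto
    also have "t powr \<alpha> \<le> (1 / l\<^sup>2) powr \<alpha>" using that alpha by (intro powr_mono2) auto
    also have "\<dots> \<le> (1 / l\<^sup>2) powr (1/2)" using alpha l l2 by (intro powr_mono') auto
    also have "\<dots> = 1 / l" using l by (simp add: powr_half_sqrt real_sqrt_divide)
    finally show ?thesis using L by simp
  qed
  have bd: "\<bar>u * t - u' * t'\<bar> \<le> 1 / l\<^sup>2" if "t \<in> {0..1 / l\<^sup>2}" "u \<in> {0..1}" "t' \<in> {0..1 / l\<^sup>2}" "u' \<in> {0..1}" for u t u' t' :: real
  proof -
    have "u * t \<le> t" "u' * t' \<le> t'" using that by (auto intro!: mult_left_le_one_le)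
    then have "u * t \<le> 1 / l\<^sup>2" "u' * t' \<le> 1 / l\<^sup>2" using that by auto
    moreover have "0 \<le> u * t" "0 \<le> u' * t'" using that by auto
    ultimately show ?thesis by linarith
  qed
  have "\<exists>M \<in> borel_measurable borel.
    (\<forall>x \<theta>. \<bar>x\<bar> \<le> R \<longrightarrow> \<theta> \<in> {0..1 / l\<^sup>2} \<times> {0..1} \<longrightarrow>
       ennreal ((norm (chirp g (x + snd \<theta> * (\<gamma> (x, fst \<theta>) - x)) (snd \<theta> * fst \<theta>)))\<^sup>2) \<le> M x) \<and>
    (\<integral>\<^sup>+x. M x \<partial>lborel) \<le> ennreal (exp 1 * (2 * (2 * R) powr \<eta> / \<eta>) * (?C * l powr \<eta>) * (LINT \<xi>|lborel. (norm (g \<xi>))\<^sup>2))"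
  proof (rule chirp_maximal_power[OF l0 g ne _ _ _ _ eta(1) R c, of "\<lambda>\<theta> x. x + snd \<theta> * (\<gamma> (x, fst \<theta>) - x)" "\<lambda>\<theta> x. snd \<theta> * fst \<theta>"], goal_cases)
    case (2 \<theta>)
    then have [measurable]: "(\<lambda>x. \<gamma> (x, fst \<theta>)) \<in> borel_measurable borel" using l2 by (intro measurable_x) auto
    show ?case by measurable
  next
    case (4 x)
    have "continuous_on ({0..1 / l\<^sup>2} \<times> {0..1::real}) (\<lambda>\<theta>. \<gamma> (x, fst \<theta>))"
      using l2 by (intro continuous_on_compose2[OF continuous_t]) (auto intro!: continuous_intros)
    then show ?case by (intro continuous_intros)
  next
    case (6 x y \<theta> \<theta>')
    show ?case
      by (rule kernel_small_time[OF l eta 6(1) disp disp bd]) (use 6 in auto)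
  qed (auto intro!: continuous_intros)
  then show "\<exists>M \<in> borel_measurable borel.
      (\<forall>x t u. \<bar>x\<bar> \<le> R \<longrightarrow> t \<in> {0..1 / l\<^sup>2} \<longrightarrow> u \<in> {0..1} \<longrightarrow>
         ennreal ((norm (chirp g (x + u * (\<gamma> (x, t) - x)) (u * t)))\<^sup>2) \<le> M x) \<and>
      (\<integral>\<^sup>+x. M x \<partial>lborel) \<le> ennreal (exp 1 * (2 * (2 * R) powr \<eta> / \<eta>) * ?C * l powr \<eta> * (LINT \<xi>|lborel. (norm (g \<xi>))\<^sup>2))"
    by (simp only: mult.assoc) force
qed

end

section \<open>Differences of the propagator on dyadic pieces\<close>

lemma integral_swap_cutoff:
  fixes h :: "real \<Rightarrow> complex" and \<phi> :: "real \<Rightarrow> real \<Rightarrow> real"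
  assumes h: "integrable lborel h" and [measurable]: "(\<lambda>(\<xi>, u). \<phi> u \<xi>) \<in> borel_measurable (borel \<Otimes>\<^sub>M borel)"
  shows "(LINT \<xi>|lborel. h \<xi> * (LINT u|lborel. complex_of_real (indicator {0..1} u) * exp (\<i> * complex_of_real (\<phi> u \<xi>)))) =
   (LINT u|lborel. complex_of_real (indicator {0..1} u) * (LINT \<xi>|lborel. h \<xi> * exp (\<i> * complex_of_real (\<phi> u \<xi>))))"
proof -
  have i: "integrable lborel (\<lambda>u. complex_of_real (indicator {0..1::real} u))"
    using integrable_indicator_Icc[of 0 1] by auto
  have "(\<lambda>(\<xi>, u). exp (\<i> * complex_of_real (\<phi> u \<xi>))) \<in> borel_measurable (borel \<Otimes>\<^sub>M borel)"
    unfolding split_beta' using assms(2)[unfolded split_beta'] by measurable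
  from integral_swap_bounded_kernel[OF h i this, of 1] show ?thesis by simp
qed

text \<open>A non-integrable \<open>f\<close> has integral 0 by convention, which is at most the
  integral of the nonnegative \<open>g\<close>. This covers inner integrals whose integrability has
  not been established.\<close>

lemma integral_mono_bounded:
  fixes f g :: "real \<Rightarrow> real"
  assumes "integrable lborel g" and "\<And>x. f x \<le> g x" and "\<And>x. 0 \<le> f x"
  shows "(LINT x|lborel. f x) \<le> (LINT x|lborel. g x)"
proof (cases "integrable lborel f")
  case True then show ?thesis using assms by (intro integral_mono) auto
next
  case False
  then show ?thesis using assms by (auto simp: not_integrable_integral_eq intro!: Bochner_Integration.integral_nonneg order_trans[OF assms(3) assms(2)])
qed

text \<open>Differentiating along the segment brings down a factor \<xi> or \<xi>^2. Divided by the
  matching power of \<open>l\<close> it is at most 1 on frequencies up to \<open>l\<close>, so the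
  weighted functions obey the same maximal bounds as \<open>g\<close> and the powers of
  \<open>l\<close> become explicit.\<close>

lemma chirp_mean_value:
  fixes g :: "real \<Rightarrow> complex"
  assumes g [measurable]: "g \<in> borel_measurable borel" and l: "l > 0"
    and gi: "integrable lborel g" and g1: "integrable lborel (\<lambda>\<xi>. complex_of_real (\<xi> / l) * g \<xi>)" and g2: "integrable lborel (\<lambda>\<xi>. complex_of_real ((\<xi> / l)\<^sup>2) * g \<xi>)"
    and S1: "\<And>u. u \<in> {0..1} \<Longrightarrow> norm (chirp (\<lambda>\<xi>. complex_of_real (\<xi> / l) * g \<xi>) (x + u * (a - x)) (u * b)) \<le> S1"
    and S2: "\<And>u. u \<in> {0..1} \<Longrightarrow> norm (chirp (\<lambda>\<xi>. complex_of_real ((\<xi> / l)\<^sup>2) * g \<xi>) (x + u * (a - x)) (u * b)) \<le> S2"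
  shows "norm (chirp g a b - chirp g x 0) \<le> \<bar>a - x\<bar> * l * S1 + \<bar>b\<bar> * l\<^sup>2 * S2"
proof -
  define \<theta> where "\<theta> = (\<lambda>\<xi>. (a - x) * \<xi> + b * \<xi>\<^sup>2)"
  define \<phi> where "\<phi> = (\<lambda>u \<xi>. (x + u * (a - x)) * \<xi> + (u * b) * \<xi>\<^sup>2)"
  define h where "h = (\<lambda>\<xi>. \<i> * complex_of_real (\<theta> \<xi>) * g \<xi>)"
  have hdec: "h \<xi> = \<i> * complex_of_real ((a - x) * l) * (complex_of_real (\<xi> / l) * g \<xi>) + \<i> * complex_of_real (b * l\<^sup>2) * (complex_of_real ((\<xi> / l)\<^sup>2) * g \<xi>)" for \<xi>
    using l by (simp add: h_def \<theta>_def field_simps power2_eq_square)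
  have hi: "integrable lborel h"
    unfolding hdec[abs_def] by (intro Bochner_Integration.integrable_add integrable_mult_right g1 g2)
  have ftc: "iexp (a * \<xi> + b * \<xi>\<^sup>2) - iexp (x * \<xi> + 0 * \<xi>\<^sup>2) =
     \<i> * complex_of_real (\<theta> \<xi>) * (LINT u|lborel. complex_of_real (indicator {0..1} u) * iexp (\<phi> u \<xi>))" for \<xi>
  proof -
    have "(LINT u|lborel. indicator {0..1} u *\<^sub>R (\<i> * complex_of_real (\<theta> \<xi>) * iexp (\<phi> u \<xi>))) = iexp (\<phi> 1 \<xi>) - iexp (\<phi> 0 \<xi>)"
    proof (rule integral_FTC_Icc)
      fix u
      have "((\<lambda>u. iexp (\<phi> u \<xi>)) has_vector_derivative (\<theta> \<xi> *\<^sub>R (\<i> * iexp (\<phi> u \<xi>)))) (at u within {0..1})"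
      proof (rule vector_diff_chain_within[where f="\<lambda>u. \<phi> u \<xi>" and g=iexp, unfolded o_def])
        show "((\<lambda>u. \<phi> u \<xi>) has_vector_derivative \<theta> \<xi>) (at u within {0..1})"
          unfolding \<phi>_def \<theta>_def has_real_derivative_iff_has_vector_derivative[symmetric]
          by (auto intro!: derivative_eq_intros simp: algebra_simps)
        show "(iexp has_vector_derivative \<i> * iexp (\<phi> u \<xi>)) (at (\<phi> u \<xi>) within (\<lambda>u. \<phi> u \<xi>) ` {0..1})"
          by (rule has_vector_derivative_iexp)
      qed
      then show "((\<lambda>u. iexp (\<phi> u \<xi>)) has_vector_derivative (\<i> * complex_of_real (\<theta> \<xi>) * iexp (\<phi> u \<xi>))) (at u within {0..1})"
        by (simp add: scaleR_conv_of_real mult_ac)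
      show "continuous_on {0..1} (\<lambda>u. \<i> * complex_of_real (\<theta> \<xi>) * iexp (\<phi> u \<xi>))"
        unfolding \<phi>_def by (intro continuous_intros)
    qed simp
    moreover have "(LINT u|lborel. indicator {0..1} u *\<^sub>R (\<i> * complex_of_real (\<theta> \<xi>) * iexp (\<phi> u \<xi>))) =
       \<i> * complex_of_real (\<theta> \<xi>) * (LINT u|lborel. complex_of_real (indicator {0..1} u) * iexp (\<phi> u \<xi>))"
      by (subst integral_mult_right_zero[symmetric]) (simp add: scaleR_conv_of_real mult_ac)
    moreover have "\<phi> 1 \<xi> = a * \<xi> + b * \<xi>\<^sup>2" "\<phi> 0 \<xi> = x * \<xi> + 0 * \<xi>\<^sup>2" by (auto simp: \<phi>_def)
    ultimately show ?thesis by simp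
  qed
  have inner: "(LINT \<xi>|lborel. h \<xi> * iexp (\<phi> u \<xi>)) = \<i> * complex_of_real ((a - x) * l) * chirp (\<lambda>\<xi>. complex_of_real (\<xi> / l) * g \<xi>) (x + u * (a - x)) (u * b)
      + \<i> * complex_of_real (b * l\<^sup>2) * chirp (\<lambda>\<xi>. complex_of_real ((\<xi> / l)\<^sup>2) * g \<xi>) (x + u * (a - x)) (u * b)" for u
  proof -
    have "(LINT \<xi>|lborel. h \<xi> * iexp (\<phi> u \<xi>)) = (LINT \<xi>|lborel.
       \<i> * complex_of_real ((a - x) * l) * (iexp (\<phi> u \<xi>) * (complex_of_real (\<xi> / l) * g \<xi>)) + \<i> * complex_of_real (b * l\<^sup>2) * (iexp (\<phi> u \<xi>) * (complex_of_real ((\<xi> / l)\<^sup>2) * g \<xi>)))"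
      by (intro Bochner_Integration.integral_cong refl) (simp only: hdec distrib_right, simp only: mult_ac)
    also have "\<dots> = (LINT \<xi>|lborel. \<i> * complex_of_real ((a - x) * l) * (iexp (\<phi> u \<xi>) * (complex_of_real (\<xi> / l) * g \<xi>))) + (LINT \<xi>|lborel. \<i> * complex_of_real (b * l\<^sup>2) * (iexp (\<phi> u \<xi>) * (complex_of_real ((\<xi> / l)\<^sup>2) * g \<xi>)))"
      unfolding \<phi>_def by (intro Bochner_Integration.integral_add integrable_mult_right integrable_phase g1 g2)
    finally show ?thesis unfolding chirp_def \<phi>_def integral_mult_right_zero .
  qed
  have "chirp g a b - chirp g x 0 = (LINT \<xi>|lborel. iexp (a * \<xi> + b * \<xi>\<^sup>2) * g \<xi> - iexp (x * \<xi> + 0 * \<xi>\<^sup>2) * g \<xi>)"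
    unfolding chirp_def by (intro Bochner_Integration.integral_diff[symmetric] integrable_phase gi)
  also have "\<dots> = (LINT \<xi>|lborel. h \<xi> * (LINT u|lborel. complex_of_real (indicator {0..1} u) * iexp (\<phi> u \<xi>)))"
    by (rule Bochner_Integration.integral_cong[OF refl], simp only: left_diff_distrib[symmetric] ftc) (simp add: h_def mult_ac)
  also have "\<dots> = (LINT u|lborel. complex_of_real (indicator {0..1} u) * (LINT \<xi>|lborel. h \<xi> * iexp (\<phi> u \<xi>)))"
    by (rule integral_swap_cutoff[OF hi]) (simp add: \<phi>_def split_beta')
  finally have eq: "chirp g a b - chirp g x 0 = \<dots>" .
  have "norm (chirp g a b - chirp g x 0) \<le> (LINT u|lborel. norm (complex_of_real (indicator {0..1} u) * (LINT \<xi>|lborel. h \<xi> * iexp (\<phi> u \<xi>))))"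
    unfolding eq by (rule integral_norm_bound)
  also have "\<dots> \<le> (LINT u::real|lborel. indicator {0..1} u * (\<bar>a - x\<bar> * l * S1 + \<bar>b\<bar> * l\<^sup>2 * S2))"
  proof (rule integral_mono_bounded)
    show "integrable lborel (\<lambda>u::real. indicator {0..1} u * (\<bar>a - x\<bar> * l * S1 + \<bar>b\<bar> * l\<^sup>2 * S2))"
      by (intro integrable_mult_left integrable_indicator_Icc)
    fix u :: real
    show "norm (complex_of_real (indicator {0..1} u) * (LINT \<xi>|lborel. h \<xi> * iexp (\<phi> u \<xi>))) \<le> indicator {0..1} u * (\<bar>a - x\<bar> * l * S1 + \<bar>b\<bar> * l\<^sup>2 * S2)"
    proof (cases "u \<in> {0..1}")
      case False then show ?thesis by simp
    next
      case True
      have "norm (LINT \<xi>|lborel. h \<xi> * iexp (\<phi> u \<xi>)) \<le> \<bar>a - x\<bar> * l * norm (chirp (\<lambda>\<xi>. complex_of_real (\<xi> / l) * g \<xi>) (x + u * (a - x)) (u * b))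
         + \<bar>b\<bar> * l\<^sup>2 * norm (chirp (\<lambda>\<xi>. complex_of_real ((\<xi> / l)\<^sup>2) * g \<xi>) (x + u * (a - x)) (u * b))"
      proof -
        have e1: "norm (\<i> * complex_of_real ((a - x) * l) * c) = \<bar>a - x\<bar> * l * norm c" for c
          using l by (simp only: norm_mult norm_of_real norm_ii abs_mult abs_of_pos mult_1_left)
        have e2: "norm (\<i> * complex_of_real (b * l\<^sup>2) * c) = \<bar>b\<bar> * l\<^sup>2 * norm c" for c
          by (simp only: norm_mult norm_of_real norm_ii abs_mult abs_power2 mult_1_left)
        show ?thesis
          unfolding inner e1[symmetric] e2[symmetric] by (rule norm_triangle_ineq)
      qed
      also have "\<dots> \<le> \<bar>a - x\<bar> * l * S1 + \<bar>b\<bar> * l\<^sup>2 * S2"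
        proof (rule add_mono)
        show "\<bar>a - x\<bar> * l * norm (chirp (\<lambda>\<xi>. complex_of_real (\<xi> / l) * g \<xi>) (x + u * (a - x)) (u * b)) \<le> \<bar>a - x\<bar> * l * S1"
          by (rule mult_left_mono[OF S1[OF True]], rule mult_nonneg_nonneg[OF abs_ge_zero less_imp_le[OF l]])
        show "\<bar>b\<bar> * l\<^sup>2 * norm (chirp (\<lambda>\<xi>. complex_of_real ((\<xi> / l)\<^sup>2) * g \<xi>) (x + u * (a - x)) (u * b)) \<le> \<bar>b\<bar> * l\<^sup>2 * S2"
          by (rule mult_left_mono[OF S2[OF True]], rule mult_nonneg_nonneg[OF abs_ge_zero zero_le_power2])
      qed
      finally have bound: "norm (LINT \<xi>|lborel. h \<xi> * iexp (\<phi> u \<xi>)) \<le> \<bar>a - x\<bar> * l * S1 + \<bar>b\<bar> * l\<^sup>2 * S2" .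
      have ind: "(indicator {0..1} u :: real) = 1" using True by simp
      show ?thesis unfolding ind of_real_1 mult_1_left by (rule bound)
    qed
  qed (rule norm_ge_zero)
  also have "\<dots> = \<bar>a - x\<bar> * l * S1 + \<bar>b\<bar> * l\<^sup>2 * S2"
  proof -
    have "(LINT u::real|lborel. indicator {0..1} u) = (1::real)" by simp
    then show ?thesis by (simp only: integral_mult_left_zero mult_1_left)
  qed
  finally show ?thesis .
qed

lemma critical_exponent_ge: "critical_exponent \<delta> \<ge> 2 * \<delta>" "critical_exponent \<delta> \<ge> 1/4 + \<delta>" if "\<delta> \<ge> 0"
  using that by (auto simp: critical_exponent_def)

text \<open>After multiplication by the weight every remaining exponent of \<open>T\<close> is at
  most 0, so \<open>T = 1 / l^2\<close> is the worst case. The value of \<open>p\<close> is the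
  largest admissible one that keeps \<open>p - 2 * \<delta>\<close> from being positive.\<close>

lemma large_time_exponents:
  assumes delta: "\<delta> \<ge> 0" and eta: "0 < \<eta>" "\<eta> < 1/2" and l: "l \<ge> 1" and T: "1 / l\<^sup>2 \<le> T"
    and p: "p = min (2 * \<delta>) (1/2 - \<eta>)"
  shows "T powr (- 2 * \<delta>) * (l powr (1/2 + p) * T powr p + l powr \<eta>) \<le> 2 * l powr (2 * critical_exponent \<delta> + \<eta>)"
proof -
  have T0: "T > 0" using T l by (smt (verit) divide_pos_pos zero_less_power2)
  have l2: "(1 / l\<^sup>2) powr e = l powr (- 2 * e)" for e
  proof -
    have "(1 / l\<^sup>2) powr e = (l powr (-2)) powr e" using l by (simp add: powr_minus divide_simps)
    then show ?thesis by (simp add: powr_powr)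
  qed
  have Tneg: "T powr e \<le> l powr (- 2 * e)" if "e \<le> 0" for e
    using powr_mono2'[OF that _ T] l unfolding l2 by simp
  have "T powr (- 2 * \<delta>) * (l powr (1/2 + p) * T powr p + l powr \<eta>) =
     l powr (1/2 + p) * T powr (p - 2 * \<delta>) + l powr \<eta> * T powr (- 2 * \<delta>)"
    by (simp add: algebra_simps powr_add[symmetric])
  also have "\<dots> \<le> l powr (1/2 + p) * l powr (- 2 * (p - 2 * \<delta>)) + l powr \<eta> * l powr (- 2 * (- 2 * \<delta>))"
    using delta p by (intro add_mono mult_left_mono Tneg) auto
  also have "\<dots> = l powr (1/2 - p + 4 * \<delta>) + l powr (\<eta> + 4 * \<delta>)"
    by (simp add: powr_add[symmetric] algebra_simps)
  also have "\<dots> \<le> l powr (2 * critical_exponent \<delta> + \<eta>) + l powr (2 * critical_exponent \<delta> + \<eta>)"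
  proof -
    have "1/2 - p + 4 * \<delta> \<le> 2 * critical_exponent \<delta> + \<eta>" "\<eta> + 4 * \<delta> \<le> 2 * critical_exponent \<delta> + \<eta>"
      using critical_exponent_ge[OF delta] eta delta p by (auto simp: min_def split: if_splits)
    then show ?thesis using l by (intro add_mono[OF powr_mono powr_mono])
  qed
  finally show ?thesis by simp
qed

text \<open>Take the least exponent whose dyadic time is not below \<open>t\<close> and step back by
  one, which keeps the index under \<open>2 * n\<close>. Only at the left end point is there no step
  back; \<open>n \<ge> 1\<close> makes index 0 available there.\<close>

lemma dyadic_time:
  fixes t :: real
  assumes "n \<ge> 1" "1 / (2 ^ n)\<^sup>2 \<le> t" "t \<le> 1"
  obtains m where "m < 2 * n" "t \<in> {2 ^ m / (2 ^ n)\<^sup>2 .. 2 * (2 ^ m / (2 ^ n)\<^sup>2)}"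
proof -
  let ?P = "\<lambda>m. t \<le> 2 ^ m / (2 ^ n)\<^sup>2"
  have "(2::real) ^ (2 * n) = (2 ^ n)\<^sup>2" by (rule power_even_eq)
  then have top: "?P (2 * n)" using assms(3) by simp
  define m where "m = (LEAST m. ?P m)"
  have m: "?P m" "m \<le> 2 * n" unfolding m_def by (rule LeastI[of ?P, OF top], rule Least_le[of ?P, OF top])
  show ?thesis
  proof (cases m)
    case 0
    then have t: "t = 1 / (2 ^ n)\<^sup>2" using m(1) assms(2) by simp
    have "0 \<le> t" unfolding t by (rule divide_nonneg_nonneg) auto
    then have "t \<le> 2 * t" by linarith
    then have "t \<in> {2 ^ 0 / (2 ^ n)\<^sup>2 .. 2 * (2 ^ 0 / (2 ^ n)\<^sup>2)}"
      unfolding atLeastAtMost_iff power_0 t[symmetric] by (intro conjI order_refl)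
    then show ?thesis using assms(1) by (intro that[of 0]) auto
  next
    case (Suc k)
    have "\<not> ?P k" by (rule not_less_Least) (use Suc in \<open>simp add: m_def\<close>)
    then have "2 ^ k / (2 ^ n)\<^sup>2 \<le> t" by simp
    moreover have "t \<le> 2 * (2 ^ k / (2 ^ n)\<^sup>2)" using m(1) unfolding Suc power_Suc times_divide_eq_right .
    ultimately show ?thesis using m(2) Suc by (intro that[of k]) simp_all
  qed
qed

lemma square_sum_le: "(a + b)\<^sup>2 \<le> 2 * a\<^sup>2 + 2 * b\<^sup>2" for a b :: real
  using zero_le_power2[of "a - b"] by (simp add: power2_eq_square algebra_simps)

section \<open>Difference quotients at small and at large times\<close>

context hoelder_path begin

text \<open>As \<open>\<delta> < \<alpha> < 1\<close>, the bounds for both quotients are increasing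
  in \<open>t\<close>, so the end point \<open>1 / l^2\<close> decides. There the first is a
  multiple of \<open>l powr (1 - 2 * \<alpha> + 2 * \<delta>)\<close>, and
  \<open>1 - 2 * \<alpha>\<close> is at most 0.\<close>

lemma small_time_weight:
  assumes delta: "0 \<le> \<delta>" "\<delta> < \<alpha>" and l: "l \<ge> 1" and t: "0 < t" "t \<le> 1 / l\<^sup>2"
  shows "\<bar>\<gamma> (x, t) - x\<bar> * l / t powr \<delta> \<le> L * l powr (2 * \<delta>)" "t * l\<^sup>2 / t powr \<delta> \<le> l powr (2 * \<delta>)"
proof -
  have l2: "(1 / l\<^sup>2) powr e = l powr (- 2 * e)" for e
  proof -
    have "(1 / l\<^sup>2) powr e = (l powr (-2)) powr e" using l by (simp add: powr_minus divide_simps)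
    then show ?thesis by (simp add: powr_powr)
  qed
  have "1 / l\<^sup>2 \<le> 1" using l by simp
  then have t1: "t \<le> 1" using t by linarith
  have pw: "t powr e \<le> l powr (- 2 * e)" if "e \<ge> 0" for e
    using powr_mono2[OF that _ t(2)] t unfolding l2 by simp
  have "\<bar>\<gamma> (x, t) - x\<bar> * l / t powr \<delta> \<le> (L * t powr \<alpha>) * l / t powr \<delta>"
    using t l t1 by (intro divide_right_mono mult_right_mono displacement) auto
  also have "\<dots> = L * (t powr (\<alpha> - \<delta>) * l)" using t by (simp add: powr_diff)
  also have "\<dots> \<le> L * (l powr (- 2 * (\<alpha> - \<delta>)) * l)"
    using L l delta by (intro mult_left_mono mult_right_mono pw) auto
  also have "l powr (- 2 * (\<alpha> - \<delta>)) * l = l powr (- 2 * (\<alpha> - \<delta>) + 1)" using l by (simp add: powr_add)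
  also have "L * l powr (- 2 * (\<alpha> - \<delta>) + 1) \<le> L * l powr (2 * \<delta>)"
    using L l alpha by (intro mult_left_mono powr_mono) auto
  finally show "\<bar>\<gamma> (x, t) - x\<bar> * l / t powr \<delta> \<le> L * l powr (2 * \<delta>)" .
  have "t * l\<^sup>2 / t powr \<delta> = t powr (1 - \<delta>) * l\<^sup>2" using t by (simp add: powr_diff)
  also have "\<dots> \<le> l powr (- 2 * (1 - \<delta>)) * l\<^sup>2" using delta alpha by (intro mult_right_mono pw) auto
  also have "\<dots> = l powr (- 2 * (1 - \<delta>)) * l powr 2" using l by simp
  also have "\<dots> = l powr (2 * \<delta>)" by (simp add: powr_add[symmetric])
  finally show "t * l\<^sup>2 / t powr \<delta> \<le> l powr (2 * \<delta>)" .
qed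

lemma small_time_difference:
  fixes g :: "real \<Rightarrow> complex" and M1 M2 :: ennreal
  assumes delta: "0 \<le> \<delta>" "\<delta> < \<alpha>" and l: "l \<ge> 1" and t: "0 < t" "t \<le> 1 / l\<^sup>2"
    and g: "g \<in> borel_measurable borel"
    and gi: "integrable lborel g" "integrable lborel (\<lambda>\<xi>. complex_of_real (\<xi> / l) * g \<xi>)" "integrable lborel (\<lambda>\<xi>. complex_of_real ((\<xi> / l)\<^sup>2) * g \<xi>)"
    and M1: "\<And>u. u \<in> {0..1} \<Longrightarrow> ennreal ((norm (chirp (\<lambda>\<xi>. complex_of_real (\<xi> / l) * g \<xi>) (x + u * (\<gamma> (x, t) - x)) (u * t)))\<^sup>2) \<le> M1"
    and M2: "\<And>u. u \<in> {0..1} \<Longrightarrow> ennreal ((norm (chirp (\<lambda>\<xi>. complex_of_real ((\<xi> / l)\<^sup>2) * g \<xi>) (x + u * (\<gamma> (x, t) - x)) (u * t)))\<^sup>2) \<le> M2"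
  shows "ennreal ((norm (chirp g (\<gamma> (x, t)) t - chirp g x 0) / t powr \<delta>)\<^sup>2) \<le>
     ennreal (2 * (L + 1)\<^sup>2 * l powr (4 * \<delta>)) * (M1 + M2)"
\<comment> \<open>An infinite majorant makes the right-hand side infinite, because its coefficient
  is nonzero. Otherwise everything can be computed with real numbers.\<close>
proof (cases "M1 = \<top> \<or> M2 = \<top>")
  case True
  moreover have "ennreal (2 * (L + 1)\<^sup>2 * l powr (4 * \<delta>)) \<noteq> 0" using L l by (simp add: ennreal_eq_0_iff not_le)
  ultimately show ?thesis by (auto simp: ennreal_mult_top)
next
  case False
  then obtain m1 m2 where m: "M1 = ennreal m1" "M2 = ennreal m2" "m1 \<ge> 0" "m2 \<ge> 0"
    by (cases M1; cases M2) auto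
  have S1: "norm (chirp (\<lambda>\<xi>. complex_of_real (\<xi> / l) * g \<xi>) (x + u * (\<gamma> (x, t) - x)) (u * t)) \<le> sqrt m1" if "u \<in> {0..1}" for u
    using M1[OF that] m by (intro real_le_rsqrt) (auto simp: ennreal_le_iff)
  have S2: "norm (chirp (\<lambda>\<xi>. complex_of_real ((\<xi> / l)\<^sup>2) * g \<xi>) (x + u * (\<gamma> (x, t) - x)) (u * t)) \<le> sqrt m2" if "u \<in> {0..1}" for u
    using M2[OF that] m by (intro real_le_rsqrt) (auto simp: ennreal_le_iff)
  have l0: "l > 0" using l by simp
  let ?A = "\<bar>\<gamma> (x, t) - x\<bar> * l / t powr \<delta>" and ?B = "t * l\<^sup>2 / t powr \<delta>" and ?D = "norm (chirp g (\<gamma> (x, t)) t - chirp g x 0) / t powr \<delta>"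
  let ?X = "(L + 1) * l powr (2 * \<delta>)"
  have "norm (chirp g (\<gamma> (x, t)) t - chirp g x 0) \<le> \<bar>\<gamma> (x, t) - x\<bar> * l * sqrt m1 + \<bar>t\<bar> * l\<^sup>2 * sqrt m2"
    by (rule chirp_mean_value[OF g l0 gi S1 S2])
  from divide_right_mono[OF this, of "t powr \<delta>"]
  have "?D \<le> ?A * sqrt m1 + ?B * sqrt m2" using t by (simp add: add_divide_distrib)
  also have "\<dots> \<le> ?X * sqrt m1 + ?X * sqrt m2"
  proof (intro add_mono mult_right_mono)
    have X: "L * l powr (2 * \<delta>) \<le> ?X" "1 * l powr (2 * \<delta>) \<le> ?X" using L by (intro mult_right_mono; simp)+
    show "?A \<le> ?X" by (rule order_trans[OF small_time_weight(1)[OF delta l t] X(1)])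
    show "?B \<le> ?X" using order_trans[OF small_time_weight(2)[OF delta l t]] X(2) by simp
  qed (use m in auto)
  finally have "?D\<^sup>2 \<le> (?X * sqrt m1 + ?X * sqrt m2)\<^sup>2" by (intro power_mono) auto
  also have "\<dots> \<le> 2 * (?X * sqrt m1)\<^sup>2 + 2 * (?X * sqrt m2)\<^sup>2" by (rule square_sum_le)
  also have "\<dots> = 2 * (L + 1)\<^sup>2 * l powr (4 * \<delta>) * (m1 + m2)"
    using m by (simp only: power_mult_distrib powr_square real_sqrt_pow2) (simp add: algebra_simps)
  finally have "ennreal (?D\<^sup>2) \<le> ennreal (2 * (L + 1)\<^sup>2 * l powr (4 * \<delta>) * (m1 + m2))" by (rule ennreal_leI)
  also have "\<dots> = ennreal (2 * (L + 1)\<^sup>2 * l powr (4 * \<delta>)) * (M1 + M2)"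
    using m by (simp add: ennreal_mult ennreal_plus)
  finally show ?thesis .
qed

text \<open>Here \<open>z\<close> and \<open>w\<close> stand for the values at time \<open>t\<close>
  and at time 0, and no cancellation between them is used. The initial value is charged the weight
  of the shortest time \<open>1 / l^2\<close>.\<close>

lemma large_time_difference:
  assumes delta: "0 \<le> \<delta>" and l: "l \<ge> 1" and t: "1 / l\<^sup>2 \<le> T" "T \<le> t"
    and M: "ennreal ((norm z)\<^sup>2) \<le> M" and M0: "ennreal ((norm w)\<^sup>2) \<le> M0"
  shows "ennreal ((norm (z - w) / t powr \<delta>)\<^sup>2) \<le> ennreal (2 * T powr (- 2 * \<delta>)) * M + ennreal (2 * l powr (4 * \<delta>)) * M0"
proof -
  have T0: "T > 0" using t l by (smt (verit) divide_pos_pos zero_less_power2)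
  have "t powr (- 2 * \<delta>) \<le> T powr (- 2 * \<delta>)" using T0 t delta by (intro powr_mono2') auto
  then have tT: "1 / t powr (2 * \<delta>) \<le> T powr (- 2 * \<delta>)" using powr_minus_divide[of t "2 * \<delta>"] by simp
  have "(1 / l\<^sup>2) powr (- 2 * \<delta>) = (l powr (-2)) powr (- 2 * \<delta>)" using l by (simp add: powr_minus divide_simps)
  then have l2: "(1 / l\<^sup>2) powr (- 2 * \<delta>) = l powr (4 * \<delta>)" by (simp add: powr_powr)
  have Tl: "T powr (- 2 * \<delta>) \<le> l powr (4 * \<delta>)"
    unfolding l2[symmetric] using l t delta by (intro powr_mono2') auto
  have "(norm (z - w))\<^sup>2 \<le> (norm z + norm w)\<^sup>2" by (intro power_mono norm_triangle_ineq4) auto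
  also have "\<dots> \<le> 2 * (norm z)\<^sup>2 + 2 * (norm w)\<^sup>2" by (rule square_sum_le)
  finally have "(norm (z - w))\<^sup>2 * (1 / t powr (2 * \<delta>)) \<le> (2 * (norm z)\<^sup>2 + 2 * (norm w)\<^sup>2) * T powr (- 2 * \<delta>)"
    using tT by (intro mult_mono) auto
  also have "\<dots> = 2 * T powr (- 2 * \<delta>) * (norm z)\<^sup>2 + 2 * (norm w)\<^sup>2 * T powr (- 2 * \<delta>)" by (simp add: algebra_simps)
  also have "\<dots> \<le> 2 * T powr (- 2 * \<delta>) * (norm z)\<^sup>2 + 2 * (norm w)\<^sup>2 * l powr (4 * \<delta>)"
    using Tl by (intro add_left_mono mult_left_mono) auto
  finally have "(norm (z - w) / t powr \<delta>)\<^sup>2 \<le> 2 * T powr (- 2 * \<delta>) * (norm z)\<^sup>2 + 2 * l powr (4 * \<delta>) * (norm w)\<^sup>2"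
    by (simp add: power_divide powr_square mult_ac)
  then have "ennreal ((norm (z - w) / t powr \<delta>)\<^sup>2) \<le> ennreal (2 * T powr (- 2 * \<delta>) * (norm z)\<^sup>2 + 2 * l powr (4 * \<delta>) * (norm w)\<^sup>2)" by (rule ennreal_leI)
  also have "\<dots> = ennreal (2 * T powr (- 2 * \<delta>)) * ennreal ((norm z)\<^sup>2) + ennreal (2 * l powr (4 * \<delta>)) * ennreal ((norm w)\<^sup>2)"
    by (simp add: ennreal_mult ennreal_plus)
  also have "\<dots> \<le> ennreal (2 * T powr (- 2 * \<delta>)) * M + ennreal (2 * l powr (4 * \<delta>)) * M0"
    using M M0 by (intro add_mono mult_left_mono) auto
  finally show ?thesis .
qed

lemma frequency_weight:
  fixes g :: "real \<Rightarrow> complex"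
  assumes g [measurable]: "g \<in> borel_measurable borel" and l: "l \<ge> 1"
    and g2: "integrable lborel (\<lambda>\<xi>. (norm (g \<xi>))\<^sup>2)" and supp: "\<And>\<xi>. \<bar>\<xi>\<bar> > l \<Longrightarrow> g \<xi> = 0"
  shows "integrable lborel (\<lambda>\<xi>. (norm (complex_of_real ((\<xi> / l) ^ j) * g \<xi>))\<^sup>2)"
    "(LINT \<xi>|lborel. (norm (complex_of_real ((\<xi> / l) ^ j) * g \<xi>))\<^sup>2) \<le> (LINT \<xi>|lborel. (norm (g \<xi>))\<^sup>2)"
proof -
  have le: "norm (complex_of_real ((\<xi> / l) ^ j) * g \<xi>) \<le> norm (g \<xi>)" for \<xi>
  proof (cases "\<bar>\<xi>\<bar> > l")
    case False
    then have "\<bar>\<xi> / l\<bar> ^ j \<le> 1" using l by (intro power_le_one) auto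
    then have "\<bar>\<xi> / l\<bar> ^ j * norm (g \<xi>) \<le> norm (g \<xi>)" by (intro mult_left_le_one_le) auto
    then show ?thesis by (simp only: norm_mult norm_of_real power_abs)
  qed (simp add: supp)
  show "integrable lborel (\<lambda>\<xi>. (norm (complex_of_real ((\<xi> / l) ^ j) * g \<xi>))\<^sup>2)"
  proof (rule Bochner_Integration.integrable_bound[OF g2])
    show "AE \<xi> in lborel. norm ((norm (complex_of_real ((\<xi> / l) ^ j) * g \<xi>))\<^sup>2) \<le> norm ((norm (g \<xi>))\<^sup>2)"
      unfolding real_norm_def abs_power2 by (intro AE_I2 power_mono le norm_ge_zero)
  qed measurable
  then show "(LINT \<xi>|lborel. (norm (complex_of_real ((\<xi> / l) ^ j) * g \<xi>))\<^sup>2) \<le> (LINT \<xi>|lborel. (norm (g \<xi>))\<^sup>2)"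
    by (intro integral_mono g2 power_mono le) auto
qed

end

text \<open>Between \<open>4^(-n)\<close> and 1 there are \<open>2 * n\<close> dyadic times; this
  absorbs their number into an arbitrarily small power of the frequency
  \<open>2 ^ n\<close>.\<close>

lemma power_of_two_dominates:
  assumes "\<eta> > 0" shows "real n \<le> ((2::real) ^ n) powr \<eta> / (\<eta> * ln 2)"
proof -
  have "\<eta> * ln 2 * real n \<le> exp (\<eta> * ln 2 * real n)" using exp_ge_add_one_self[of "\<eta> * ln 2 * real n"] by linarith
  also have "\<dots> = ((2::real) ^ n) powr \<eta>" by (simp add: powr_def ln_realpow mult_ac)
  finally show ?thesis using assms by (simp add: field_simps)
qed

context hoelder_path begin

text \<open>One majorant serves both the difference quotient and the initial value, the latter being
  needed for the existence of the limits. Of the loss \<open>2 * \<eta>\<close>, one half comes from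
  the estimates at fixed scale and the other from the number of dyadic times.\<close>

lemma piece_estimate:
  assumes delta: "0 \<le> \<delta>" "\<delta> < \<alpha>" and eta: "0 < \<eta>" "\<eta> < 1/2" and R: "R > 0"
  obtains C where "C > 0" and
   "\<And>n g. g \<in> borel_measurable borel \<Longrightarrow>
     integrable lborel (\<lambda>\<xi>. (norm (g \<xi>))\<^sup>2) \<Longrightarrow> (\<And>\<xi>. \<bar>\<xi>\<bar> > 2 ^ n \<Longrightarrow> g \<xi> = 0) \<Longrightarrow>
     \<exists>M \<in> borel_measurable borel.
      (\<forall>x t. \<bar>x\<bar> \<le> R \<longrightarrow> 0 < t \<longrightarrow> t \<le> 1 \<longrightarrow>
         ennreal ((norm (chirp g (\<gamma> (x, t)) t - chirp g x 0) / t powr \<delta>)\<^sup>2) \<le> M x) \<and>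
      (\<forall>x. \<bar>x\<bar> \<le> R \<longrightarrow> ennreal ((norm (chirp g x 0))\<^sup>2) \<le> M x) \<and>
      (\<integral>\<^sup>+x. M x \<partial>lborel) \<le>
        ennreal (C * (2 ^ n) powr (2 * critical_exponent \<delta> + 2 * \<eta>) * (LINT \<xi>|lborel. (norm (g \<xi>))\<^sup>2))"
proof -
  define p where "p = min (2 * \<delta>) (1/2 - \<eta>)"
  have p: "0 \<le> p" "p \<le> 1/2 - \<eta>" using delta eta by (auto simp: p_def)
  obtain Cl where Cl: "Cl > 0" and large:
   "\<And>l T g. l \<ge> 1 \<Longrightarrow> 1 / l\<^sup>2 \<le> T \<Longrightarrow> T \<le> 1 \<Longrightarrow> g \<in> borel_measurable borel \<Longrightarrow>
     integrable lborel (\<lambda>\<xi>. (norm (g \<xi>))\<^sup>2) \<Longrightarrow> (\<And>\<xi>. \<bar>\<xi>\<bar> > l \<Longrightarrow> g \<xi> = 0) \<Longrightarrow>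
     \<exists>M \<in> borel_measurable borel.
      (\<forall>x t. \<bar>x\<bar> \<le> R \<longrightarrow> t \<in> {0..1} \<inter> {T..2*T} \<longrightarrow> ennreal ((norm (chirp g (\<gamma> (x, t)) t))\<^sup>2) \<le> M x) \<and>
      (\<integral>\<^sup>+x. M x \<partial>lborel) \<le> ennreal (Cl * (l powr (1/2 + p) * T powr p + l powr \<eta>) * (LINT \<xi>|lborel. (norm (g \<xi>))\<^sup>2))"
    using maximal_large_time[OF eta p R] by blast
  obtain Cs where Cs: "Cs > 0" and small:
   "\<And>l g. l \<ge> 1 \<Longrightarrow> g \<in> borel_measurable borel \<Longrightarrow>
     integrable lborel (\<lambda>\<xi>. (norm (g \<xi>))\<^sup>2) \<Longrightarrow> (\<And>\<xi>. \<bar>\<xi>\<bar> > l \<Longrightarrow> g \<xi> = 0) \<Longrightarrow>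
     \<exists>M \<in> borel_measurable borel.
      (\<forall>x t u. \<bar>x\<bar> \<le> R \<longrightarrow> t \<in> {0..1 / l\<^sup>2} \<longrightarrow> u \<in> {0..1} \<longrightarrow>
         ennreal ((norm (chirp g (x + u * (\<gamma> (x, t) - x)) (u * t)))\<^sup>2) \<le> M x) \<and>
      (\<integral>\<^sup>+x. M x \<partial>lborel) \<le> ennreal (Cs * l powr \<eta> * (LINT \<xi>|lborel. (norm (g \<xi>))\<^sup>2))"
    using maximal_small_time[OF eta R] by blast
  \<comment> \<open>The four summands match those of \<open>M\<close> below: the initial value
    alone, the two weighted functions of the small times, the large times, and the initial value
    subtracted at large times.\<close>
  define C where "C = Cs + 4 * (L + 1)\<^sup>2 * Cs + 8 * Cl / (\<eta> * ln 2) + 2 * Cs"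
  show ?thesis
  proof (rule that[of C])
    show "C > 0" unfolding C_def using Cs Cl eta by (intro add_pos_pos add_pos_nonneg) auto
  next
    fix n and g :: "real \<Rightarrow> complex"
    assume g [measurable]: "g \<in> borel_measurable borel" and gsq: "integrable lborel (\<lambda>\<xi>. (norm (g \<xi>))\<^sup>2)"
      and supp: "\<And>\<xi>. \<bar>\<xi>\<bar> > 2 ^ n \<Longrightarrow> g \<xi> = 0"
    define l :: real where "l = 2 ^ n"
    have l: "l \<ge> 1" by (simp add: l_def)
    have supp': "\<And>\<xi>. \<bar>\<xi>\<bar> > l \<Longrightarrow> g \<xi> = 0" using supp by (simp add: l_def)
    define G where "G = (LINT \<xi>|lborel. (norm (g \<xi>))\<^sup>2)"
    have G: "G \<ge> 0" by (simp add: G_def)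
    define g1 where "g1 = (\<lambda>\<xi>. complex_of_real (\<xi> / l) * g \<xi>)"
    define g2 where "g2 = (\<lambda>\<xi>. complex_of_real ((\<xi> / l)\<^sup>2) * g \<xi>)"
    have m12: "g1 \<in> borel_measurable borel" "g2 \<in> borel_measurable borel" unfolding g1_def g2_def by measurable
    have sq1: "integrable lborel (\<lambda>\<xi>. (norm (g1 \<xi>))\<^sup>2)" "(LINT \<xi>|lborel. (norm (g1 \<xi>))\<^sup>2) \<le> G"
      using frequency_weight[OF g l gsq supp', where j=1] unfolding g1_def G_def power_one_right by blast+
    have sq2: "integrable lborel (\<lambda>\<xi>. (norm (g2 \<xi>))\<^sup>2)" "(LINT \<xi>|lborel. (norm (g2 \<xi>))\<^sup>2) \<le> G"
      using frequency_weight[OF g l gsq supp', where j=2] unfolding g2_def G_def by blast+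
    have s12: "\<And>\<xi>. \<bar>\<xi>\<bar> > l \<Longrightarrow> g1 \<xi> = 0" "\<And>\<xi>. \<bar>\<xi>\<bar> > l \<Longrightarrow> g2 \<xi> = 0" by (auto simp: g1_def g2_def supp')
    have gi: "integrable lborel g" "integrable lborel g1" "integrable lborel g2"
      by (rule integrable_of_square[OF g gsq supp'], assumption)
        (rule integrable_of_square[OF m12(1) sq1(1) s12(1)], assumption,
         rule integrable_of_square[OF m12(2) sq2(1) s12(2)], assumption)
    define as where "as = Cs * l powr \<eta> * G"
    have as0: "as \<ge> 0" using Cs G by (simp add: as_def)
    have smaller: "ennreal (Cs * l powr \<eta> * H) \<le> ennreal as" if "H \<le> G" for H
      using that Cs unfolding as_def by (intro ennreal_leI mult_left_mono) auto
    obtain M0 where [measurable]: "M0 \<in> borel_measurable borel"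
      and M0: "\<And>x t u. \<bar>x\<bar> \<le> R \<Longrightarrow> t \<in> {0..1 / l\<^sup>2} \<Longrightarrow> u \<in> {0..1} \<Longrightarrow> ennreal ((norm (chirp g (x + u * (\<gamma> (x, t) - x)) (u * t)))\<^sup>2) \<le> M0 x"
      and I0: "(\<integral>\<^sup>+x. M0 x \<partial>lborel) \<le> ennreal as"
      using small[OF l g gsq supp'] unfolding G_def[symmetric] as_def[symmetric] by auto
    obtain M1 where [measurable]: "M1 \<in> borel_measurable borel"
      and M1: "\<And>x t u. \<bar>x\<bar> \<le> R \<Longrightarrow> t \<in> {0..1 / l\<^sup>2} \<Longrightarrow> u \<in> {0..1} \<Longrightarrow> ennreal ((norm (chirp g1 (x + u * (\<gamma> (x, t) - x)) (u * t)))\<^sup>2) \<le> M1 x"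
      and I1': "(\<integral>\<^sup>+x. M1 x \<partial>lborel) \<le> ennreal (Cs * l powr \<eta> * (LINT \<xi>|lborel. (norm (g1 \<xi>))\<^sup>2))"
      using small[OF l m12(1) sq1(1) s12(1)] by auto
    note I1 = order_trans[OF I1' smaller[OF sq1(2)]]
    obtain M2 where [measurable]: "M2 \<in> borel_measurable borel"
      and M2: "\<And>x t u. \<bar>x\<bar> \<le> R \<Longrightarrow> t \<in> {0..1 / l\<^sup>2} \<Longrightarrow> u \<in> {0..1} \<Longrightarrow> ennreal ((norm (chirp g2 (x + u * (\<gamma> (x, t) - x)) (u * t)))\<^sup>2) \<le> M2 x"
      and I2': "(\<integral>\<^sup>+x. M2 x \<partial>lborel) \<le> ennreal (Cs * l powr \<eta> * (LINT \<xi>|lborel. (norm (g2 \<xi>))\<^sup>2))"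
      using small[OF l m12(2) sq2(1) s12(2)] by auto
    note I2 = order_trans[OF I2' smaller[OF sq2(2)]]
    define T where "T = (\<lambda>m. 2 ^ m / (2 ^ n)\<^sup>2 :: real)"
    have T1: "1 / l\<^sup>2 \<le> T m" for m unfolding T_def l_def by (intro divide_right_mono) auto
    have T2: "T m \<le> 1" if "m < 2 * n" for m
    proof -
      have "(2::real) ^ m \<le> 2 ^ (2 * n)" using that by (intro power_increasing) auto
      also have "\<dots> = (2 ^ n)\<^sup>2" by (rule power_even_eq)
      finally show ?thesis by (simp add: T_def)
    qed
    define Q where "Q = (\<lambda>m M. M \<in> borel_measurable borel \<and>
      (\<forall>x t. \<bar>x\<bar> \<le> R \<longrightarrow> t \<in> {0..1} \<inter> {T m..2 * T m} \<longrightarrow> ennreal ((norm (chirp g (\<gamma> (x, t)) t))\<^sup>2) \<le> M x) \<and>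
      (\<integral>\<^sup>+x. M x \<partial>lborel) \<le> ennreal (Cl * (l powr (1/2 + p) * T m powr p + l powr \<eta>) * G))"
    have "\<exists>M. Q m M" if "m < 2 * n" for m
      using large[OF l T1 T2[OF that] g gsq supp'] unfolding Q_def G_def by (simp only: Bex_def)
    then have "\<forall>m. \<exists>M. m < 2 * n \<longrightarrow> Q m M" by blast
    from choice[OF this] obtain Mt where "\<forall>m. m < 2 * n \<longrightarrow> Q m (Mt m)" ..
    then have MtQ: "Q m (Mt m)" if "m < 2 * n" for m using that by simp
    have Mt_meas: "\<And>m. m < 2 * n \<Longrightarrow> Mt m \<in> borel_measurable borel"
      and Mt: "\<And>m x t. m < 2 * n \<Longrightarrow> \<bar>x\<bar> \<le> R \<Longrightarrow> t \<in> {0..1} \<inter> {T m..2 * T m} \<Longrightarrow> ennreal ((norm (chirp g (\<gamma> (x, t)) t))\<^sup>2) \<le> Mt m x"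
      and IL: "\<And>m. m < 2 * n \<Longrightarrow> (\<integral>\<^sup>+x. Mt m x \<partial>lborel) \<le> ennreal (Cl * (l powr (1/2 + p) * T m powr p + l powr \<eta>) * G)"
      using MtQ unfolding Q_def by blast+
    define K1 where "K1 = 2 * (L + 1)\<^sup>2 * l powr (4 * \<delta>)"
    define K2 where "K2 = 2 * l powr (4 * \<delta>)"
    define w where "w = (\<lambda>m. 2 * T m powr (- 2 * \<delta>))"
    have K0: "K1 \<ge> 0" "K2 \<ge> 0" "\<And>m. w m \<ge> 0" by (auto simp: K1_def K2_def w_def)
    define M where "M = (\<lambda>x. M0 x + ennreal K1 * (M1 x + M2 x) + (\<Sum>m<2*n. ennreal (w m) * Mt m x) + ennreal K2 * M0 x)"
    have [measurable]: "(\<lambda>x. \<Sum>m<2*n. ennreal (w m) * Mt m x) \<in> borel_measurable borel"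
      using Mt_meas by (intro borel_measurable_sum borel_measurable_times) auto
    have M_meas: "M \<in> borel_measurable borel" unfolding M_def by measurable
    have start0: "ennreal ((norm (chirp g x 0))\<^sup>2) \<le> M0 x" if "\<bar>x\<bar> \<le> R" for x
      using M0[OF that, of 0 0] by simp
    define X where "X = l powr (2 * critical_exponent \<delta> + 2 * \<eta>)"
    have lX: "l powr e \<le> X" if "e \<le> 4 * \<delta> + \<eta>" for e
      unfolding X_def using that l critical_exponent_ge(1)[OF delta(1)] eta by (intro powr_mono) auto
    have "(\<integral>\<^sup>+x. M x \<partial>lborel) = (\<integral>\<^sup>+x. M0 x \<partial>lborel) + ennreal K1 * ((\<integral>\<^sup>+x. M1 x \<partial>lborel) + (\<integral>\<^sup>+x. M2 x \<partial>lborel))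
       + (\<Sum>m<2*n. ennreal (w m) * (\<integral>\<^sup>+x. Mt m x \<partial>lborel)) + ennreal K2 * (\<integral>\<^sup>+x. M0 x \<partial>lborel)"
    proof -
      have "(\<integral>\<^sup>+x. (\<Sum>m<2*n. ennreal (w m) * Mt m x) \<partial>lborel) = (\<Sum>m<2*n. ennreal (w m) * (\<integral>\<^sup>+x. Mt m x \<partial>lborel))"
        using Mt_meas by (subst nn_integral_sum) (auto intro!: borel_measurable_times sum.cong nn_integral_cmult)
      then show ?thesis unfolding M_def by (simp add: nn_integral_add nn_integral_cmult)
    qed
    also have "\<dots> \<le> ennreal as + ennreal K1 * (ennreal as + ennreal as)
       + (\<Sum>m<2*n. ennreal (w m) * ennreal (Cl * (l powr (1/2 + p) * T m powr p + l powr \<eta>) * G)) + ennreal K2 * ennreal as"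
      using I0 I1 I2 IL by (intro add_mono mult_left_mono sum_mono) auto
    also have "(\<Sum>m<2*n. ennreal (w m) * ennreal (Cl * (l powr (1/2 + p) * T m powr p + l powr \<eta>) * G))
       \<le> (\<Sum>m<2*n. ennreal (4 * Cl * G * l powr (2 * critical_exponent \<delta> + \<eta>)))"
    proof (intro sum_mono)
      fix m assume "m \<in> {..<2*n}"
      have "w m * (Cl * (l powr (1/2 + p) * T m powr p + l powr \<eta>) * G) =
         2 * Cl * G * (T m powr (- 2 * \<delta>) * (l powr (1/2 + p) * T m powr p + l powr \<eta>))" by (simp add: w_def)
      also have "\<dots> \<le> 2 * Cl * G * (2 * l powr (2 * critical_exponent \<delta> + \<eta>))"
        using Cl G by (intro mult_left_mono large_time_exponents[OF delta(1) eta l T1 p_def]) auto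
      finally have "w m * (Cl * (l powr (1/2 + p) * T m powr p + l powr \<eta>) * G) \<le> 4 * Cl * G * l powr (2 * critical_exponent \<delta> + \<eta>)"
        by simp
      then show "ennreal (w m) * ennreal (Cl * (l powr (1/2 + p) * T m powr p + l powr \<eta>) * G) \<le> ennreal (4 * Cl * G * l powr (2 * critical_exponent \<delta> + \<eta>))"
        using K0 by (simp add: ennreal_mult'[symmetric] ennreal_leI)
    qed
    also have "\<dots> = ennreal (real (2 * n) * (4 * Cl * G * l powr (2 * critical_exponent \<delta> + \<eta>)))"
      using Cl G by (subst sum_ennreal) auto
    also have "ennreal as + ennreal K1 * (ennreal as + ennreal as)
       + ennreal (real (2 * n) * (4 * Cl * G * l powr (2 * critical_exponent \<delta> + \<eta>))) + ennreal K2 * ennreal as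
       = ennreal (as + K1 * (as + as) + real (2 * n) * (4 * Cl * G * l powr (2 * critical_exponent \<delta> + \<eta>)) + K2 * as)"
      using as0 K0 Cl G by (simp add: ennreal_mult[symmetric] ennreal_plus[symmetric] del: ennreal_plus)
    also have "\<dots> \<le> ennreal (C * X * G)"
    proof (rule ennreal_leI)
      have a: "as \<le> Cs * X * G" unfolding as_def
        using Cs G delta by (intro mult_right_mono mult_left_mono lX) auto
      have b: "l powr (4 * \<delta>) * as \<le> Cs * X * G"
      proof -
        have "l powr (4 * \<delta>) * as = Cs * l powr (4 * \<delta> + \<eta>) * G" by (simp add: as_def powr_add)
        also have "\<dots> \<le> Cs * X * G" using Cs G by (intro mult_right_mono mult_left_mono lX) auto
        finally show ?thesis .
      qed
      \<comment> \<open>The sum over the dyadic times is paid for by the second \<eta> in the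
        exponent of \<open>X\<close>.\<close>
      have c: "real n * l powr (2 * critical_exponent \<delta> + \<eta>) \<le> X / (\<eta> * ln 2)"
      proof -
        have "real n * l powr (2 * critical_exponent \<delta> + \<eta>) \<le> l powr \<eta> / (\<eta> * ln 2) * l powr (2 * critical_exponent \<delta> + \<eta>)"
          using power_of_two_dominates[OF eta(1), of n] by (intro mult_right_mono) (auto simp: l_def)
        also have "\<dots> = X / (\<eta> * ln 2)" by (simp add: X_def powr_add[symmetric] algebra_simps)
        finally show ?thesis .
      qed
      have "K1 * (as + as) = 4 * (L + 1)\<^sup>2 * (l powr (4 * \<delta>) * as)" by (simp add: K1_def)
      also have "\<dots> \<le> 4 * (L + 1)\<^sup>2 * (Cs * X * G)" using b by (intro mult_left_mono) auto
      finally have k1: "K1 * (as + as) \<le> 4 * (L + 1)\<^sup>2 * (Cs * X * G)" .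
      have k2: "K2 * as \<le> 2 * (Cs * X * G)" using b by (simp add: K2_def)
      have "real (2 * n) * (4 * Cl * G * l powr (2 * critical_exponent \<delta> + \<eta>)) = 8 * Cl * G * (real n * l powr (2 * critical_exponent \<delta> + \<eta>))" by simp
      also have "\<dots> \<le> 8 * Cl * G * (X / (\<eta> * ln 2))" using c Cl G by (intro mult_left_mono) auto
      finally have k3: "real (2 * n) * (4 * Cl * G * l powr (2 * critical_exponent \<delta> + \<eta>)) \<le> 8 * Cl * G * (X / (\<eta> * ln 2))" .
      have "as + K1 * (as + as) + real (2 * n) * (4 * Cl * G * l powr (2 * critical_exponent \<delta> + \<eta>)) + K2 * as \<le>
         Cs * X * G + 4 * (L + 1)\<^sup>2 * (Cs * X * G) + 8 * Cl * G * (X / (\<eta> * ln 2)) + 2 * (Cs * X * G)"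
        using a k1 k2 k3 by linarith
      also have "\<dots> = C * X * G" by (simp add: C_def algebra_simps)
      finally show "as + K1 * (as + as) + real (2 * n) * (4 * Cl * G * l powr (2 * critical_exponent \<delta> + \<eta>)) + K2 * as \<le> C * X * G" .
    qed
    finally have int_M: "(\<integral>\<^sup>+x. M x \<partial>lborel) \<le> ennreal (C * X * G)" by (simp add: add_mono)
    have diff: "ennreal ((norm (chirp g (\<gamma> (x, t)) t - chirp g x 0) / t powr \<delta>)\<^sup>2) \<le> M x"
      if x: "\<bar>x\<bar> \<le> R" and t: "0 < t" "t \<le> 1" for x t
    proof (cases "t \<le> 1 / l\<^sup>2")
      case True
      have "ennreal ((norm (chirp g (\<gamma> (x, t)) t - chirp g x 0) / t powr \<delta>)\<^sup>2) \<le> ennreal K1 * (M1 x + M2 x)"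
        unfolding K1_def
        by (rule small_time_difference[OF delta l t(1) True g gi(1) gi(2,3)[unfolded g1_def g2_def]])
          (use M1[OF x, of t] M2[OF x, of t] t True in \<open>auto simp: g1_def g2_def\<close>)
      also have "\<dots> \<le> M x" by (simp add: M_def add_increasing add_increasing2)
      finally show ?thesis .
    next
      case False
      then have n: "n \<ge> 1" using t by (cases n) (auto simp: l_def)
      obtain m where m: "m < 2 * n" "t \<in> {T m..2 * T m}"
        using dyadic_time[OF n _ t(2)] False unfolding T_def l_def by (metis less_eq_real_def not_le)
      have "ennreal ((norm (chirp g (\<gamma> (x, t)) t - chirp g x 0) / t powr \<delta>)\<^sup>2) \<le> ennreal (w m) * Mt m x + ennreal K2 * M0 x"
        unfolding w_def K2_def
        by (rule large_time_difference[OF delta(1) l T1 _ Mt[OF m(1) x] start0[OF x]]) (use m t in auto)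
      also have "ennreal (w m) * Mt m x \<le> (\<Sum>m<2*n. ennreal (w m) * Mt m x)"
        using m by (intro member_le_sum) auto
      also have "(\<Sum>m<2*n. ennreal (w m) * Mt m x) + ennreal K2 * M0 x \<le> M x"
        unfolding M_def by (intro add_right_mono) (simp add: add_increasing)
      finally show ?thesis by (simp add: add_right_mono)
    qed
    have "M0 x \<le> M x" for x unfolding M_def by (simp add: add_increasing2 add.assoc)
    then have "ennreal ((norm (chirp g x 0))\<^sup>2) \<le> M x" if "\<bar>x\<bar> \<le> R" for x
      using start0[OF that] order_trans by blast
    with diff int_M M_meas show "\<exists>M \<in> borel_measurable borel.
      (\<forall>x t. \<bar>x\<bar> \<le> R \<longrightarrow> 0 < t \<longrightarrow> t \<le> 1 \<longrightarrow>
         ennreal ((norm (chirp g (\<gamma> (x, t)) t - chirp g x 0) / t powr \<delta>)\<^sup>2) \<le> M x) \<and>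
      (\<forall>x. \<bar>x\<bar> \<le> R \<longrightarrow> ennreal ((norm (chirp g x 0))\<^sup>2) \<le> M x) \<and>
      (\<integral>\<^sup>+x. M x \<partial>lborel) \<le>
        ennreal (C * (2 ^ n) powr (2 * critical_exponent \<delta> + 2 * \<eta>) * (LINT \<xi>|lborel. (norm (g \<xi>))\<^sup>2))"
      unfolding X_def G_def l_def by blast
  qed
qed

end

section \<open>Almost everywhere convergence\<close>

lemma propagator_integrand_eq:
  "propagator_integrand \<gamma> f x t = (\<lambda>\<xi>. exp (\<i> * complex_of_real (\<gamma> (x, t) * \<xi> + t * \<xi>\<^sup>2)) * fourier_function f \<xi>)"
  by (simp add: propagator_integrand_def fun_eq_iff)

text \<open>Unifies the two branches of the definition: when the Fourier transform is integrable,
  dominated convergence shows that the truncations tend to the full integral as well, so it is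
  enough to study the truncations.\<close>

lemma propagator_from_truncations:
  assumes [measurable]: "fourier_function f \<in> borel_measurable borel"
    and S: "dyadic_truncation \<gamma> f x t \<longlonglongrightarrow> S"
  shows "propagator_exists \<gamma> f x t" "propagator \<gamma> f x t = S / (2 * complex_of_real pi)"
proof -
  show "propagator_exists \<gamma> f x t" using S by (auto simp: propagator_exists_def convergent_def)
  show "propagator \<gamma> f x t = S / (2 * complex_of_real pi)"
  proof (cases "integrable lborel (fourier_function f)")
    case True
    have "dyadic_truncation \<gamma> f x t \<longlonglongrightarrow> (LINT \<xi>|lborel. propagator_integrand \<gamma> f x t \<xi>)"
      unfolding dyadic_truncation_def set_lebesgue_integral_def propagator_integrand_eq
    proof (rule integral_dominated_convergence[where w="\<lambda>\<xi>. norm (fourier_function f \<xi>)"])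
      show "AE \<xi> in lborel. (\<lambda>n. indicat_real {\<xi>. \<bar>\<xi>\<bar> \<le> 2 ^ n} \<xi> *\<^sub>R
          (iexp (\<gamma> (x, t) * \<xi> + t * \<xi>\<^sup>2) * fourier_function f \<xi>)) \<longlonglongrightarrow> iexp (\<gamma> (x, t) * \<xi> + t * \<xi>\<^sup>2) * fourier_function f \<xi>"
      proof (rule AE_I2)
        fix \<xi> :: real
        obtain N where N: "\<bar>\<xi>\<bar> < 2 ^ N" using real_arch_pow[of 2 "\<bar>\<xi>\<bar>"] by auto
        have "\<forall>n\<ge>N. \<bar>\<xi>\<bar> \<le> 2 ^ n"
        proof (intro allI impI)
          fix n assume "N \<le> n"
          then have "(2::real) ^ N \<le> 2 ^ n" by (intro power_increasing) auto
          then show "\<bar>\<xi>\<bar> \<le> 2 ^ n" using N by linarith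
        qed
        then have "\<forall>\<^sub>F n in sequentially. indicat_real {\<xi>. \<bar>\<xi>\<bar> \<le> 2 ^ n} \<xi> *\<^sub>R
          (iexp (\<gamma> (x, t) * \<xi> + t * \<xi>\<^sup>2) * fourier_function f \<xi>) = iexp (\<gamma> (x, t) * \<xi> + t * \<xi>\<^sup>2) * fourier_function f \<xi>"
          unfolding eventually_sequentially by (intro exI[of _ N]) auto
        then show "(\<lambda>n. indicat_real {\<xi>. \<bar>\<xi>\<bar> \<le> 2 ^ n} \<xi> *\<^sub>R
          (iexp (\<gamma> (x, t) * \<xi> + t * \<xi>\<^sup>2) * fourier_function f \<xi>)) \<longlonglongrightarrow> iexp (\<gamma> (x, t) * \<xi> + t * \<xi>\<^sup>2) * fourier_function f \<xi>"
          by (rule tendsto_eventually)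
      qed
      show "AE \<xi> in lborel. norm (indicat_real {\<xi>. \<bar>\<xi>\<bar> \<le> 2 ^ n} \<xi> *\<^sub>R
          (iexp (\<gamma> (x, t) * \<xi> + t * \<xi>\<^sup>2) * fourier_function f \<xi>)) \<le> norm (fourier_function f \<xi>)" for n
        by (intro AE_I2) (simp add: norm_mult split: split_indicator)
    qed (use True in auto)
    with S have "S = (LINT \<xi>|lborel. propagator_integrand \<gamma> f x t \<xi>)" by (rule LIMSEQ_unique)
    then show ?thesis using True by (simp add: propagator_def)
  next
    case False
    then show ?thesis using limI[OF S] by (simp add: propagator_def)
  qed
qed

text \<open>The shells are cut at the powers of 2 that define the truncations, so partial sums of
  pieces are exactly the truncated integrals. Piece 0 is the whole interval of frequencies of
  modulus at most 1.\<close>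

definition dyadic_piece :: "(real \<Rightarrow> complex) \<Rightarrow> nat \<Rightarrow> real \<Rightarrow> complex" where
  "dyadic_piece g n \<xi> = (if \<bar>\<xi>\<bar> \<le> 2 ^ n \<and> (n = 0 \<or> 2 ^ (n - 1) < \<bar>\<xi>\<bar>) then g \<xi> else 0)"

lemma measurable_dyadic_piece [measurable]:
  "g \<in> borel_measurable borel \<Longrightarrow> dyadic_piece g n \<in> borel_measurable borel"
  by (cases "n = 0") (simp_all add: dyadic_piece_def[abs_def], measurable)

lemma sum_dyadic_piece: "(\<Sum>n\<le>N. dyadic_piece g n \<xi>) = (if \<bar>\<xi>\<bar> \<le> 2 ^ N then g \<xi> else 0)"
proof (induction N)
  case 0 show ?case by (simp add: dyadic_piece_def)
next
  case (Suc N)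
  have "(2::real) ^ N \<le> 2 ^ Suc N" by simp
  then show ?case using Suc by (auto simp: dyadic_piece_def)
qed

lemma dyadic_truncation_eq:
  assumes "\<And>n. integrable lborel (dyadic_piece (fourier_function f) n)"
  shows "dyadic_truncation \<gamma> f x t N = (\<Sum>n\<le>N. chirp (dyadic_piece (fourier_function f) n) (\<gamma> (x, t)) t)"
proof -
  have "dyadic_truncation \<gamma> f x t N =
    (LINT \<xi>|lborel. (\<Sum>n\<le>N. exp (\<i> * complex_of_real (\<gamma> (x, t) * \<xi> + t * \<xi>\<^sup>2)) * dyadic_piece (fourier_function f) n \<xi>))"
    unfolding dyadic_truncation_def set_lebesgue_integral_def propagator_integrand_eq sum_distrib_left[symmetric] sum_dyadic_piece
    by (intro Bochner_Integration.integral_cong refl) (auto split: split_indicator)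
  also have "\<dots> = (\<Sum>n\<le>N. chirp (dyadic_piece (fourier_function f) n) (\<gamma> (x, t)) t)"
    unfolding chirp_def by (intro Bochner_Integration.integral_sum integrable_phase assms)
  finally show ?thesis .
qed

text \<open>The constant \<open>4 powr s\<close> comes from
  \<open>(2^n)^2 <= 4 * (1 + \<xi>^2)\<close>, which holds on every shell, including the one with
  \<open>n = 0\<close>.\<close>

lemma dyadic_piece_square:
  fixes g :: "real \<Rightarrow> complex"
  assumes [measurable]: "g \<in> borel_measurable borel" and s: "s \<ge> 0"
    and W: "integrable lborel (\<lambda>\<xi>. (norm (complex_of_real ((1 + \<xi>\<^sup>2) powr (s / 2)) * g \<xi>))\<^sup>2)"
  shows "integrable lborel (\<lambda>\<xi>. (norm (dyadic_piece g n \<xi>))\<^sup>2)"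
    "(LINT \<xi>|lborel. (norm (dyadic_piece g n \<xi>))\<^sup>2) \<le>
      4 powr s * (2 ^ n) powr (- 2 * s) * (LINT \<xi>|lborel. (norm (complex_of_real ((1 + \<xi>\<^sup>2) powr (s / 2)) * g \<xi>))\<^sup>2)"
proof -
  let ?w = "\<lambda>\<xi>. (norm (complex_of_real ((1 + \<xi>\<^sup>2) powr (s / 2)) * g \<xi>))\<^sup>2"
  let ?c = "4 powr s * (2 ^ n) powr (- 2 * s) :: real"
  have le: "(norm (dyadic_piece g n \<xi>))\<^sup>2 \<le> ?c * ?w \<xi>" for \<xi>
  proof (cases "\<bar>\<xi>\<bar> \<le> 2 ^ n \<and> (n = 0 \<or> 2 ^ (n - 1) < \<bar>\<xi>\<bar>)")
    case True
    have n4: "((2::real) ^ n)\<^sup>2 \<le> 4 * (1 + \<xi>\<^sup>2)"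
    proof (cases n)
      case 0 then show ?thesis by simp
    next
      case (Suc k)
      have "(2 ^ k)\<^sup>2 \<le> \<bar>\<xi>\<bar>\<^sup>2" using True Suc by (intro power_mono) auto
      moreover have "((2::real) ^ n)\<^sup>2 = 4 * (2 ^ k)\<^sup>2" using Suc by (simp add: power_mult_distrib)
      ultimately show ?thesis by simp
    qed
    have "((2::real) ^ n) powr (2 * s) = (((2::real) ^ n) powr 2) powr s" by (simp only: powr_powr)
    also have "\<dots> = (((2::real) ^ n)\<^sup>2) powr s" by simp
    also have "\<dots> \<le> (4 * (1 + \<xi>\<^sup>2)) powr s" using n4 s by (intro powr_mono2) auto
    also have "\<dots> = 4 powr s * (1 + \<xi>\<^sup>2) powr s" by (rule powr_mult)
    finally have A: "((2::real) ^ n) powr (2 * s) \<le> 4 powr s * (1 + \<xi>\<^sup>2) powr s" .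
    have "1 = ((2::real) ^ n) powr (- 2 * s) * ((2::real) ^ n) powr (2 * s)" by (simp add: powr_add[symmetric])
    also have "\<dots> \<le> ((2::real) ^ n) powr (- 2 * s) * (4 powr s * (1 + \<xi>\<^sup>2) powr s)" by (rule mult_left_mono[OF A]) simp
    finally have "1 \<le> ?c * (1 + \<xi>\<^sup>2) powr s" by (simp only: mult_ac)
    then have "1 * (norm (g \<xi>))\<^sup>2 \<le> ?c * (1 + \<xi>\<^sup>2) powr s * (norm (g \<xi>))\<^sup>2" by (rule mult_right_mono) simp
    moreover have "?w \<xi> = (1 + \<xi>\<^sup>2) powr s * (norm (g \<xi>))\<^sup>2"
      by (simp add: norm_mult power_mult_distrib powr_square)
    ultimately show ?thesis using True by (simp add: dyadic_piece_def mult.assoc)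
  next
    case False then show ?thesis by (auto simp: dyadic_piece_def)
  qed
  show I: "integrable lborel (\<lambda>\<xi>. (norm (dyadic_piece g n \<xi>))\<^sup>2)"
  proof (rule Bochner_Integration.integrable_bound)
    show "integrable lborel (\<lambda>\<xi>. ?c * ?w \<xi>)" by (rule integrable_mult_right[OF W])
    show "AE \<xi> in lborel. norm ((norm (dyadic_piece g n \<xi>))\<^sup>2) \<le> norm (?c * ?w \<xi>)"
      unfolding real_norm_def abs_power2 by (intro AE_I2 order_trans[OF le abs_ge_self])
  qed measurable
  have "(LINT \<xi>|lborel. (norm (dyadic_piece g n \<xi>))\<^sup>2) \<le> (LINT \<xi>|lborel. ?c * ?w \<xi>)"
    by (intro integral_mono I integrable_mult_right[OF W] le)
  then show "(LINT \<xi>|lborel. (norm (dyadic_piece g n \<xi>))\<^sup>2) \<le> ?c * (LINT \<xi>|lborel. ?w \<xi>)"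
    by (simp only: integral_mult_right_zero)
qed

section \<open>Summation of the pieces\<close>

context hoelder_path begin

text \<open>For a bounded range of frequencies the mean value estimate with plain \<open>L^1\<close>
  norms already gives decay of order \<open>t^(\<alpha> - \<delta>) + t^(1 - \<delta>)\<close> at
  every point. The constant grows with \<open>l\<close>, so this settles each piece but not their
  sum.\<close>

lemma piece_rate:
  assumes delta: "0 \<le> \<delta>" "\<delta> < \<alpha>"
    and g [measurable]: "g \<in> borel_measurable borel" and gsq: "integrable lborel (\<lambda>\<xi>. (norm (g \<xi>))\<^sup>2)"
    and supp: "\<And>\<xi>. \<bar>\<xi>\<bar> > l \<Longrightarrow> g \<xi> = 0" and l: "l \<ge> 1"
  shows "((\<lambda>t. (chirp g (\<gamma> (x, t)) t - chirp g x 0) / complex_of_real (t powr \<delta>)) \<longlongrightarrow> 0) (at_right 0)"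
proof -
  define g1 where "g1 = (\<lambda>\<xi>. complex_of_real (\<xi> / l) * g \<xi>)"
  define g2 where "g2 = (\<lambda>\<xi>. complex_of_real ((\<xi> / l)\<^sup>2) * g \<xi>)"
  have m12: "g1 \<in> borel_measurable borel" "g2 \<in> borel_measurable borel" unfolding g1_def g2_def by measurable
  have sq1: "integrable lborel (\<lambda>\<xi>. (norm (g1 \<xi>))\<^sup>2)"
    using frequency_weight(1)[OF g l gsq supp, where j=1] unfolding g1_def power_one_right by blast
  have sq2: "integrable lborel (\<lambda>\<xi>. (norm (g2 \<xi>))\<^sup>2)"
    using frequency_weight(1)[OF g l gsq supp, where j=2] unfolding g2_def by blast
  have s12: "\<And>\<xi>. \<bar>\<xi>\<bar> > l \<Longrightarrow> g1 \<xi> = 0" "\<And>\<xi>. \<bar>\<xi>\<bar> > l \<Longrightarrow> g2 \<xi> = 0" by (auto simp: g1_def g2_def supp)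
  have gi: "integrable lborel g" "integrable lborel g1" "integrable lborel g2"
    by (rule integrable_of_square[OF g gsq supp], assumption)
      (rule integrable_of_square[OF m12(1) sq1 s12(1)], assumption,
       rule integrable_of_square[OF m12(2) sq2 s12(2)], assumption)
  define S1 where "S1 = (LINT \<xi>|lborel. norm (g1 \<xi>))"
  define S2 where "S2 = (LINT \<xi>|lborel. norm (g2 \<xi>))"
  have S0: "S1 \<ge> 0" "S2 \<ge> 0" by (auto simp: S1_def S2_def)
  have l0: "l > 0" using l by simp
  have bound: "norm ((chirp g (\<gamma> (x, t)) t - chirp g x 0) / complex_of_real (t powr \<delta>)) \<le>
      L * l * S1 * t powr (\<alpha> - \<delta>) + l\<^sup>2 * S2 * t powr (1 - \<delta>)" if t: "0 < t" "t < 1" for t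
  proof -
    have "norm (chirp g (\<gamma> (x, t)) t - chirp g x 0) \<le> \<bar>\<gamma> (x, t) - x\<bar> * l * S1 + \<bar>t\<bar> * l\<^sup>2 * S2"
      by (rule chirp_mean_value[OF g l0 gi(1) gi(2,3)[unfolded g1_def g2_def]])
        (simp_all only: S1_def S2_def g1_def g2_def norm_chirp_le)
    also have "\<dots> \<le> (L * t powr \<alpha>) * l * S1 + t * l\<^sup>2 * S2"
    proof (rule add_mono)
      show "\<bar>\<gamma> (x, t) - x\<bar> * l * S1 \<le> (L * t powr \<alpha>) * l * S1"
        by (intro mult_right_mono displacement) (use S0 t l in auto)
      show "\<bar>t\<bar> * l\<^sup>2 * S2 \<le> t * l\<^sup>2 * S2" using t by simp
    qed
    finally have "norm (chirp g (\<gamma> (x, t)) t - chirp g x 0) / t powr \<delta> \<le> ((L * t powr \<alpha>) * l * S1 + t * l\<^sup>2 * S2) / t powr \<delta>"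
      by (rule divide_right_mono) simp
    also have "\<dots> = L * l * S1 * t powr (\<alpha> - \<delta>) + l\<^sup>2 * S2 * t powr (1 - \<delta>)"
      using t by (simp add: powr_diff add_divide_distrib mult_ac)
    finally show ?thesis by (simp add: norm_divide)
  qed
  have pw: "((\<lambda>t. t powr e) \<longlongrightarrow> 0) (at_right 0)" if "e > 0" for e :: real
  proof -
    have "((\<lambda>t::real. t powr e) \<longlongrightarrow> 0 powr e) (at_right 0)"
      using that by (intro tendsto_powr') (auto simp: eventually_at_right_less eventually_at_filter)
    then show ?thesis by simp
  qed
  have "((\<lambda>t. L * l * S1 * t powr (\<alpha> - \<delta>) + l\<^sup>2 * S2 * t powr (1 - \<delta>)) \<longlongrightarrow> L * l * S1 * 0 + l\<^sup>2 * S2 * 0) (at_right 0)"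
    using delta alpha by (intro tendsto_add tendsto_mult tendsto_const pw) auto
  then have lim: "((\<lambda>t. L * l * S1 * t powr (\<alpha> - \<delta>) + l\<^sup>2 * S2 * t powr (1 - \<delta>)) \<longlongrightarrow> 0) (at_right 0)" by simp
  have "\<forall>\<^sub>F t in at_right 0. norm ((chirp g (\<gamma> (x, t)) t - chirp g x 0) / complex_of_real (t powr \<delta>)) \<le>
      L * l * S1 * t powr (\<alpha> - \<delta>) + l\<^sup>2 * S2 * t powr (1 - \<delta>)"
    using eventually_at_right_less[of 0] eventually_at_right[of "0::real" 1 "\<lambda>t. t < 1"]
    by (auto simp: eventually_at_right[OF zero_less_one] intro!: exI[of _ 1] bound)
  then show ?thesis by (rule Lim_null_comparison[OF _ lim])
qed

text \<open>Tannery's theorem: each piece has the rate, and \<open>d\<close> dominates all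
  difference quotients uniformly in \<open>t\<close>. The same \<open>d\<close> yields convergence
  of the truncations at time 0 and, by the triangle inequality, at every time up to 1.\<close>

lemma rate_from_summable_pieces:
  fixes f :: "(real \<Rightarrow> complex) \<Rightarrow> complex"
  defines "P \<equiv> \<lambda>n. dyadic_piece (fourier_function f) n"
  assumes delta: "0 \<le> \<delta>" "\<delta> < \<alpha>"
    and g [measurable]: "fourier_function f \<in> borel_measurable borel"
    and sq: "\<And>n. integrable lborel (\<lambda>\<xi>. (norm (P n \<xi>))\<^sup>2)"
    and d: "summable d"
    and d0: "\<And>n. norm (chirp (P n) x 0) \<le> d n"
    and dt: "\<And>n t. 0 < t \<Longrightarrow> t \<le> 1 \<Longrightarrow> norm (chirp (P n) (\<gamma> (x, t)) t - chirp (P n) x 0) / t powr \<delta> \<le> d n"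
  shows "converges_with_rate \<gamma> \<delta> f x"
proof -
  have supp: "P n \<xi> = 0" if "\<bar>\<xi>\<bar> > 2 ^ n" for n \<xi> using that by (simp add: P_def dyadic_piece_def)
  have P_meas: "P n \<in> borel_measurable borel" for n unfolding P_def by measurable
  have P_int: "integrable lborel (P n)" for n by (rule integrable_of_square[OF P_meas sq supp])
  have lims: "propagator_exists \<gamma> f x t \<and> propagator \<gamma> f x t = (\<Sum>n. chirp (P n) (\<gamma> (x, t)) t) / (2 * complex_of_real pi)"
    if "summable (\<lambda>n. chirp (P n) (\<gamma> (x, t)) t)" for t
  proof -
    have "(\<lambda>N. \<Sum>n\<le>N. chirp (P n) (\<gamma> (x, t)) t) \<longlonglongrightarrow> (\<Sum>n. chirp (P n) (\<gamma> (x, t)) t)"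
      using summable_LIMSEQ'[OF that] .
    then have "dyadic_truncation \<gamma> f x t \<longlonglongrightarrow> (\<Sum>n. chirp (P n) (\<gamma> (x, t)) t)"
      unfolding P_def dyadic_truncation_eq[of f \<gamma> x t, OF P_int[unfolded P_def], abs_def, symmetric] .
    then show ?thesis using propagator_from_truncations[OF g] by blast
  qed
  have sum0: "summable (\<lambda>n. chirp (P n) (\<gamma> (x, 0)) 0)"
    by (rule summable_comparison_test'[OF d]) (simp add: start d0)
  have sumt: "summable (\<lambda>n. chirp (P n) (\<gamma> (x, t)) t)" if t: "0 < t" "t \<le> 1" for t
  proof (rule summable_comparison_test')
    show "summable (\<lambda>n. d n * t powr \<delta> + d n)" by (intro summable_add summable_mult2 d)
    fix n
    have "norm (chirp (P n) (\<gamma> (x, t)) t - chirp (P n) x 0) \<le> d n * t powr \<delta>"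
      using dt[OF t, of n] t by (simp add: field_simps)
    then show "norm (chirp (P n) (\<gamma> (x, t)) t) \<le> d n * t powr \<delta> + d n"
      using d0[of n] norm_triangle_ineq2[of "chirp (P n) (\<gamma> (x, t)) t" "chirp (P n) x 0"] by linarith
  qed
  define a where "a = (\<lambda>n t. (chirp (P n) (\<gamma> (x, t)) t - chirp (P n) x 0) / complex_of_real (t powr \<delta>))"
  have small: "\<forall>\<^sub>F t in at_right 0. 0 < t \<and> t \<le> (1::real)"
    by (auto simp: eventually_at_right[OF zero_less_one] intro!: exI[of _ 1])
  have "((\<lambda>t. \<Sum>n. a n t) \<longlongrightarrow> (\<Sum>n. 0)) (at_right 0)"
  proof (rule tannerys_theorem[where M=d, THEN conjunct2, THEN conjunct2])
    show "(a n \<longlongrightarrow> 0) (at_right 0)" for n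
      unfolding a_def by (rule piece_rate[OF delta P_meas sq supp]) auto
    show "\<forall>\<^sub>F (n, t) in at_top \<times>\<^sub>F at_right 0. norm (a n t) \<le> d n"
      unfolding eventually_prod_filter
    proof (intro exI conjI allI impI)
      show "\<forall>\<^sub>F n in sequentially. True" by simp
      show "\<forall>\<^sub>F t in at_right 0. 0 < t \<and> t \<le> (1::real)" by (rule small)
      show "case (n, t) of (n, t) \<Rightarrow> norm (a n t) \<le> d n" if "0 < t \<and> t \<le> 1" for n t
        using dt[of t n] that by (simp add: a_def norm_divide)
    qed
  qed (use d in auto)
  then have "((\<lambda>t. (\<Sum>n. a n t) / (2 * complex_of_real pi)) \<longlongrightarrow> 0 / (2 * complex_of_real pi)) (at_right 0)"
    by (intro tendsto_divide) auto
  moreover have "\<forall>\<^sub>F t in at_right 0. (\<Sum>n. a n t) / (2 * complex_of_real pi) = (propagator \<gamma> f x t - propagator \<gamma> f x 0) / complex_of_real (t powr \<delta>)"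
    using small
  proof eventually_elim
    case (elim t)
    then have t: "0 < t" "t \<le> 1" by auto
    have "(\<Sum>n. a n t) = (\<Sum>n. chirp (P n) (\<gamma> (x, t)) t - chirp (P n) (\<gamma> (x, 0)) 0) / complex_of_real (t powr \<delta>)"
      unfolding a_def start by (rule suminf_divide) (use summable_diff[OF sumt[OF t] sum0] in \<open>simp add: start\<close>)
    also have "(\<Sum>n. chirp (P n) (\<gamma> (x, t)) t - chirp (P n) (\<gamma> (x, 0)) 0) = (\<Sum>n. chirp (P n) (\<gamma> (x, t)) t) - (\<Sum>n. chirp (P n) (\<gamma> (x, 0)) 0)"
      by (rule suminf_diff[symmetric, OF sumt[OF t] sum0])
    finally show ?case
      using lims[OF sumt[OF t]] lims[OF sum0] by (simp add: diff_divide_distrib mult.commute)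
  qed
  ultimately have "((\<lambda>t. (propagator \<gamma> f x t - propagator \<gamma> f x 0) / complex_of_real (t powr \<delta>)) \<longlongrightarrow> 0) (at_right 0)"
    by (simp add: tendsto_cong)
  moreover have "\<forall>\<^sub>F t in at_right 0. propagator_exists \<gamma> f x t"
    using small by eventually_elim (use lims sumt in blast)
  ultimately show ?thesis using lims[OF sum0] by (simp add: converges_with_rate_def)
qed

lemma converges_with_rate_on_ball:
  fixes f :: "(real \<Rightarrow> complex) \<Rightarrow> complex"
  assumes delta: "0 \<le> \<delta>" "\<delta> < \<alpha>" and s: "s > critical_exponent \<delta>" and R: "R > 0"
    and g [measurable]: "fourier_function f \<in> borel_measurable borel"
    and W: "integrable lborel (\<lambda>\<xi>. (norm (complex_of_real ((1 + \<xi>\<^sup>2) powr (s / 2)) * fourier_function f \<xi>))\<^sup>2)"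
  shows "AE x in lborel. \<bar>x\<bar> \<le> R \<longrightarrow> converges_with_rate \<gamma> \<delta> f x"
proof -
  define P where "P = (\<lambda>n. dyadic_piece (fourier_function f) n)"
  define \<epsilon> where "\<epsilon> = s - critical_exponent \<delta>"
  \<comment> \<open>The Sobolev weight leaves decay of order \<open>-2 * \<epsilon>\<close> in the
    squared estimate; the loss \<open>2 * \<eta>\<close> uses up at most half of it.\<close>
  define \<eta> where "\<eta> = min (1/4) (\<epsilon> / 2)"
  have eps: "\<epsilon> > 0" using s by (simp add: \<epsilon>_def)
  have eta: "0 < \<eta>" "\<eta> < 1/2" "\<eta> \<le> \<epsilon> / 2" using eps by (auto simp: \<eta>_def)
  have s0: "s \<ge> 0" using critical_exponent_ge(2)[OF delta(1)] s delta by simp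
  define W0 where "W0 = (LINT \<xi>|lborel. (norm (complex_of_real ((1 + \<xi>\<^sup>2) powr (s / 2)) * fourier_function f \<xi>))\<^sup>2)"
  have W0: "W0 \<ge> 0" by (simp add: W0_def)
  have P_meas: "P n \<in> borel_measurable borel" for n unfolding P_def by measurable
  have sq: "integrable lborel (\<lambda>\<xi>. (norm (P n \<xi>))\<^sup>2)" for n unfolding P_def by (rule dyadic_piece_square(1)[OF g s0 W])
  have sqle: "(LINT \<xi>|lborel. (norm (P n \<xi>))\<^sup>2) \<le> 4 powr s * (2 ^ n) powr (- 2 * s) * W0" for n
    unfolding P_def W0_def by (rule dyadic_piece_square(2)[OF g s0 W])
  have supp: "P n \<xi> = 0" if "\<bar>\<xi>\<bar> > 2 ^ n" for n \<xi> using that by (simp add: P_def dyadic_piece_def)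
  obtain C where C: "C > 0" and est:
   "\<And>n g. g \<in> borel_measurable borel \<Longrightarrow>
     integrable lborel (\<lambda>\<xi>. (norm (g \<xi>))\<^sup>2) \<Longrightarrow> (\<And>\<xi>. \<bar>\<xi>\<bar> > 2 ^ n \<Longrightarrow> g \<xi> = 0) \<Longrightarrow>
     \<exists>M \<in> borel_measurable borel.
      (\<forall>x t. \<bar>x\<bar> \<le> R \<longrightarrow> 0 < t \<longrightarrow> t \<le> 1 \<longrightarrow>
         ennreal ((norm (chirp g (\<gamma> (x, t)) t - chirp g x 0) / t powr \<delta>)\<^sup>2) \<le> M x) \<and>
      (\<forall>x. \<bar>x\<bar> \<le> R \<longrightarrow> ennreal ((norm (chirp g x 0))\<^sup>2) \<le> M x) \<and>
      (\<integral>\<^sup>+x. M x \<partial>lborel) \<le>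
        ennreal (C * (2 ^ n) powr (2 * critical_exponent \<delta> + 2 * \<eta>) * (LINT \<xi>|lborel. (norm (g \<xi>))\<^sup>2))"
    using piece_estimate[OF delta eta(1,2) R] by blast
  define Q where "Q = (\<lambda>n M. M \<in> borel_measurable borel \<and>
      (\<forall>x t. \<bar>x\<bar> \<le> R \<longrightarrow> 0 < t \<longrightarrow> t \<le> 1 \<longrightarrow>
         ennreal ((norm (chirp (P n) (\<gamma> (x, t)) t - chirp (P n) x 0) / t powr \<delta>)\<^sup>2) \<le> M x) \<and>
      (\<forall>x. \<bar>x\<bar> \<le> R \<longrightarrow> ennreal ((norm (chirp (P n) x 0))\<^sup>2) \<le> M x) \<and>
      (\<integral>\<^sup>+x. M x \<partial>lborel) \<le>
        ennreal (C * (2 ^ n) powr (2 * critical_exponent \<delta> + 2 * \<eta>) * (LINT \<xi>|lborel. (norm (P n \<xi>))\<^sup>2)))"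
  have "\<exists>M. Q n M" for n
    using est[OF P_meas sq supp, of n] unfolding Q_def by (simp only: Bex_def)
  then obtain M where M: "\<And>n. Q n (M n)" using choice[of Q] by blast
  have M_meas [measurable]: "M n \<in> borel_measurable borel" for n using M[of n] by (simp add: Q_def)
  have Mt: "ennreal ((norm (chirp (P n) (\<gamma> (x, t)) t - chirp (P n) x 0) / t powr \<delta>)\<^sup>2) \<le> M n x" if "\<bar>x\<bar> \<le> R" "0 < t" "t \<le> 1" for n x t
    using M[of n] that by (simp add: Q_def)
  have M0: "ennreal ((norm (chirp (P n) x 0))\<^sup>2) \<le> M n x" if "\<bar>x\<bar> \<le> R" for n x
    using M[of n] that by (simp add: Q_def)
  \<comment> \<open>The integral of \<open>M n\<close> decays like \<open>q ^ (2 * n)\<close>. One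
    factor \<open>q ^ n\<close> is spent on the growing weight \<open>r ^ n\<close> below, and the
    other keeps the weighted series summable.\<close>
  define q where "q = (2::real) powr (- \<epsilon> / 2)"
  have q: "0 < q" "q < 1" using eps powr_less_mono[of "- \<epsilon> / 2" 0 2] by (auto simp: q_def)
  define B where "B = C * 4 powr s * W0"
  have B: "B \<ge> 0" using C W0 by (simp add: B_def)
  have IM: "(\<integral>\<^sup>+x. M n x \<partial>lborel) \<le> ennreal (B * (q ^ n * q ^ n))" for n
  proof -
    let ?l = "(2::real) ^ n" and ?E = "2 * critical_exponent \<delta> + 2 * \<eta>"
    have "(\<integral>\<^sup>+x. M n x \<partial>lborel) \<le> ennreal (C * ?l powr ?E * (LINT \<xi>|lborel. (norm (P n \<xi>))\<^sup>2))"
      using M[of n] by (simp only: Q_def)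
    also have "\<dots> \<le> ennreal (B * (q ^ n * q ^ n))"
    proof (rule ennreal_leI)
      have "C * ?l powr ?E * (LINT \<xi>|lborel. (norm (P n \<xi>))\<^sup>2) \<le> C * ?l powr ?E * (4 powr s * ?l powr (- 2 * s) * W0)"
        using C by (intro mult_left_mono sqle) auto
      also have "\<dots> = B * (?l powr ?E * ?l powr (- 2 * s))" by (simp add: B_def mult_ac)
      also have "?l powr ?E * ?l powr (- 2 * s) = ?l powr (?E + (- 2 * s))" by (simp only: powr_add)
      also have "B * ?l powr (?E + (- 2 * s)) \<le> B * ?l powr (- \<epsilon>)"
        using B eta(3) by (intro mult_left_mono powr_mono) (auto simp: \<epsilon>_def)
      also have "?l powr (- \<epsilon>) = q ^ n * q ^ n"
      proof -
        have "q ^ n = ?l powr (- \<epsilon> / 2)"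
        proof -
          have "?l powr (- \<epsilon> / 2) = ((2::real) powr real n) powr (- \<epsilon> / 2)" by (simp add: powr_realpow)
          also have "\<dots> = (2 powr (- \<epsilon> / 2)) powr real n" by (simp only: powr_powr mult.commute)
          finally show ?thesis using q by (simp add: q_def powr_realpow)
        qed
        then show ?thesis by (simp add: powr_add[symmetric])
      qed
      finally show "C * ?l powr ?E * (LINT \<xi>|lborel. (norm (P n \<xi>))\<^sup>2) \<le> B * (q ^ n * q ^ n)" .
    qed
    finally show ?thesis .
  qed
  define r where "r = inverse q"
  have r: "r > 0" "r * q = 1" using q by (auto simp: r_def)
  have "(\<integral>\<^sup>+x. (\<Sum>n. ennreal (r ^ n) * M n x) \<partial>lborel) = (\<Sum>n. ennreal (r ^ n) * (\<integral>\<^sup>+x. M n x \<partial>lborel))"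
    by (subst nn_integral_suminf) (auto simp: nn_integral_cmult)
  also have "\<dots> \<le> (\<Sum>n. ennreal (B * q ^ n))"
  proof (rule suminf_le)
    fix n
    have "ennreal (r ^ n) * (\<integral>\<^sup>+x. M n x \<partial>lborel) \<le> ennreal (r ^ n) * ennreal (B * (q ^ n * q ^ n))"
      by (rule mult_left_mono[OF IM]) simp
    also have "\<dots> = ennreal (r ^ n * (B * (q ^ n * q ^ n)))" using r by (simp add: ennreal_mult'[symmetric])
    also have "r ^ n * (B * (q ^ n * q ^ n)) = B * q ^ n * (r * q) ^ n" by (simp add: power_mult_distrib)
    finally show "ennreal (r ^ n) * (\<integral>\<^sup>+x. M n x \<partial>lborel) \<le> ennreal (B * q ^ n)" using r by simp
  qed auto
  also have "\<dots> = ennreal (\<Sum>n. B * q ^ n)"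
    using B q by (intro suminf_ennreal2) (auto intro!: summable_mult summable_geometric)
  finally have fin: "(\<integral>\<^sup>+x. (\<Sum>n. ennreal (r ^ n) * M n x) \<partial>lborel) \<noteq> \<infinity>"
    by (metis ennreal_neq_top infinity_ennreal_def neq_top_trans)
  have "AE x in lborel. (\<Sum>n. ennreal (r ^ n) * M n x) \<noteq> \<infinity>"
    by (rule nn_integral_noteq_infinite[OF _ fin]) measurable
  then show ?thesis
  proof (eventually_elim, intro impI)
    fix x assume fx: "(\<Sum>n. ennreal (r ^ n) * M n x) \<noteq> \<infinity>" and x: "\<bar>x\<bar> \<le> R"
    define m where "m = (\<lambda>n. enn2real (M n x))"
    have Mm: "M n x = ennreal (m n)" for n
    proof -
      have "ennreal (r ^ n) * M n x \<noteq> \<top>"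
        using fx ennreal_suminf_lessD[of "\<lambda>n. ennreal (r ^ n) * M n x" \<top> n] by (simp add: less_top)
      moreover have "r ^ n > 0" using r by simp
      ultimately have "M n x \<noteq> \<top>" by (auto simp: ennreal_mult_top ennreal_eq_0_iff not_le)
      then show ?thesis by (simp add: m_def less_top)
    qed
    have m0: "m n \<ge> 0" for n by (simp add: m_def)
    have "(\<Sum>n. ennreal (r ^ n * m n)) \<noteq> \<top>" using fx r m0 by (simp add: Mm ennreal_mult)
    then have sm: "summable (\<lambda>n. r ^ n * m n)" using r m0 by (intro summable_suminf_not_top) auto
    define d where "d = (\<lambda>n. q ^ n + r ^ n * m n)"
    have d: "summable d" unfolding d_def using q by (intro summable_add sm summable_geometric) auto
    \<comment> \<open>Passes from bounds on squares to summable bounds: either \<open>v\<close> is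
      at most \<open>q ^ n\<close>, or \<open>v\<close> is at most \<open>v^2 / q ^ n\<close>, and
      both right-hand sides are dominated by terms of convergent series.\<close>
    have vd: "v \<le> d n" if v: "0 \<le> v" "ennreal (v\<^sup>2) \<le> M n x" for v n
    proof (cases "v \<le> q ^ n")
      case True then show ?thesis using r m0[of n] by (simp add: d_def add_increasing2)
    next
      case False
      have "v\<^sup>2 \<le> m n" using v m0[of n] by (simp add: Mm ennreal_le_iff)
      then have "r ^ n * v\<^sup>2 \<le> r ^ n * m n" using r by simp
      moreover have "v \<le> r ^ n * v\<^sup>2"
      proof -
        have "r ^ n * q ^ n = 1" using r by (simp add: power_mult_distrib[symmetric])
        moreover have "r ^ n * q ^ n \<le> r ^ n * v" using False r by (intro mult_left_mono) auto
        ultimately have "1 * v \<le> r ^ n * v * v" using v by (intro mult_right_mono) auto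
        then show ?thesis by (simp add: power2_eq_square mult_ac)
      qed
      moreover have "q ^ n \<ge> 0" using q by simp
      ultimately show ?thesis unfolding d_def by linarith
    qed
    show "converges_with_rate \<gamma> \<delta> f x"
    proof (rule rate_from_summable_pieces[OF delta g sq[unfolded P_def] d])
      show "norm (chirp (dyadic_piece (fourier_function f) n) x 0) \<le> d n" for n
        using vd[OF norm_ge_zero M0[OF x]] by (simp add: P_def)
      show "norm (chirp (dyadic_piece (fourier_function f) n) (\<gamma> (x, t)) t - chirp (dyadic_piece (fourier_function f) n) x 0) / t powr \<delta> \<le> d n"
        if "0 < t" "t \<le> 1" for n t
        using vd[OF _ Mt[OF x that]] by (simp add: P_def)
    qed
  qed
qed

end

theorem convergence_above_critical_exponent:
  assumes alpha: "1 / 2 \<le> \<alpha>" "\<alpha> < 1" and delta: "0 \<le> \<delta>" "\<delta> < \<alpha>"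
    and path: "admissible_path \<alpha> \<gamma>" and s: "s > critical_exponent \<delta>" and f: "f \<in> sobolev s"
  shows "AE x in lborel. converges_with_rate \<gamma> \<delta> f x"
proof -
  obtain C1 C2 where C: "C1 > 0" "\<forall>t\<in>{-1..1}. \<forall>x x'. 1 / C1 * \<bar>x - x'\<bar> \<le> \<bar>\<gamma> (x, t) - \<gamma> (x', t)\<bar> \<and>
     \<bar>\<gamma> (x, t) - \<gamma> (x', t)\<bar> \<le> C2 * \<bar>x - x'\<bar>"
    using path unfolding admissible_path_def bilipschitz_in_x_def by blast
  obtain C3 where C3: "C3 > 0" "\<forall>x. \<forall>t\<in>{-1..1}. \<forall>t'\<in>{-1..1}. \<bar>\<gamma> (x, t) - \<gamma> (x, t')\<bar> \<le> C3 * \<bar>t - t'\<bar> powr \<alpha>"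
    using path unfolding admissible_path_def hoelder_in_t_def by blast
  interpret hoelder_path \<gamma> \<alpha> "1 / C1" C3
    by unfold_locales (use alpha C C3 path in \<open>auto simp: admissible_path_def\<close>)
  have "\<exists>g. has_fourier_function f g" using f by (auto simp: sobolev_def)
  then have "has_fourier_function f (fourier_function f)" unfolding fourier_function_def by (rule someI_ex)
  then have g: "fourier_function f \<in> borel_measurable borel" by (simp add: has_fourier_function_def)
  have W: "integrable lborel (\<lambda>\<xi>. (norm (complex_of_real ((1 + \<xi>\<^sup>2) powr (s / 2)) * fourier_function f \<xi>))\<^sup>2)"
    using f by (simp add: sobolev_def)
  \<comment> \<open>Countably many radii, taken as \<open>Suc n\<close> so that each of them is
    positive.\<close>
  have "AE x in lborel. \<forall>n. \<bar>x\<bar> \<le> real (Suc n) \<longrightarrow> converges_with_rate \<gamma> \<delta> f x"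
    unfolding AE_all_countable by (intro allI converges_with_rate_on_ball[OF delta s _ g W]) simp
  then show ?thesis
  proof eventually_elim
    case (elim x)
    obtain n where "\<bar>x\<bar> \<le> real n" using real_arch_simple by blast
    then show ?case using elim by (meson le_add2 of_nat_Suc of_nat_0_le_iff order_trans le_SucI of_nat_le_iff order_refl lessI less_imp_le)
  qed
qed

section \<open>Integrable functions as tempered distributions\<close>

text \<open>All modulations of one Gaussian. Integrating \<open>g\<close> against them gives the
  Fourier transform of \<open>g\<close> times that Gaussian at every frequency, so these Schwartz
  functions alone identify \<open>g\<close> almost everywhere.\<close>

definition test_gaussian :: "real \<Rightarrow> real \<Rightarrow> complex" where
  "test_gaussian y x = exp (- (complex_of_real x)\<^sup>2 + \<i> * complex_of_real y * complex_of_real x)"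

lemma norm_test_gaussian: "norm (test_gaussian y x) = exp (- x\<^sup>2)"
  by (simp add: test_gaussian_def Re_power2)

lemma test_gaussian_eq: "test_gaussian y x = exp (- x\<^sup>2) * iexp (y * x)"
  unfolding test_gaussian_def exp_add by (simp add: exp_of_real[symmetric] mult_ac)

lemma poly_test_gaussian_derivative:
  "((\<lambda>x. poly p (complex_of_real x) * test_gaussian y x) has_vector_derivative
     poly (pderiv p + [:\<i> * complex_of_real y, -2:] * p) (complex_of_real x) * test_gaussian y x) (at x)"
proof -
  have "((\<lambda>z. poly p z * exp (- z\<^sup>2 + \<i> * complex_of_real y * z)) has_field_derivative
    poly (pderiv p + [:\<i> * complex_of_real y, -2:] * p) (complex_of_real x) * exp (- (complex_of_real x)\<^sup>2 + \<i> * complex_of_real y * complex_of_real x)) (at (complex_of_real x))"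
    by (auto intro!: derivative_eq_intros simp: algebra_simps)
  from has_vector_derivative_real_field[OF this, of UNIV] show ?thesis by (simp add: test_gaussian_def)
qed

text \<open>Polynomials times the Gaussian are closed under differentiation; membership in the
  Schwartz class requires knowing the derivatives only up to an unspecified polynomial.\<close>

lemma nth_vderiv_test_gaussian:
  "\<exists>p. nth_vderiv k (test_gaussian y) = (\<lambda>x. poly p (complex_of_real x) * test_gaussian y x)"
proof (induction k)
  case 0 show ?case by (intro exI[of _ 1]) (simp add: nth_vderiv_def)
next
  case (Suc k)
  then obtain p where p: "nth_vderiv k (test_gaussian y) = (\<lambda>x. poly p (complex_of_real x) * test_gaussian y x)" by blast
  have "nth_vderiv (Suc k) (test_gaussian y) = (\<lambda>x. vector_derivative (nth_vderiv k (test_gaussian y)) (at x))"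
    by (simp add: nth_vderiv_def)
  also have "\<dots> = (\<lambda>x. poly (pderiv p + [:\<i> * complex_of_real y, -2:] * p) (complex_of_real x) * test_gaussian y x)"
    unfolding p by (intro ext vector_derivative_at poly_test_gaussian_derivative)
  finally show ?case by blast
qed

text \<open>Combines \<open>(1 + |x| / i)^i <= exp |x|\<close> with \<open>|x| - x^2 <= 1\<close>.
  For \<open>i = 0\<close> the factor \<open>real i ^ i\<close> is 1.\<close>

lemma power_times_gaussian_bounded: "\<bar>x\<bar> ^ i * exp (- x\<^sup>2) \<le> real i ^ i * exp 1" for x :: real
proof -
  have "\<bar>x\<bar> ^ i \<le> real i ^ i * exp \<bar>x\<bar>"
  proof (cases "i = 0")
    case False
    have "\<bar>x\<bar> ^ i \<le> (real i * (1 + \<bar>x\<bar> / real i)) ^ i" using False by (intro power_mono) (auto simp: field_simps)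
    also have "\<dots> = real i ^ i * (1 + \<bar>x\<bar> / real i) ^ i" by (rule power_mult_distrib)
    also have "\<dots> \<le> real i ^ i * exp \<bar>x\<bar>"
      using False by (intro mult_left_mono exp_ge_one_plus_x_over_n_power_n) auto
    finally show ?thesis .
  qed simp
  then have "\<bar>x\<bar> ^ i * exp (- x\<^sup>2) \<le> real i ^ i * exp \<bar>x\<bar> * exp (- x\<^sup>2)" by (rule mult_right_mono) simp
  also have "\<dots> = real i ^ i * exp (\<bar>x\<bar> - x\<^sup>2)" by (simp add: exp_diff exp_minus field_simps)
  also have "\<dots> \<le> real i ^ i * exp 1"
  proof -
    have "0 \<le> (\<bar>x\<bar> - 1)\<^sup>2" "0 \<le> \<bar>x\<bar>" by auto
    then have "\<bar>x\<bar> - x\<^sup>2 \<le> 1" by (simp add: power2_eq_square algebra_simps)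
    then show ?thesis by (intro mult_left_mono) auto
  qed
  finally show ?thesis .
qed

lemma test_gaussian_schwartz: "test_gaussian y \<in> schwartz"
  unfolding schwartz_def
proof (intro CollectI conjI allI)
  fix k x
  obtain p where p: "nth_vderiv k (test_gaussian y) = (\<lambda>x. poly p (complex_of_real x) * test_gaussian y x)"
    using nth_vderiv_test_gaussian by blast
  show "nth_vderiv k (test_gaussian y) differentiable at x"
    unfolding p using poly_test_gaussian_derivative differentiableI_vector by blast
  fix j
  show "bounded (range (\<lambda>x. x ^ j *\<^sub>R nth_vderiv k (test_gaussian y) x))"
  proof (rule boundedI, safe)
    fix x :: real
    have "norm (x ^ j *\<^sub>R nth_vderiv k (test_gaussian y) x) = \<bar>x\<bar> ^ j * (norm (\<Sum>i\<le>degree p. coeff p i * complex_of_real x ^ i) * exp (- x\<^sup>2))"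
      unfolding p poly_altdef by (simp add: norm_mult norm_test_gaussian power_abs)
    also have "\<dots> \<le> \<bar>x\<bar> ^ j * ((\<Sum>i\<le>degree p. norm (coeff p i) * \<bar>x\<bar> ^ i) * exp (- x\<^sup>2))"
      by (intro mult_left_mono mult_right_mono sum_norm_le) (auto simp: norm_mult norm_power)
    also have "\<dots> = (\<Sum>i\<le>degree p. norm (coeff p i) * (\<bar>x\<bar> ^ (j + i) * exp (- x\<^sup>2)))"
      by (simp add: sum_distrib_left sum_distrib_right power_add mult_ac)
    also have "\<dots> \<le> (\<Sum>i\<le>degree p. norm (coeff p i) * (real (j + i) ^ (j + i) * exp 1))"
      by (intro sum_mono mult_left_mono power_times_gaussian_bounded) auto
    finally show "norm (x ^ j *\<^sub>R nth_vderiv k (test_gaussian y) x) \<le> \<dots>" .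
  qed
qed

section \<open>Elementary properties of Schwartz functions\<close>

lemma schwartz_measurable:
  assumes "\<phi> \<in> schwartz" shows "\<phi> \<in> borel_measurable borel"
proof -
  have "\<phi> differentiable at x" for x
    using assms unfolding schwartz_def by (auto dest: spec[of _ 0] simp: nth_vderiv_def)
  then have "continuous_on UNIV \<phi>"
    by (simp add: continuous_at_imp_continuous_on differentiable_imp_continuous_within)
  then show ?thesis by (rule borel_measurable_continuous_onI)
qed

lemma schwartz_bound:
  assumes "\<phi> \<in> schwartz" shows "norm (\<phi> x) \<le> schwartz_seminorm 0 0 \<phi>"
proof -
  have "bounded (range (\<lambda>x. x ^ 0 *\<^sub>R nth_vderiv 0 \<phi> x))" using assms unfolding schwartz_def by blast
  then have "bdd_above (range (\<lambda>x. norm (x ^ 0 *\<^sub>R nth_vderiv 0 \<phi> x)))"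
    by (auto simp: bounded_iff bdd_above_def)
  then have "norm (x ^ 0 *\<^sub>R nth_vderiv 0 \<phi> x) \<le> schwartz_seminorm 0 0 \<phi>"
    unfolding schwartz_seminorm_def by (intro cSUP_upper) auto
  then show ?thesis by (simp add: nth_vderiv_def)
qed

lemma integrable_inverse_square: "integrable lborel (\<lambda>x::real. inverse (1 + x\<^sup>2))"
  using integrable_inverse_1_plus_square by (simp add: set_integrable_def)

lemma schwartz_integrable:
  assumes phi: "\<phi> \<in> schwartz" shows "integrable lborel \<phi>"
proof -
  have "bounded (range (\<lambda>x. x ^ j *\<^sub>R nth_vderiv 0 \<phi> x))" for j using phi unfolding schwartz_def by blast
  then have b: "bounded (range (\<lambda>x. x ^ j *\<^sub>R \<phi> x))" for j by (simp add: nth_vderiv_def)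
  obtain B0 where B0: "\<And>x. norm (\<phi> x) \<le> B0" using b[of 0] by (auto simp: bounded_iff)
  obtain B2 where B2: "\<And>x. norm (x\<^sup>2 *\<^sub>R \<phi> x) \<le> B2" using b[of 2] unfolding bounded_iff by blast
  have "norm (\<phi> x) \<le> (B0 + B2) * inverse (1 + x\<^sup>2)" for x
  proof -
    have p: "1 + x\<^sup>2 > 0" by (simp add: add_pos_nonneg)
    have "(1 + x\<^sup>2) * norm (\<phi> x) \<le> B0 + B2" using B0[of x] B2[of x] by (simp add: algebra_simps)
    then show ?thesis using p by (simp add: field_simps)
  qed
  then show ?thesis
    by (intro Bochner_Integration.integrable_bound[OF integrable_mult_right[OF integrable_inverse_square, of "B0 + B2"]])
      (use schwartz_measurable[OF phi] in \<open>auto intro!: AE_I2 order_trans[OF _ abs_ge_self]\<close>)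
qed

lemma integral_mult_bounded:
  fixes u v :: "real \<Rightarrow> complex"
  assumes u: "integrable lborel u" and [measurable]: "v \<in> borel_measurable borel" and v: "\<And>x. norm (v x) \<le> C"
  shows "integrable lborel (\<lambda>x. u x * v x)"
proof (rule Bochner_Integration.integrable_bound[OF integrable_mult_right[OF u, of "complex_of_real C"]])
  have [measurable]: "u \<in> borel_measurable borel" using u by auto
  show "(\<lambda>x. u x * v x) \<in> borel_measurable lborel" by measurable
  show "AE x in lborel. norm (u x * v x) \<le> norm (complex_of_real C * u x)"
  proof (rule AE_I2)
    fix x
    have "norm (u x) * norm (v x) \<le> norm (u x) * \<bar>C\<bar>" using v[of x] by (intro mult_left_mono) auto
    then show "norm (u x * v x) \<le> norm (complex_of_real C * u x)" by (simp add: norm_mult mult.commute)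
  qed
qed

section \<open>Distributions given by integrable functions\<close>

definition distribution_of :: "(real \<Rightarrow> complex) \<Rightarrow> (real \<Rightarrow> complex) \<Rightarrow> complex" where
  "distribution_of F \<phi> = (LINT x|lborel. F x * \<phi> x)"

lemma tempered_distribution_of:
  assumes F: "integrable lborel F"
  shows "tempered_distribution (distribution_of F)"
  unfolding tempered_distribution_def
proof (intro conjI ballI allI exI)
  have i: "integrable lborel (\<lambda>x. F x * \<phi> x)" if "\<phi> \<in> schwartz" for \<phi>
    by (rule integral_mult_bounded[OF F schwartz_measurable[OF that] schwartz_bound[OF that]])
  fix \<phi> assume phi: "\<phi> \<in> schwartz"
  show "distribution_of F (\<lambda>x. \<phi> x + \<psi> x) = distribution_of F \<phi> + distribution_of F \<psi>" if "\<psi> \<in> schwartz" for \<psi>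
    unfolding distribution_of_def distrib_left by (rule Bochner_Integration.integral_add[OF i[OF phi] i[OF that]])
  show "distribution_of F (\<lambda>x. c * \<phi> x) = c * distribution_of F \<phi>" for c
    unfolding distribution_of_def by (subst integral_mult_right_zero[symmetric]) (simp add: mult_ac)
  show "norm (distribution_of F \<phi>) \<le> (LINT x|lborel. norm (F x)) * (\<Sum>j\<le>0. \<Sum>k\<le>0. schwartz_seminorm j k \<phi>)"
  proof -
    have "norm (distribution_of F \<phi>) \<le> (LINT x|lborel. norm (F x * \<phi> x))"
      unfolding distribution_of_def by (rule integral_norm_bound)
    also have "\<dots> \<le> (LINT x|lborel. norm (F x) * schwartz_seminorm 0 0 \<phi>)"
      using F integrable_norm[OF i[OF phi]] by (intro integral_mono) (auto simp: norm_mult intro!: mult_left_mono schwartz_bound[OF phi])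
    finally show ?thesis by simp
  qed
qed

lemma norm_fourier_le: "norm (fourier F \<xi>) \<le> (LINT x|lborel. norm (F x))"
  unfolding fourier_def by (rule order_trans[OF integral_norm_bound]) (simp add: norm_mult)

lemma measurable_fourier [measurable]:
  assumes [measurable]: "F \<in> borel_measurable borel"
  shows "fourier F \<in> borel_measurable borel"
  unfolding fourier_def[abs_def] by measurable

text \<open>This is the multiplication formula for the Fourier transform, an instance of Fubini's
  theorem.\<close>

lemma has_fourier_function_distribution_of:
  assumes F: "integrable lborel F"
  shows "has_fourier_function (distribution_of F) (fourier F)"
  unfolding has_fourier_function_def
proof (intro conjI ballI)
  have [measurable]: "F \<in> borel_measurable borel" using F by auto
  show "fourier F \<in> borel_measurable lborel" by simp
  fix \<phi> assume phi: "\<phi> \<in> schwartz"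
  have [measurable]: "\<phi> \<in> borel_measurable borel" by (rule schwartz_measurable[OF phi])
  have phii: "integrable lborel \<phi>" by (rule schwartz_integrable[OF phi])
  have "integrable lborel (\<lambda>\<xi>. \<phi> \<xi> * fourier F \<xi>)"
    by (rule integral_mult_bounded[OF phii _ norm_fourier_le]) measurable
  then show "integrable lborel (\<lambda>\<xi>. fourier F \<xi> * \<phi> \<xi>)" by (simp add: mult.commute)
  have m: "(\<lambda>(x, \<xi>). exp (- \<i> * complex_of_real (\<xi> * x))) \<in> borel_measurable (borel \<Otimes>\<^sub>M borel)"
    by measurable
  have "distribution_of F (fourier \<phi>) = (LINT x|lborel. F x * (LINT \<xi>|lborel. \<phi> \<xi> * exp (- \<i> * complex_of_real (\<xi> * x))))"
    unfolding distribution_of_def fourier_def by (simp only: mult.commute)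
  also have "\<dots> = (LINT \<xi>|lborel. \<phi> \<xi> * (LINT x|lborel. F x * exp (- \<i> * complex_of_real (\<xi> * x))))"
    using integral_swap_bounded_kernel[OF F phii m, of 1] by simp
  also have "\<dots> = (LINT \<xi>|lborel. fourier F \<xi> * \<phi> \<xi>)"
    unfolding fourier_def by (simp only: mult.commute)
  finally show "distribution_of F (fourier \<phi>) = (LINT \<xi>|lborel. fourier F \<xi> * \<phi> \<xi>)" .
qed

section \<open>Uniqueness of the Fourier transform\<close>

text \<open>The positive and the negative part of \<open>k\<close>, normalised, are probability densities with the same
  characteristic function.\<close>

lemma fourier_injective_real:
  fixes k :: "real \<Rightarrow> real"
  assumes k: "integrable lborel k" and zero: "\<And>y. (LINT x|lborel. complex_of_real (k x) * iexp (y * x)) = 0"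
  shows "AE x in lborel. k x = 0"
proof -
  have [measurable]: "k \<in> borel_measurable borel" using k by auto
  define u where "u = (\<lambda>x. max (k x) 0)"
  define v where "v = (\<lambda>x. max (- k x) 0)"
  have [measurable]: "u \<in> borel_measurable borel" "v \<in> borel_measurable borel" unfolding u_def v_def by measurable
  have uv0: "u x \<ge> 0" "v x \<ge> 0" for x by (auto simp: u_def v_def)
  have kuv: "k x = u x - v x" for x by (auto simp: u_def v_def)
  have ui: "integrable lborel u" unfolding u_def by (rule Bochner_Integration.integrable_bound[OF k]) auto
  have vi: "integrable lborel v" unfolding v_def by (rule Bochner_Integration.integrable_bound[OF k]) auto
  have iu: "integrable lborel (\<lambda>x. complex_of_real (u x) * iexp (y * x))" for y
    by (rule integral_mult_bounded[where C=1]) (use ui in auto)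
  have iv: "integrable lborel (\<lambda>x. complex_of_real (v x) * iexp (y * x))" for y
    by (rule integral_mult_bounded[where C=1]) (use vi in auto)
  have eq: "(LINT x|lborel. complex_of_real (u x) * iexp (y * x)) = (LINT x|lborel. complex_of_real (v x) * iexp (y * x))" for y
    using zero[of y] iu[of y] iv[of y] unfolding kuv by (simp add: left_diff_distrib)
  define c where "c = (LINT x|lborel. u x)"
  have cv: "c = (LINT x|lborel. v x)" using eq[of 0] ui vi by (simp add: c_def)
  have c0: "c \<ge> 0" by (simp add: c_def uv0)
  show ?thesis
  proof (cases "c = 0")
    case True
    have "AE x in lborel. u x = 0"
      using True integral_nonneg_eq_0_iff_AE[OF ui] uv0 by (simp add: c_def)
    moreover have "AE x in lborel. v x = 0"
      using True cv integral_nonneg_eq_0_iff_AE[OF vi] uv0 by simp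
    ultimately show ?thesis by eventually_elim (simp add: kuv)
  next
    case False
    then have c: "c > 0" using c0 by simp
    have rd: "real_distribution (density lborel (\<lambda>x. ennreal (w x / c)))"
      if [measurable]: "w \<in> borel_measurable borel" and w: "integrable lborel w" "\<And>x. w x \<ge> 0" "(LINT x|lborel. w x) = c" for w
    proof -
      have "(\<integral>\<^sup>+x. ennreal (w x / c) \<partial>lborel) = ennreal (LINT x|lborel. w x / c)"
        using w c by (intro nn_integral_eq_integral) auto
      also have "(LINT x|lborel. w x / c) = 1" using w c by simp
      finally have "emeasure (density lborel (\<lambda>x. ennreal (w x / c))) UNIV = 1"
        by (simp add: emeasure_density)
      then show ?thesis by (intro real_distribution.intro prob_spaceI real_distribution_axioms.intro) auto
    qed
    have ch: "char (density lborel (\<lambda>x. ennreal (w x / c))) y = (LINT x|lborel. complex_of_real (w x) * iexp (y * x)) / c"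
      if [measurable]: "w \<in> borel_measurable borel" and w: "\<And>x. w x \<ge> 0" for w y
    proof -
      have "char (density lborel (\<lambda>x. ennreal (w x / c))) y = (LINT x|lborel. (w x / c) *\<^sub>R iexp (y * x))"
        unfolding char_def using w c by (subst integral_density) auto
      also have "\<dots> = (LINT x|lborel. (complex_of_real (w x) * iexp (y * x)) / c)"
        by (simp add: scaleR_conv_of_real)
      finally show ?thesis by simp
    qed
    have "density lborel (\<lambda>x. ennreal (u x / c)) = density lborel (\<lambda>x. ennreal (v x / c))"
    proof (rule Levy_uniqueness)
      show "real_distribution (density lborel (\<lambda>x. ennreal (u x / c)))" by (rule rd) (use ui uv0 in \<open>auto simp: c_def\<close>)
      show "real_distribution (density lborel (\<lambda>x. ennreal (v x / c)))" by (rule rd) (use vi uv0 cv in auto)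
      have cu: "char (density lborel (\<lambda>x. ennreal (u x / c))) y = (LINT x|lborel. complex_of_real (u x) * iexp (y * x)) / c" for y
        by (rule ch) (use uv0 in auto)
      have cw: "char (density lborel (\<lambda>x. ennreal (v x / c))) y = (LINT x|lborel. complex_of_real (v x) * iexp (y * x)) / c" for y
        by (rule ch) (use uv0 in auto)
      show "char (density lborel (\<lambda>x. ennreal (u x / c))) = char (density lborel (\<lambda>x. ennreal (v x / c)))"
        by (rule ext) (simp only: cu cw eq)
    qed
    then have "AE x in lborel. ennreal (u x / c) = ennreal (v x / c)"
      by (subst (asm) sigma_finite_measure.density_unique_iff[OF sigma_finite_lborel]) auto
    then show ?thesis by eventually_elim (use c uv0 in \<open>simp add: kuv\<close>)
  qed
qed

text \<open>The conjugate of \<open>k\<close> inherits the hypothesis with \<open>y\<close> replaced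
  by \<open>- y\<close>, so the real and imaginary parts have vanishing transforms too and the real
  case applies to each.\<close>

lemma fourier_injective:
  fixes k :: "real \<Rightarrow> complex"
  assumes k: "integrable lborel k" and zero: "\<And>y. (LINT x|lborel. k x * iexp (y * x)) = 0"
  shows "AE x in lborel. k x = 0"
proof -
  have [measurable]: "k \<in> borel_measurable borel" using k by auto
  have ik: "integrable lborel (\<lambda>x. k x * iexp (y * x))" for y
    by (rule integral_mult_bounded[OF k, where C=1]) auto
  have ick: "integrable lborel (\<lambda>x. cnj (k x) * iexp (y * x))" for y
    by (rule integral_mult_bounded[where C=1]) (use k in auto)
  have zc: "(LINT x|lborel. cnj (k x) * iexp (y * x)) = 0" for y
  proof -
    have "(LINT x|lborel. cnj (k x) * iexp (y * x)) = (LINT x|lborel. cnj (k x * iexp (- y * x)))"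
      by (intro Bochner_Integration.integral_cong refl) (simp add: exp_cnj)
    also have "\<dots> = cnj (LINT x|lborel. k x * iexp (- y * x))" by (rule Bochner_Integration.integral_cnj)
    finally show ?thesis using zero[of "- y"] by simp
  qed
  have "AE x in lborel. Re (k x) = 0"
  proof (rule fourier_injective_real)
    show "integrable lborel (\<lambda>x. Re (k x))" using k by auto
    fix y
    have "(LINT x|lborel. complex_of_real (Re (k x)) * iexp (y * x)) = (LINT x|lborel. (1/2) * (k x * iexp (y * x) + cnj (k x) * iexp (y * x)))"
      by (intro Bochner_Integration.integral_cong refl) (simp add: distrib_right[symmetric] complex_add_cnj)
    also have "\<dots> = (1/2) * ((LINT x|lborel. k x * iexp (y * x)) + (LINT x|lborel. cnj (k x) * iexp (y * x)))"
      using ik ick by (simp only: integral_mult_right_zero Bochner_Integration.integral_add)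
    finally show "(LINT x|lborel. complex_of_real (Re (k x)) * iexp (y * x)) = 0" unfolding zero zc by simp
  qed
  moreover have "AE x in lborel. Im (k x) = 0"
  proof (rule fourier_injective_real)
    show "integrable lborel (\<lambda>x. Im (k x))" using k by auto
    fix y
    have "(LINT x|lborel. complex_of_real (Im (k x)) * iexp (y * x)) = (LINT x|lborel. (- (\<i> / 2)) * (k x * iexp (y * x) - cnj (k x) * iexp (y * x)))"
    proof (intro Bochner_Integration.integral_cong refl)
      fix x
      have "complex_of_real (Im z) * w = (- (\<i> / 2)) * (z * w - cnj z * w)" for z w by (simp add: complex_eq_iff field_simps)
      then show "complex_of_real (Im (k x)) * iexp (y * x) = (- (\<i> / 2)) * (k x * iexp (y * x) - cnj (k x) * iexp (y * x))" .
    qed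
    also have "\<dots> = (- (\<i> / 2)) * ((LINT x|lborel. k x * iexp (y * x)) - (LINT x|lborel. cnj (k x) * iexp (y * x)))"
      using ik ick by (simp only: integral_mult_right_zero Bochner_Integration.integral_diff)
    finally show "(LINT x|lborel. complex_of_real (Im (k x)) * iexp (y * x)) = 0" unfolding zero zc by simp
  qed
  ultimately show ?thesis by eventually_elim (simp add: complex_eq_iff)
qed

text \<open>The function \<open>fourier_function\<close> is an arbitrary choice, so a concrete datum
  requires this to learn what was chosen. The difference of two candidates need not be integrable,
  but its product with a Gaussian is, and the modulated Gaussians say that the transform of this
  product vanishes.\<close>

lemma has_fourier_function_unique:
  assumes g1: "has_fourier_function T g1" and g2: "has_fourier_function T g2"
  shows "AE \<xi> in lborel. g1 \<xi> = g2 \<xi>"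
proof -
  let ?G = "test_gaussian 0"
  have i: "integrable lborel (\<lambda>\<xi>. g1 \<xi> * test_gaussian y \<xi>)" "integrable lborel (\<lambda>\<xi>. g2 \<xi> * test_gaussian y \<xi>)"
    and e: "(LINT \<xi>|lborel. g1 \<xi> * test_gaussian y \<xi>) = (LINT \<xi>|lborel. g2 \<xi> * test_gaussian y \<xi>)" for y
    using g1 g2 test_gaussian_schwartz[of y] unfolding has_fourier_function_def by metis+
  have "AE \<xi> in lborel. (g1 \<xi> - g2 \<xi>) * ?G \<xi> = 0"
  proof (rule fourier_injective)
    show "integrable lborel (\<lambda>\<xi>. (g1 \<xi> - g2 \<xi>) * ?G \<xi>)"
      unfolding left_diff_distrib by (intro Bochner_Integration.integrable_diff i)
    fix y
    have "(LINT \<xi>|lborel. (g1 \<xi> - g2 \<xi>) * ?G \<xi> * iexp (y * \<xi>)) = (LINT \<xi>|lborel. g1 \<xi> * test_gaussian y \<xi> - g2 \<xi> * test_gaussian y \<xi>)"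
      by (intro Bochner_Integration.integral_cong refl) (simp add: test_gaussian_eq algebra_simps)
    also have "\<dots> = 0" using i[of y] e[of y] by simp
    finally show "(LINT \<xi>|lborel. (g1 \<xi> - g2 \<xi>) * ?G \<xi> * iexp (y * \<xi>)) = 0" .
  qed
  then show ?thesis by eventually_elim (simp add: test_gaussian_def)
qed

lemma fourier_function_distribution_of:
  assumes "integrable lborel F"
  shows "has_fourier_function (distribution_of F) (fourier_function (distribution_of F))"
    "AE \<xi> in lborel. fourier_function (distribution_of F) \<xi> = fourier F \<xi>"
proof -
  have ex: "\<exists>g. has_fourier_function (distribution_of F) g"
    using has_fourier_function_distribution_of[OF assms] by blast
  show h: "has_fourier_function (distribution_of F) (fourier_function (distribution_of F))"
    unfolding fourier_function_def by (rule someI_ex[OF ex])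
  show "AE \<xi> in lborel. fourier_function (distribution_of F) \<xi> = fourier F \<xi>"
    by (rule has_fourier_function_unique[OF h has_fourier_function_distribution_of[OF assms]])
qed

section \<open>Gaussian wave packets\<close>

text \<open>The parameter \<sigma> is the variance in frequency, so the packet has frequency width
  of order \<open>sqrt \<sigma>\<close> and spatial width of order
  \<open>1 / sqrt \<sigma>\<close>.\<close>

definition packet :: "real \<Rightarrow> real \<Rightarrow> real \<Rightarrow> real" where
  "packet \<omega> \<sigma> \<xi> = exp (- ((\<xi> - \<omega>)\<^sup>2 / (2 * \<sigma>)))"

text \<open>The inverse Fourier transform of the packet. Its \<open>L^1\<close> norm is 1 for every
  \<sigma>, so any summable amplitudes give an integrable superposition.\<close>

definition wave :: "real \<Rightarrow> real \<Rightarrow> real \<Rightarrow> complex" where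
  "wave \<omega> \<sigma> x = complex_of_real (sqrt (\<sigma> / (2 * pi)) * exp (- (\<sigma> / 2) * x\<^sup>2)) * iexp (\<omega> * x)"

lemma packet_bounds: "0 < packet \<omega> \<sigma> \<xi>" "\<sigma> > 0 \<Longrightarrow> packet \<omega> \<sigma> \<xi> \<le> 1"
  by (auto simp: packet_def)

lemma measurable_packet [measurable]: "packet \<omega> \<sigma> \<in> borel_measurable borel"
  unfolding packet_def[abs_def] by measurable

lemma gaussian_integral:
  assumes "c > 0" shows "(LINT x|lborel. exp (- c * x\<^sup>2)) = sqrt (pi / c)"
proof -
  have "complex_of_real (LINT x|lborel. exp (- c * x\<^sup>2)) = complex_of_real (sqrt (pi / c))"
    using gaussian_fourier[OF assms, of 0] by (simp add: integral_complex_of_real[symmetric] del: integral_complex_of_real of_real_exp)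
  then show ?thesis by (simp only: of_real_eq_iff)
qed

lemma wave_integrable:
  assumes "\<sigma> > 0"
  shows "integrable lborel (wave \<omega> \<sigma>)" "(LINT x|lborel. norm (wave \<omega> \<sigma> x)) = 1"
proof -
  have n: "norm (wave \<omega> \<sigma> x) = sqrt (\<sigma> / (2 * pi)) * exp (- (\<sigma> / 2) * x\<^sup>2)" for x
    using assms by (simp add: wave_def norm_mult del: of_real_mult of_real_exp)
  have i: "integrable lborel (\<lambda>x. sqrt (\<sigma> / (2 * pi)) * exp (- (\<sigma> / 2) * x\<^sup>2))"
    using assms by (intro integrable_mult_right integrable_gaussian) auto
  show "integrable lborel (wave \<omega> \<sigma>)"
  proof (rule Bochner_Integration.integrable_bound[OF i])
    show "wave \<omega> \<sigma> \<in> borel_measurable lborel" unfolding wave_def[abs_def] by measurable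
    show "AE x in lborel. norm (wave \<omega> \<sigma> x) \<le> norm (sqrt (\<sigma> / (2 * pi)) * exp (- (\<sigma> / 2) * x\<^sup>2))"
      unfolding n real_norm_def by (intro AE_I2 abs_ge_self)
  qed
  have "sqrt (\<sigma> / (2 * pi)) * sqrt (pi / (\<sigma> / 2)) = 1" using assms by (simp add: real_sqrt_mult[symmetric])
  then show "(LINT x|lborel. norm (wave \<omega> \<sigma> x)) = 1"
    unfolding n integral_mult_right_zero using gaussian_integral[of "\<sigma> / 2"] assms by simp
qed

lemma fourier_wave:
  assumes "\<sigma> > 0"
  shows "fourier (wave \<omega> \<sigma>) \<xi> = complex_of_real (packet \<omega> \<sigma> \<xi>)"
proof -
  have "fourier (wave \<omega> \<sigma>) \<xi> = (LINT x|lborel. complex_of_real (sqrt (\<sigma> / (2 * pi))) * (iexp ((\<omega> - \<xi>) * x) * exp (- (\<sigma> / 2) * x\<^sup>2)))"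
    unfolding fourier_def
  proof (intro Bochner_Integration.integral_cong refl)
    fix x
    have e: "exp (- \<i> * complex_of_real (x * \<xi>)) * iexp (\<omega> * x) = iexp ((\<omega> - \<xi>) * x)"
      by (simp add: exp_add[symmetric] algebra_simps)
    show "exp (- \<i> * complex_of_real (x * \<xi>)) * wave \<omega> \<sigma> x = complex_of_real (sqrt (\<sigma> / (2 * pi))) * (iexp ((\<omega> - \<xi>) * x) * exp (- (\<sigma> / 2) * x\<^sup>2))"
      unfolding wave_def e[symmetric] of_real_mult[of "sqrt (\<sigma> / (2 * pi))"] by (simp only: ac_simps)
  qed
  also have "\<dots> = complex_of_real (sqrt (\<sigma> / (2 * pi))) * complex_of_real (sqrt (pi / (\<sigma> / 2)) * exp (- (\<omega> - \<xi>)\<^sup>2 / (4 * (\<sigma> / 2))))"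
    using assms gaussian_fourier[of "\<sigma>/2" "\<omega> - \<xi>"] by (simp only: integral_mult_right_zero half_gt_zero)
  also have "\<dots> = complex_of_real ((sqrt (\<sigma> / (2 * pi)) * sqrt (pi / (\<sigma> / 2))) * exp (- (\<omega> - \<xi>)\<^sup>2 / (4 * (\<sigma> / 2))))"
    by simp
  also have "sqrt (\<sigma> / (2 * pi)) * sqrt (pi / (\<sigma> / 2)) = 1" using assms by (simp add: real_sqrt_mult[symmetric])
  also have "- (\<omega> - \<xi>)\<^sup>2 / (4 * (\<sigma> / 2)) = - ((\<xi> - \<omega>)\<^sup>2 / (2 * \<sigma>))" by (simp add: power2_commute)
  finally show ?thesis by (simp add: packet_def)
qed

lemma packet_integral:
  assumes "\<sigma> > 0"
  shows "integrable lborel (packet \<omega> \<sigma>)" "(LINT \<xi>|lborel. packet \<omega> \<sigma> \<xi>) = sqrt (2 * pi * \<sigma>)"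
proof -
  have e: "packet \<omega> \<sigma> (\<omega> + 1 * \<eta>) = exp (- (1 / (2 * \<sigma>)) * \<eta>\<^sup>2)" for \<eta> by (simp add: packet_def)
  have "integrable lborel (\<lambda>\<eta>. packet \<omega> \<sigma> (\<omega> + 1 * \<eta>))" unfolding e by (rule integrable_gaussian) (use assms in simp)
  then show "integrable lborel (packet \<omega> \<sigma>)" by (subst (asm) lborel_integrable_real_affine_iff) auto
  have "(LINT \<xi>|lborel. packet \<omega> \<sigma> \<xi>) = (LINT \<eta>|lborel. packet \<omega> \<sigma> (\<omega> + 1 * \<eta>))"
    by (subst lborel_integral_real_affine[where c=1 and t=\<omega>]) auto
  also have "\<dots> = sqrt (pi / (1 / (2 * \<sigma>)))" unfolding e by (rule gaussian_integral) (use assms in simp)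
  finally show "(LINT \<xi>|lborel. packet \<omega> \<sigma> \<xi>) = sqrt (2 * pi * \<sigma>)" by (simp add: mult_ac)
qed

text \<open>Galilean symmetry: shifting the frequency variable by \<omega> produces a carrier phase
  and transports the envelope along \<open>x = - 2 * t * \<omega>\<close>. The phase
  \<open>+ t * \<xi>^2\<close> thus sends positive frequencies to the left.\<close>

lemma packet_chirp:
  assumes "\<sigma> > 0"
  shows "chirp (\<lambda>\<xi>. complex_of_real (packet \<omega> \<sigma> \<xi>)) x t =
    iexp (x * \<omega> + t * \<omega>\<^sup>2) * chirp_gaussian (1 / (2 * \<sigma>)) (x + 2 * t * \<omega>) t"
proof -
  have "chirp (\<lambda>\<xi>. complex_of_real (packet \<omega> \<sigma> \<xi>)) x t =
    (LINT \<eta>|lborel. iexp (x * (\<omega> + 1 * \<eta>) + t * (\<omega> + 1 * \<eta>)\<^sup>2) * complex_of_real (packet \<omega> \<sigma> (\<omega> + 1 * \<eta>)))"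
    unfolding chirp_def by (subst lborel_integral_real_affine[where c=1 and t=\<omega>]) auto
  also have "\<dots> = (LINT \<eta>|lborel. iexp (x * \<omega> + t * \<omega>\<^sup>2) * (iexp ((x + 2 * t * \<omega>) * \<eta> + t * \<eta>\<^sup>2) * complex_of_real (exp (- (1 / (2 * \<sigma>)) * \<eta>\<^sup>2))))"
  proof (intro Bochner_Integration.integral_cong refl)
    fix \<eta> :: real
    have "x * (\<omega> + 1 * \<eta>) + t * (\<omega> + 1 * \<eta>)\<^sup>2 = (x * \<omega> + t * \<omega>\<^sup>2) + ((x + 2 * t * \<omega>) * \<eta> + t * \<eta>\<^sup>2)"
      by (simp add: power2_eq_square algebra_simps)
    then have "iexp (x * (\<omega> + 1 * \<eta>) + t * (\<omega> + 1 * \<eta>)\<^sup>2) = iexp (x * \<omega> + t * \<omega>\<^sup>2) * iexp ((x + 2 * t * \<omega>) * \<eta> + t * \<eta>\<^sup>2)"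
      by (simp only: of_real_add distrib_left exp_add)
    moreover have "packet \<omega> \<sigma> (\<omega> + 1 * \<eta>) = exp (- (1 / (2 * \<sigma>)) * \<eta>\<^sup>2)" by (simp add: packet_def)
    ultimately show "iexp (x * (\<omega> + 1 * \<eta>) + t * (\<omega> + 1 * \<eta>)\<^sup>2) * complex_of_real (packet \<omega> \<sigma> (\<omega> + 1 * \<eta>)) =
      iexp (x * \<omega> + t * \<omega>\<^sup>2) * (iexp ((x + 2 * t * \<omega>) * \<eta> + t * \<eta>\<^sup>2) * complex_of_real (exp (- (1 / (2 * \<sigma>)) * \<eta>\<^sup>2)))"
      by (simp only: mult.assoc)
  qed
  finally show ?thesis unfolding chirp_def by (simp only: integral_mult_right_zero)
qed

text \<open>The growth of the weight away from \<omega> is absorbed by a packet of doubled variance;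
  \<open>\<sigma> \<le> \<omega>^2\<close> keeps the weight comparable to its value at \<omega> on
  the bulk. The constant is \<open>16 * 64 * 4\<close>, from \<open>4 powr s\<close>, from
  \<open>(1 + y)^2 <= 64 * exp (y / 4)\<close> and from the mass of the wider packet.\<close>

lemma packet_moment:
  assumes lam: "\<omega> \<ge> 1" and sig: "0 < \<sigma>" "\<sigma> \<le> \<omega>\<^sup>2" and s: "0 \<le> s" "s \<le> 2"
  shows "integrable lborel (\<lambda>\<xi>. (1 + \<xi>\<^sup>2) powr s * packet \<omega> \<sigma> \<xi>)"
    "(LINT \<xi>|lborel. (1 + \<xi>\<^sup>2) powr s * packet \<omega> \<sigma> \<xi>) \<le> 4096 * \<omega> powr (2 * s) * sqrt \<sigma>"
proof -
  have le: "(1 + \<xi>\<^sup>2) powr s * packet \<omega> \<sigma> \<xi> \<le> 1024 * \<omega> powr (2 * s) * packet \<omega> (2 * \<sigma>) \<xi>" for \<xi>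
  proof -
    define y where "y = (\<xi> - \<omega>)\<^sup>2 / \<sigma>"
    have y: "y \<ge> 0" using sig by (simp add: y_def)
    have "\<xi>\<^sup>2 \<le> 2 * \<omega>\<^sup>2 + 2 * (\<xi> - \<omega>)\<^sup>2" using square_sum_le[of \<omega> "\<xi> - \<omega>"] by simp
    moreover have "(\<xi> - \<omega>)\<^sup>2 = \<sigma> * y" using sig by (simp add: y_def)
    moreover have "\<sigma> * y \<le> \<omega>\<^sup>2 * y" using sig y by (intro mult_right_mono)
    moreover have "1 \<le> \<omega>\<^sup>2" using lam by (rule one_le_power)
    moreover have "0 \<le> \<omega>\<^sup>2 * y" using y by simp
    ultimately have "1 + \<xi>\<^sup>2 \<le> (4 * \<omega>\<^sup>2) * (1 + y)" by (simp add: algebra_simps)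
    then have "(1 + \<xi>\<^sup>2) powr s \<le> ((4 * \<omega>\<^sup>2) * (1 + y)) powr s" using s by (intro powr_mono2) auto
    also have "\<dots> = 4 powr s * (\<omega>\<^sup>2) powr s * (1 + y) powr s" by (simp add: powr_mult)
    also have "(\<omega>\<^sup>2) powr s = (\<omega> powr 2) powr s" using lam by simp
    also have "\<dots> = \<omega> powr (2 * s)" by (rule powr_powr)
    also have "4 powr s * \<omega> powr (2 * s) * (1 + y) powr s \<le> 4 powr 2 * \<omega> powr (2 * s) * (1 + y) powr 2"
      using s y lam by (intro mult_mono powr_mono) auto
    also have "\<dots> = 16 * \<omega> powr (2 * s) * (1 + y)\<^sup>2" using y by simp
    also have "\<dots> \<le> 16 * \<omega> powr (2 * s) * (64 * exp (y / 4))"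
    proof (rule mult_left_mono)
      have "(1 + y / 8)\<^sup>2 \<le> (exp (y / 8))\<^sup>2" using y exp_ge_add_one_self[of "y/8"] by (intro power_mono) auto
      also have "\<dots> = exp (y / 4)" by (simp add: exp_double[symmetric])
      finally have "64 * (1 + y / 8)\<^sup>2 \<le> 64 * exp (y / 4)" by simp
      moreover have "(1 + y)\<^sup>2 \<le> 64 * (1 + y / 8)\<^sup>2"
        using y by (simp add: power2_eq_square algebra_simps)
      ultimately show "(1 + y)\<^sup>2 \<le> 64 * exp (y / 4)" by linarith
    qed simp
    finally have "(1 + \<xi>\<^sup>2) powr s * exp (- (y / 2)) \<le> 16 * \<omega> powr (2 * s) * (64 * exp (y / 4)) * exp (- (y / 2))"
      by (rule mult_right_mono) simp
    also have "\<dots> = 1024 * \<omega> powr (2 * s) * (exp (y / 4) * exp (- (y / 2)))" by simp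
    also have "exp (y / 4) * exp (- (y / 2)) = exp (- (y / 4))" by (simp add: exp_add[symmetric])
    finally show ?thesis by (simp add: packet_def y_def field_simps)
  qed
  have s2: "2 * \<sigma> > 0" using sig by simp
  have i: "integrable lborel (\<lambda>\<xi>. 1024 * \<omega> powr (2 * s) * packet \<omega> (2 * \<sigma>) \<xi>)"
    by (intro integrable_mult_right packet_integral(1)[OF s2])
  show I: "integrable lborel (\<lambda>\<xi>. (1 + \<xi>\<^sup>2) powr s * packet \<omega> \<sigma> \<xi>)"
  proof (rule Bochner_Integration.integrable_bound[OF i])
    show "AE \<xi> in lborel. norm ((1 + \<xi>\<^sup>2) powr s * packet \<omega> \<sigma> \<xi>) \<le> norm (1024 * \<omega> powr (2 * s) * packet \<omega> (2 * \<sigma>) \<xi>)"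
    proof (rule AE_I2)
      fix \<xi>
      have "0 \<le> (1 + \<xi>\<^sup>2) powr s * packet \<omega> \<sigma> \<xi>" using packet_bounds(1)[of \<omega> \<sigma> \<xi>] by simp
      then show "norm ((1 + \<xi>\<^sup>2) powr s * packet \<omega> \<sigma> \<xi>) \<le> norm (1024 * \<omega> powr (2 * s) * packet \<omega> (2 * \<sigma>) \<xi>)"
        using order_trans[OF le[of \<xi>] abs_ge_self] unfolding real_norm_def by (simp only: abs_of_nonneg)
    qed
  qed measurable
  have "(LINT \<xi>|lborel. (1 + \<xi>\<^sup>2) powr s * packet \<omega> \<sigma> \<xi>) \<le> 1024 * \<omega> powr (2 * s) * sqrt (2 * pi * (2 * \<sigma>))"
    using integral_mono[OF I i le] packet_integral(2)[OF s2] by (simp only: integral_mult_right_zero)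
  also have "\<dots> \<le> 1024 * \<omega> powr (2 * s) * (4 * sqrt \<sigma>)"
  proof (rule mult_left_mono)
    have "sqrt (2 * pi * (2 * \<sigma>)) \<le> sqrt (16 * \<sigma>)" using pi_less_4 sig by (intro real_sqrt_le_mono) auto
    then show "sqrt (2 * pi * (2 * \<sigma>)) \<le> 4 * sqrt \<sigma>" by (simp add: real_sqrt_mult)
  qed simp
  finally show "(LINT \<xi>|lborel. (1 + \<xi>\<^sup>2) powr s * packet \<omega> \<sigma> \<xi>) \<le> 4096 * \<omega> powr (2 * s) * sqrt \<sigma>" by simp
qed

section \<open>Superpositions of wave packets\<close>

lemma AE_summable_norm:
  fixes f :: "nat \<Rightarrow> real \<Rightarrow> 'a::{banach, second_countable_topology}"
  assumes i: "\<And>k. integrable lborel (f k)" and s: "summable (\<lambda>k. LINT x|lborel. norm (f k x))"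
  shows "AE x in lborel. summable (\<lambda>k. norm (f k x))"
proof -
  have [measurable]: "f k \<in> borel_measurable borel" for k using i[of k] by auto
  have "(\<integral>\<^sup>+x. (\<Sum>k. ennreal (norm (f k x))) \<partial>lborel) = (\<Sum>k. ennreal (LINT x|lborel. norm (f k x)))"
    using i by (subst nn_integral_suminf) (auto simp: nn_integral_eq_integral)
  also have "\<dots> = ennreal (\<Sum>k. LINT x|lborel. norm (f k x))" by (rule suminf_ennreal2[OF _ s]) simp
  finally have "(\<integral>\<^sup>+x. (\<Sum>k. ennreal (norm (f k x))) \<partial>lborel) \<noteq> \<infinity>" by simp
  then have "AE x in lborel. (\<Sum>k. ennreal (norm (f k x))) \<noteq> \<infinity>"
    by (intro nn_integral_noteq_infinite) auto
  then show ?thesis by eventually_elim (auto intro!: summable_suminf_not_top)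
qed

text \<open>Cauchy-Schwarz with weights \<open>2^(-k-1)\<close> of total mass 1, obtained by
  expanding a series of nonnegative squares. It substitutes for orthogonality of the packets; the
  factors \<open>2^(k+1)\<close> are negligible against powers of frequencies that grow doubly
  exponentially.\<close>

lemma square_suminf_le:
  fixes u :: "nat \<Rightarrow> real"
  assumes u: "summable u" and u2: "summable (\<lambda>k. 2 ^ Suc k * (u k)\<^sup>2)"
  shows "(\<Sum>k. u k)\<^sup>2 \<le> (\<Sum>k. 2 ^ Suc k * (u k)\<^sup>2)"
proof -
  define m where "m = (\<Sum>k. u k)"
  have h: "(\<lambda>k. (1/2::real) ^ Suc k) sums 1" using power_half_series .
  have S: "(\<lambda>k. 2 ^ Suc k * (u k)\<^sup>2 - 2 * m * u k + m\<^sup>2 * (1/2) ^ Suc k) sums ((\<Sum>k. 2 ^ Suc k * (u k)\<^sup>2) - 2 * m * m + m\<^sup>2 * 1)"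
    unfolding m_def by (intro sums_add sums_diff sums_mult summable_sums u u2 h)
  have "2 ^ Suc k * (u k)\<^sup>2 - 2 * m * u k + m\<^sup>2 * (1/2) ^ Suc k \<ge> 0" for k
  proof -
    have gen: "P * (a * a) - 2 * m * a + m * m * Q = P * ((a - m * Q) * (a - m * Q))" if "P * Q = 1" for P Q a :: real
    proof -
      have "P * ((a - m * Q) * (a - m * Q)) = P * (a * a) - 2 * m * a * (P * Q) + m * m * Q * (P * Q)" by (simp add: algebra_simps)
      then show ?thesis unfolding that by simp
    qed
    have "(2::real) ^ Suc k * (1/2) ^ Suc k = 1" by (simp only: power_mult_distrib[symmetric]) simp
    then have "2 ^ Suc k * (u k)\<^sup>2 - 2 * m * u k + m\<^sup>2 * (1/2) ^ Suc k = 2 ^ Suc k * (u k - m * (1/2) ^ Suc k)\<^sup>2"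
      unfolding power2_eq_square by (rule gen)
    then show ?thesis by simp
  qed
  then have "0 \<le> (\<Sum>k. 2 ^ Suc k * (u k)\<^sup>2 - 2 * m * u k + m\<^sup>2 * (1/2) ^ Suc k)"
    by (rule suminf_nonneg[OF sums_summable[OF S]])
  then have "0 \<le> (\<Sum>k. 2 ^ Suc k * (u k)\<^sup>2) - 2 * m * m + m\<^sup>2 * 1" unfolding sums_unique[OF S, symmetric] .
  then show ?thesis by (simp add: m_def power2_eq_square)
qed

locale wave_packets =
  fixes h \<omega> \<sigma> :: "nat \<Rightarrow> real"
  assumes h0: "h k \<ge> 0" and hs: "summable h" and om: "\<omega> k \<ge> 1"
    and sig: "0 < \<sigma> k" "\<sigma> k \<le> (\<omega> k)\<^sup>2"
begin

definition profile :: "real \<Rightarrow> real" where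
  "profile \<xi> = (\<Sum>k. h k * packet (\<omega> k) (\<sigma> k) \<xi>)"

definition wave_series :: "real \<Rightarrow> complex" where
  "wave_series x = (\<Sum>k. complex_of_real (h k) * wave (\<omega> k) (\<sigma> k) x)"

definition datum :: "(real \<Rightarrow> complex) \<Rightarrow> complex" where
  "datum = distribution_of wave_series"

definition evolution :: "nat \<Rightarrow> real \<Rightarrow> real \<Rightarrow> complex" where
  "evolution k x t = chirp (\<lambda>\<xi>. complex_of_real (packet (\<omega> k) (\<sigma> k) \<xi>)) x t"

definition truncated_evolution :: "nat \<Rightarrow> nat \<Rightarrow> real \<Rightarrow> real \<Rightarrow> complex" where
  "truncated_evolution N k x t =
     chirp (\<lambda>\<xi>. complex_of_real (indicator {\<xi>. \<bar>\<xi>\<bar> \<le> 2 ^ N} \<xi> * packet (\<omega> k) (\<sigma> k) \<xi>)) x t"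

lemma packet_le: "0 \<le> packet (\<omega> k) (\<sigma> k) \<xi>" "packet (\<omega> k) (\<sigma> k) \<xi> \<le> 1"
  by (rule less_imp_le[OF packet_bounds(1)], rule packet_bounds(2)[OF sig(1)])

lemma summable_profile: "summable (\<lambda>k. h k * packet (\<omega> k) (\<sigma> k) \<xi>)"
  by (rule summable_comparison_test'[OF hs, of 0]) (simp add: h0 packet_le mult_left_le)

lemma measurable_profile [measurable]: "profile \<in> borel_measurable borel"
  unfolding profile_def[abs_def] by measurable

lemma wave_terms:
  "integrable lborel (\<lambda>x. complex_of_real (h k) * wave (\<omega> k) (\<sigma> k) x)"
  "(LINT x|lborel. norm (complex_of_real (h k) * wave (\<omega> k) (\<sigma> k) x)) = h k"
  using wave_integrable[OF sig(1)[of k], of "\<omega> k"] h0[of k] by (auto simp: norm_mult)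

lemma wave_series_summable: "AE x in lborel. summable (\<lambda>k. norm (complex_of_real (h k) * wave (\<omega> k) (\<sigma> k) x))"
  by (rule AE_summable_norm[OF wave_terms(1)]) (simp only: wave_terms(2) hs)

lemma wave_series_integrable: "integrable lborel wave_series"
  unfolding wave_series_def[abs_def]
  by (rule integrable_suminf[OF wave_terms(1) wave_series_summable]) (simp only: wave_terms(2) hs)

lemma fourier_wave_series: "fourier wave_series \<xi> = complex_of_real (profile \<xi>)"
proof -
  let ?f = "\<lambda>k x. exp (- \<i> * complex_of_real (x * \<xi>)) * (complex_of_real (h k) * wave (\<omega> k) (\<sigma> k) x)"
  have n: "norm (?f k x) = norm (complex_of_real (h k) * wave (\<omega> k) (\<sigma> k) x)" for k x by (simp add: norm_mult)
  have i: "integrable lborel (?f k)" for k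
  proof -
    have "integrable lborel (\<lambda>x. (complex_of_real (h k) * wave (\<omega> k) (\<sigma> k) x) * exp (- \<i> * complex_of_real (x * \<xi>)))"
      by (rule integral_mult_bounded[OF wave_terms(1), where C=1]) auto
    then show ?thesis by (simp only: mult.commute)
  qed
  have as: "AE x in lborel. summable (\<lambda>k. norm (?f k x))" unfolding n by (rule wave_series_summable)
  have ns: "summable (\<lambda>k. LINT x|lborel. norm (?f k x))" unfolding n wave_terms(2) by (rule hs)
  have "fourier wave_series \<xi> = (LINT x|lborel. (\<Sum>k. ?f k x))"
    unfolding fourier_def
  proof (rule integral_cong_AE)
    show "(\<lambda>x. exp (- \<i> * complex_of_real (x * \<xi>)) * wave_series x) \<in> borel_measurable lborel"
      using wave_series_integrable by measurable
    show "(\<lambda>x. \<Sum>k. ?f k x) \<in> borel_measurable lborel"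
      using integrable_suminf[OF i as ns] by auto
    show "AE x in lborel. exp (- \<i> * complex_of_real (x * \<xi>)) * wave_series x = (\<Sum>k. ?f k x)"
      using wave_series_summable
    proof eventually_elim
      case (elim x)
      show ?case unfolding wave_series_def by (rule suminf_mult[symmetric, OF summable_norm_cancel[OF elim]])
    qed
  qed
  also have "\<dots> = (\<Sum>k. LINT x|lborel. ?f k x)" by (rule integral_suminf[OF i as ns])
  also have "\<dots> = (\<Sum>k. complex_of_real (h k * packet (\<omega> k) (\<sigma> k) \<xi>))"
  proof (rule suminf_cong)
    fix k
    have "(LINT x|lborel. ?f k x) = (LINT x|lborel. complex_of_real (h k) * (exp (- \<i> * complex_of_real (x * \<xi>)) * wave (\<omega> k) (\<sigma> k) x))"
      by (simp only: mult.left_commute)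
    also have "\<dots> = complex_of_real (h k) * fourier (wave (\<omega> k) (\<sigma> k)) \<xi>"
      unfolding fourier_def by (rule integral_mult_right_zero)
    finally show "(LINT x|lborel. ?f k x) = complex_of_real (h k * packet (\<omega> k) (\<sigma> k) \<xi>)"
      using fourier_wave[OF sig(1)] by simp
  qed
  also have "(\<Sum>k. complex_of_real (h k * packet (\<omega> k) (\<sigma> k) \<xi>)) = complex_of_real (profile \<xi>)"
    unfolding profile_def by (rule suminf_of_real[symmetric, OF summable_profile])
  finally show ?thesis .
qed

lemma fourier_function_datum:
  "has_fourier_function datum (fourier_function datum)"
  "fourier_function datum \<in> borel_measurable borel"
  "AE \<xi> in lborel. fourier_function datum \<xi> = complex_of_real (profile \<xi>)"
  using fourier_function_distribution_of[OF wave_series_integrable] unfolding datum_def[symmetric] fourier_wave_series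
  by (auto simp: has_fourier_function_def)

lemma truncated_packet:
  "integrable lborel (\<lambda>\<xi>. complex_of_real (indicator {\<xi>. \<bar>\<xi>\<bar> \<le> 2 ^ N} \<xi> * packet (\<omega> k) (\<sigma> k) \<xi>))"
proof -
  have "integrable lborel (\<lambda>\<xi>. indicator {\<xi>. \<bar>\<xi>\<bar> \<le> 2 ^ N} \<xi> * packet (\<omega> k) (\<sigma> k) \<xi>)"
    by (rule Bochner_Integration.integrable_bound[OF packet_integral(1)[OF sig(1)[of k], of "\<omega> k"]])
      (auto split: split_indicator)
  then show ?thesis by (rule integrable_of_real)
qed

lemma dyadic_truncation_datum:
  "dyadic_truncation fst datum x t N = (\<Sum>k. complex_of_real (h k) * truncated_evolution N k x t)"
proof -
  let ?e = "\<lambda>\<xi>. iexp (x * \<xi> + t * \<xi>\<^sup>2)"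
  let ?I = "\<lambda>\<xi>::real. indicator {\<xi>. \<bar>\<xi>\<bar> \<le> 2 ^ N} \<xi> :: real"
  let ?f = "\<lambda>k \<xi>. complex_of_real (h k) * (?e \<xi> * complex_of_real (?I \<xi> * packet (\<omega> k) (\<sigma> k) \<xi>))"
  have i: "integrable lborel (?f k)" for k
    by (intro integrable_mult_right integrable_phase truncated_packet)
  have n: "norm (?f k \<xi>) = ?I \<xi> * (h k * packet (\<omega> k) (\<sigma> k) \<xi>)" for k \<xi>
    using h0[of k] packet_le[of k \<xi>] by (simp add: norm_mult del: of_real_mult)
  have as: "AE \<xi> in lborel. summable (\<lambda>k. norm (?f k \<xi>))"
    unfolding n by (intro AE_I2 summable_mult summable_profile)
  have ns: "summable (\<lambda>k. LINT \<xi>|lborel. norm (?f k \<xi>))"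
  proof (rule summable_comparison_test')
    show "summable (\<lambda>k. h k * (LINT \<xi>|lborel. ?I \<xi>))" by (rule summable_mult2[OF hs])
    have "{\<xi>::real. \<bar>\<xi>\<bar> \<le> 2 ^ N} = {- (2 ^ N)..2 ^ N}" by auto
    then have Ii: "integrable lborel ?I" using integrable_indicator_Icc by simp
    fix k
    have "(LINT \<xi>|lborel. norm (?f k \<xi>)) \<le> (LINT \<xi>|lborel. h k * ?I \<xi>)"
    proof (rule integral_mono[OF integrable_norm[OF i] integrable_mult_right[OF Ii]])
      fix \<xi> show "norm (?f k \<xi>) \<le> h k * ?I \<xi>"
      proof -
        have "h k * packet (\<omega> k) (\<sigma> k) \<xi> \<le> h k" by (rule mult_left_le[OF packet_le(2) h0])
        then show ?thesis unfolding n by (simp add: h0 split: split_indicator)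
      qed
    qed
    then show "norm (LINT \<xi>|lborel. norm (?f k \<xi>)) \<le> h k * (LINT \<xi>|lborel. ?I \<xi>)" by simp
  qed
  have "dyadic_truncation fst datum x t N = (LINT \<xi>|lborel. (\<Sum>k. ?f k \<xi>))"
    unfolding dyadic_truncation_def set_lebesgue_integral_def propagator_integrand_eq
  proof (rule integral_cong_AE)
    show "(\<lambda>\<xi>. ?I \<xi> *\<^sub>R (iexp (fst (x, t) * \<xi> + t * \<xi>\<^sup>2) * fourier_function datum \<xi>)) \<in> borel_measurable lborel"
      using fourier_function_datum(2) by measurable
    show "(\<lambda>\<xi>. \<Sum>k. ?f k \<xi>) \<in> borel_measurable lborel"
      using integrable_suminf[OF i as ns] by auto
    show "AE \<xi> in lborel. ?I \<xi> *\<^sub>R (iexp (fst (x, t) * \<xi> + t * \<xi>\<^sup>2) * fourier_function datum \<xi>) = (\<Sum>k. ?f k \<xi>)"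
      using fourier_function_datum(3)
    proof eventually_elim
      case (elim \<xi>)
      have "(\<Sum>k. ?f k \<xi>) = (\<Sum>k. (?I \<xi> *\<^sub>R ?e \<xi>) * complex_of_real (h k * packet (\<omega> k) (\<sigma> k) \<xi>))"
        by (simp add: scaleR_conv_of_real mult_ac)
      also have "\<dots> = (?I \<xi> *\<^sub>R ?e \<xi>) * (\<Sum>k. complex_of_real (h k * packet (\<omega> k) (\<sigma> k) \<xi>))"
        by (rule suminf_mult) (rule summable_of_real[OF summable_profile])
      also have "(\<Sum>k. complex_of_real (h k * packet (\<omega> k) (\<sigma> k) \<xi>)) = complex_of_real (profile \<xi>)"
        unfolding profile_def by (rule suminf_of_real[symmetric, OF summable_profile])
      finally show ?case by (simp add: elim)
    qed
  qed
  also have "\<dots> = (\<Sum>k. LINT \<xi>|lborel. ?f k \<xi>)" by (rule integral_suminf[OF i as ns])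
  finally show ?thesis unfolding truncated_evolution_def chirp_def by (simp only: integral_mult_right_zero)
qed

lemma truncated_evolution_tendsto: "(\<lambda>N. truncated_evolution N k x t) \<longlonglongrightarrow> evolution k x t"
  unfolding truncated_evolution_def evolution_def chirp_def
proof (rule integral_dominated_convergence[where w="packet (\<omega> k) (\<sigma> k)"])
  show "integrable lborel (packet (\<omega> k) (\<sigma> k))" by (rule packet_integral(1)[OF sig(1)])
  show "AE \<xi> in lborel. (\<lambda>N. iexp (x * \<xi> + t * \<xi>\<^sup>2) * complex_of_real (indicator {\<xi>. \<bar>\<xi>\<bar> \<le> 2 ^ N} \<xi> * packet (\<omega> k) (\<sigma> k) \<xi>))
      \<longlonglongrightarrow> iexp (x * \<xi> + t * \<xi>\<^sup>2) * complex_of_real (packet (\<omega> k) (\<sigma> k) \<xi>)"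
  proof (rule AE_I2)
    fix \<xi> :: real
    obtain M where M: "\<bar>\<xi>\<bar> < 2 ^ M" using real_arch_pow[of 2 "\<bar>\<xi>\<bar>"] by auto
    have "\<bar>\<xi>\<bar> \<le> 2 ^ N" if "M \<le> N" for N
    proof -
      have "(2::real) ^ M \<le> 2 ^ N" using that by (intro power_increasing) auto
      then show ?thesis using M by linarith
    qed
    then have "\<forall>\<^sub>F N in sequentially. iexp (x * \<xi> + t * \<xi>\<^sup>2) * complex_of_real (indicator {\<xi>. \<bar>\<xi>\<bar> \<le> 2 ^ N} \<xi> * packet (\<omega> k) (\<sigma> k) \<xi>) =
        iexp (x * \<xi> + t * \<xi>\<^sup>2) * complex_of_real (packet (\<omega> k) (\<sigma> k) \<xi>)"
      unfolding eventually_sequentially by (intro exI[of _ M]) auto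
    then show "(\<lambda>N. iexp (x * \<xi> + t * \<xi>\<^sup>2) * complex_of_real (indicator {\<xi>. \<bar>\<xi>\<bar> \<le> 2 ^ N} \<xi> * packet (\<omega> k) (\<sigma> k) \<xi>))
      \<longlonglongrightarrow> iexp (x * \<xi> + t * \<xi>\<^sup>2) * complex_of_real (packet (\<omega> k) (\<sigma> k) \<xi>)"
      by (rule tendsto_eventually)
  qed
  show "AE \<xi> in lborel. norm (iexp (x * \<xi> + t * \<xi>\<^sup>2) * complex_of_real (indicator {\<xi>. \<bar>\<xi>\<bar> \<le> 2 ^ N} \<xi> * packet (\<omega> k) (\<sigma> k) \<xi>))
     \<le> packet (\<omega> k) (\<sigma> k) \<xi>" for N
    using packet_le(1) by (intro AE_I2) (simp add: norm_mult split: split_indicator)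
qed auto

text \<open>Interchanges the truncation limit with the sum over packets, for which the domination
  must be uniform in the truncation. It is required at the given point and time only: in the later
  construction with \<open>\<delta> = 0\<close>, the amplitudes times the masses of the packets are
  not summable.\<close>

lemma propagator_datum:
  assumes d: "summable d" and dom: "\<And>N k. h k * norm (truncated_evolution N k x t) \<le> d k"
  shows "propagator_exists fst datum x t"
    "propagator fst datum x t = (\<Sum>k. complex_of_real (h k) * evolution k x t) / (2 * complex_of_real pi)"
    "summable (\<lambda>k. complex_of_real (h k) * evolution k x t)"
proof -
  have "((\<lambda>N. \<Sum>k. complex_of_real (h k) * truncated_evolution N k x t) \<longlonglongrightarrow> (\<Sum>k. complex_of_real (h k) * evolution k x t))
      \<and> summable (\<lambda>k. norm (complex_of_real (h k) * evolution k x t))"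
  proof -
    have lim: "(\<lambda>N. complex_of_real (h k) * truncated_evolution N k x t) \<longlonglongrightarrow> complex_of_real (h k) * evolution k x t" for k
      by (intro tendsto_mult tendsto_const truncated_evolution_tendsto)
    have ev: "\<forall>\<^sub>F (k, N) in at_top \<times>\<^sub>F sequentially. norm (complex_of_real (h k) * truncated_evolution N k x t) \<le> d k"
      using dom h0 by (intro always_eventually) (simp add: norm_mult split_beta)
    show ?thesis using tannerys_theorem[OF lim ev d] by simp
  qed
  then have L: "dyadic_truncation fst datum x t \<longlonglongrightarrow> (\<Sum>k. complex_of_real (h k) * evolution k x t)"
    and S: "summable (\<lambda>k. norm (complex_of_real (h k) * evolution k x t))"
    unfolding dyadic_truncation_datum[abs_def] by auto
  show "propagator_exists fst datum x t"
    "propagator fst datum x t = (\<Sum>k. complex_of_real (h k) * evolution k x t) / (2 * complex_of_real pi)"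
    by (rule propagator_from_truncations[OF fourier_function_datum(2) L])+
  show "summable (\<lambda>k. complex_of_real (h k) * evolution k x t)" by (rule summable_norm_cancel[OF S])
qed

lemma datum_in_sobolev:
  assumes s: "0 \<le> s" "s \<le> 2"
    and sum: "summable (\<lambda>k. 2 ^ Suc k * ((h k)\<^sup>2 * (\<omega> k powr (2 * s) * sqrt (\<sigma> k))))"
  shows "datum \<in> sobolev s"
proof -
  let ?w = "\<lambda>\<xi>::real. (1 + \<xi>\<^sup>2) powr s"
  let ?p = "\<lambda>k \<xi>. packet (\<omega> k) (\<sigma> k) \<xi>"
  \<comment> \<open>Uses that a packet is at most 1, so its square is at most itself; the factor
    \<open>2^(k+1)\<close> prepares for \<open>square_suminf_le\<close>.\<close>
  define f where "f = (\<lambda>k \<xi>. 2 ^ Suc k * (h k)\<^sup>2 * (?w \<xi> * ?p k \<xi>))"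
  have f0: "f k \<xi> \<ge> 0" for k \<xi> using packet_le(1)[of k \<xi>] by (simp add: f_def)
  have i: "integrable lborel (f k)" for k
    unfolding f_def using packet_moment(1)[OF om[of k] sig s] by (intro integrable_mult_right)
  have ns: "summable (\<lambda>k. LINT \<xi>|lborel. norm (f k \<xi>))"
  proof (rule summable_comparison_test')
    show "summable (\<lambda>k. 4096 * (2 ^ Suc k * ((h k)\<^sup>2 * (\<omega> k powr (2 * s) * sqrt (\<sigma> k)))))" by (rule summable_mult[OF sum])
    fix k
    have "(LINT \<xi>|lborel. norm (f k \<xi>)) = 2 ^ Suc k * (h k)\<^sup>2 * (LINT \<xi>|lborel. ?w \<xi> * ?p k \<xi>)"
      unfolding real_norm_def abs_of_nonneg[OF f0] unfolding f_def by (rule integral_mult_right_zero)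
    also have "\<dots> \<le> 2 ^ Suc k * (h k)\<^sup>2 * (4096 * \<omega> k powr (2 * s) * sqrt (\<sigma> k))"
      using packet_moment(2)[OF om[of k] sig s] by (intro mult_left_mono) auto
    finally show "norm (LINT \<xi>|lborel. norm (f k \<xi>)) \<le> 4096 * (2 ^ Suc k * ((h k)\<^sup>2 * (\<omega> k powr (2 * s) * sqrt (\<sigma> k))))"
      by (simp add: mult_ac)
  qed
  have as: "AE \<xi> in lborel. summable (\<lambda>k. norm (f k \<xi>))" by (rule AE_summable_norm[OF i ns])
  have fi: "integrable lborel (\<lambda>\<xi>. \<Sum>k. f k \<xi>)" by (rule integrable_suminf[OF i as ns])
  have "integrable lborel (\<lambda>\<xi>. (norm (complex_of_real ((1 + \<xi>\<^sup>2) powr (s / 2)) * fourier_function datum \<xi>))\<^sup>2)"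
  proof (rule Bochner_Integration.integrable_bound[OF fi])
    show "(\<lambda>\<xi>. (norm (complex_of_real ((1 + \<xi>\<^sup>2) powr (s / 2)) * fourier_function datum \<xi>))\<^sup>2) \<in> borel_measurable lborel"
      using fourier_function_datum(2) by measurable
    show "AE \<xi> in lborel. norm ((norm (complex_of_real ((1 + \<xi>\<^sup>2) powr (s / 2)) * fourier_function datum \<xi>))\<^sup>2) \<le> norm (\<Sum>k. f k \<xi>)"
      using as fourier_function_datum(3)
    proof eventually_elim
      case (elim \<xi>)
      have "1 + \<xi>\<^sup>2 > 0" by (simp add: add_pos_nonneg)
      then have w: "?w \<xi> > 0" by simp
      have sf: "summable (\<lambda>k. f k \<xi>)" using elim(1) f0 by simp
      have uf: "2 ^ Suc k * (h k * ?p k \<xi>)\<^sup>2 \<le> f k \<xi> / ?w \<xi>" for k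
      proof -
        have "(?p k \<xi>)\<^sup>2 \<le> ?p k \<xi>" using packet_le[of k \<xi>] by (simp add: power2_eq_square mult_left_le)
        then have "2 ^ Suc k * (h k)\<^sup>2 * (?p k \<xi>)\<^sup>2 \<le> 2 ^ Suc k * (h k)\<^sup>2 * ?p k \<xi>" by (intro mult_left_mono) auto
        then show ?thesis using w by (simp add: f_def power_mult_distrib)
      qed
      have sq: "summable (\<lambda>k. 2 ^ Suc k * (h k * ?p k \<xi>)\<^sup>2)"
        by (rule summable_comparison_test'[OF summable_divide[OF sf, of "?w \<xi>"], of 0]) (use uf in simp)
      have "(profile \<xi>)\<^sup>2 \<le> (\<Sum>k. 2 ^ Suc k * (h k * ?p k \<xi>)\<^sup>2)"
        unfolding profile_def by (rule square_suminf_le[OF summable_profile sq])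
      also have "\<dots> \<le> (\<Sum>k. f k \<xi> / ?w \<xi>)" by (rule suminf_le[OF uf sq summable_divide[OF sf]])
      also have "\<dots> = (\<Sum>k. f k \<xi>) / ?w \<xi>" by (rule suminf_divide[OF sf])
      finally have "?w \<xi> * (profile \<xi>)\<^sup>2 \<le> (\<Sum>k. f k \<xi>)" using w by (simp add: field_simps)
      moreover have "(norm (complex_of_real ((1 + \<xi>\<^sup>2) powr (s / 2)) * fourier_function datum \<xi>))\<^sup>2 = ?w \<xi> * (profile \<xi>)\<^sup>2"
        using elim(2) by (simp add: norm_mult power_mult_distrib powr_square)
      ultimately have "(norm (complex_of_real ((1 + \<xi>\<^sup>2) powr (s / 2)) * fourier_function datum \<xi>))\<^sup>2 \<le> (\<Sum>k. f k \<xi>)"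
        by (simp only:)
      then show ?case unfolding real_norm_def abs_power2 by (rule order_trans[OF _ abs_ge_self])
    qed
  qed
  moreover have "\<exists>g. has_fourier_function datum g" using fourier_function_datum(1) by blast
  moreover have "tempered_distribution datum" unfolding datum_def by (rule tempered_distribution_of[OF wave_series_integrable])
  ultimately show ?thesis by (simp add: sobolev_def)
qed

text \<open>A gliding hump argument: \<open>D n k\<close> is the contribution of packet
  \<open>k\<close> to the difference quotient at time \<open>T n\<close>. Tannery's theorem sends
  the sum over \<open>k \<noteq> n\<close> to 0, so convergence of the whole quotient would force
  the diagonal terms to 0. The bounds \<open>d0\<close> and \<open>d1\<close> guarantee that the
  propagator equals the packet series at the times in question.\<close>

lemma no_rate_of_convergence:
  fixes T :: "nat \<Rightarrow> real" and x \<delta> :: real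
  assumes D_def: "D = (\<lambda>n k. complex_of_real (h k) * (evolution k x (T n) - evolution k x 0) / complex_of_real (T n powr \<delta>))"
    and T: "\<And>n. T n > 0" "T \<longlonglongrightarrow> 0"
    and dom0: "summable d0" "\<And>N k. h k * norm (truncated_evolution N k x 0) \<le> d0 k"
    and domT: "\<And>n. summable (d1 n)" "\<And>n N k. h k * norm (truncated_evolution N k x (T n)) \<le> d1 n k"
    and off: "summable M" "\<And>n k. n \<noteq> k \<Longrightarrow> norm (D n k) \<le> M k" "\<And>k. (\<lambda>n. D n k) \<longlonglongrightarrow> 0"
    and diag: "c > 0" "\<forall>\<^sub>F n in sequentially. norm (D n n) \<ge> c"
  shows "\<not> converges_with_rate fst \<delta> datum x"
proof
  assume "converges_with_rate fst \<delta> datum x"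
  then have lim: "((\<lambda>t. (propagator fst datum x t - propagator fst datum x 0) / complex_of_real (t powr \<delta>)) \<longlongrightarrow> 0) (at_right 0)"
    by (simp add: converges_with_rate_def)
  have "filterlim T (at_right 0) sequentially"
    using T by (auto simp: filterlim_at less_imp_neq[OF T(1), symmetric])
  from filterlim_compose[OF lim this]
  have lim1: "(\<lambda>n. (propagator fst datum x (T n) - propagator fst datum x 0) / complex_of_real (T n powr \<delta>)) \<longlonglongrightarrow> 0" .
  note P0 = propagator_datum[OF dom0] and PT = propagator_datum[OF domT]
  have sums: "(\<lambda>k. D n k) sums (2 * complex_of_real pi * ((propagator fst datum x (T n) - propagator fst datum x 0) / complex_of_real (T n powr \<delta>)))" for n
  proof -
    have "(\<lambda>k. (complex_of_real (h k) * evolution k x (T n) - complex_of_real (h k) * evolution k x 0) / complex_of_real (T n powr \<delta>)) sums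
        ((2 * complex_of_real pi * propagator fst datum x (T n) - 2 * complex_of_real pi * propagator fst datum x 0) / complex_of_real (T n powr \<delta>))"
      using P0 PT by (intro sums_divide sums_diff) (auto simp: summable_sums)
    then show ?thesis by (simp add: D_def right_diff_distrib)
  qed
  have sumD: "(\<lambda>n. \<Sum>k. D n k) \<longlonglongrightarrow> 0"
  proof -
    have "(\<lambda>n. 2 * complex_of_real pi * ((propagator fst datum x (T n) - propagator fst datum x 0) / complex_of_real (T n powr \<delta>))) \<longlonglongrightarrow> 2 * complex_of_real pi * 0"
      by (intro tendsto_mult tendsto_const lim1)
    then show ?thesis unfolding sums_unique[OF sums, symmetric] by (simp only: mult_zero_right)
  qed
  define a where "a = (\<lambda>k n. if k = n then 0 else D n k)"
  have "(\<lambda>n. \<Sum>k. a k n) \<longlonglongrightarrow> (\<Sum>k. 0)"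
  proof (rule tannerys_theorem[where M=M, THEN conjunct2, THEN conjunct2])
    show "a k \<longlonglongrightarrow> 0" for k
    proof -
      have "\<forall>\<^sub>F n in sequentially. a k n = D n k" unfolding eventually_sequentially a_def by (intro exI[of _ "Suc k"]) auto
      then show ?thesis using off(3)[of k] by (simp add: tendsto_cong)
    qed
    have "0 \<le> M k" for k by (rule order_trans[OF norm_ge_zero off(2)[of "Suc k" k]]) simp
    then show "\<forall>\<^sub>F (k, n) in at_top \<times>\<^sub>F sequentially. norm (a k n) \<le> M k"
      using off(2) by (intro always_eventually) (auto simp: a_def)
  qed (use off in auto)
  then have lim_a: "(\<lambda>n. \<Sum>k. a k n) \<longlonglongrightarrow> 0" by simp
  have "D n n = (\<Sum>k. D n k) - (\<Sum>k. a k n)" for n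
  proof -
    have "(\<lambda>k. if k = n then D n k else 0) sums D n n" using sums_If_finite[of "\<lambda>k. k = n" "D n"] by simp
    from sums_diff[OF summable_sums[OF sums_summable[OF sums]] this]
    have S: "(\<lambda>k. D n k - (if k = n then D n k else 0)) sums ((\<Sum>k. D n k) - D n n)" .
    have "(\<lambda>k. D n k - (if k = n then D n k else 0)) = (\<lambda>k. a k n)" by (auto simp: a_def)
    from sums_unique[OF S[unfolded this], symmetric] show ?thesis by (simp only: diff_diff_eq2 add_diff_cancel_left')
  qed
  then have "(\<lambda>n. D n n) \<longlonglongrightarrow> 0 - 0" using tendsto_diff[OF sumD lim_a] by simp
  then have "(\<lambda>n. norm (D n n)) \<longlonglongrightarrow> 0" using tendsto_norm[of "\<lambda>n. D n n" 0 sequentially] by simp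
  then have "\<forall>\<^sub>F n in sequentially. norm (D n n) < c" using diag(1) by (rule order_tendstoD)
  then have "\<forall>\<^sub>F n in sequentially. False" using diag(2) by eventually_elim auto
  then show False by simp
qed

end

section \<open>Divergence for lacunary superpositions\<close>

text \<open>The factor 3 keeps the frequencies away from the powers of 2 at which the propagator is
  truncated, so that no truncation cuts through the bulk of a packet.\<close>

definition freq :: "nat \<Rightarrow> real" where
  "freq k = 3 * 2 ^ (4 ^ k)"

lemma freq_ge_power: "2 ^ (4 ^ k) \<le> freq k"
  by (simp add: freq_def)

lemma freq_ge: "freq k \<ge> 6"
proof -
  have "(2::real) ^ 1 \<le> 2 ^ (4 ^ k)" by (rule power_increasing) auto
  then show ?thesis by (simp add: freq_def)
qed

lemma freq_pos: "freq k > 0" using freq_ge[of k] by linarith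

lemma freq_Suc: "freq (Suc k) = freq k ^ 4 / 27"
proof -
  have "(2::real) ^ (4 ^ Suc k) = (2 ^ (4 ^ k)) ^ 4" by (simp add: power_mult[symmetric] mult.commute)
  then show ?thesis by (simp add: freq_def power_mult_distrib)
qed

lemma freq_mono: "j \<le> k \<Longrightarrow> freq j \<le> freq k"
  unfolding freq_def by (intro mult_left_mono power_increasing) auto

text \<open>Three strengths of separation: the quartic gap controls slower packets when
  \<open>\<delta> \<le> 1/4\<close>, the quadratic gap controls all interactions when
  \<open>\<delta> > 1/4\<close>, and the factor 2 keeps different packets apart in space.\<close>

lemma freq_gap:
  assumes "j < k"
  shows "freq j ^ 4 / 27 \<le> freq k" "(freq j)\<^sup>2 \<le> freq k" "2 * freq j \<le> freq k"
proof -
  have "freq (Suc j) \<le> freq k" using assms by (intro freq_mono) auto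
  then show a: "freq j ^ 4 / 27 \<le> freq k" by (simp add: freq_Suc)
  have "6\<^sup>2 \<le> (freq j)\<^sup>2" using freq_ge[of j] by (intro power_mono) auto
  then have "27 * (freq j)\<^sup>2 \<le> (freq j)\<^sup>2 * (freq j)\<^sup>2" by (intro mult_right_mono) auto
  also have "\<dots> = freq j ^ 4" by (simp add: power2_eq_square power4_eq_xxxx)
  finally show b: "(freq j)\<^sup>2 \<le> freq k" using a by simp
  have "2 * freq j \<le> freq j * freq j" using freq_ge[of j] by (intro mult_right_mono) auto
  then show "2 * freq j \<le> freq k" using b by (simp add: power2_eq_square)
qed

text \<open>The factor \<open>2^(k+1)\<close> is the price of \<open>square_suminf_le\<close>.
  Bounding \<open>exp (- y)\<close> by \<open>1 / y\<close> with \<open>y\<close> proportional to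
  \<open>4^k\<close> already leaves geometric decay.\<close>

lemma summable_freq:
  assumes rho: "\<rho> > 0"
  shows "summable (\<lambda>k. 2 ^ Suc k * freq k powr (- \<rho>))"
proof (rule summable_comparison_test')
  show "summable (\<lambda>k. 2 / (\<rho> * ln 2) * (1/2) ^ k)" by (intro summable_mult summable_geometric) auto
  fix k
  have "freq k powr (- \<rho>) \<le> ((2::real) ^ (4 ^ k)) powr (- \<rho>)"
    using rho freq_ge_power by (intro powr_mono2') auto
  also have "\<dots> = exp (- (\<rho> * (4 ^ k * ln 2)))" by (simp add: powr_def ln_realpow)
  also have "\<dots> \<le> (\<rho> * (4 ^ k * ln 2)) powr (- 1)" using rho by (intro exp_minus_le_powr) auto
  also have "\<dots> = 1 / (\<rho> * ln 2) * (1/4) ^ k" using rho by (simp add: powr_minus_divide power_one_over)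
  finally have "2 ^ Suc k * freq k powr (- \<rho>) \<le> 2 ^ Suc k * (1 / (\<rho> * ln 2) * (1/4) ^ k)" by (rule mult_left_mono) simp
  also have "\<dots> = 2 / (\<rho> * ln 2) * (2 ^ k * (1/4) ^ k)" by simp
  also have "(2::real) ^ k * (1/4) ^ k = (1/2) ^ k" by (subst power_mult_distrib[symmetric]) simp
  finally show "norm (2 ^ Suc k * freq k powr (- \<rho>)) \<le> 2 / (\<rho> * ln 2) * (1/2) ^ k" by simp
qed

lemma summable_freq_powr:
  assumes rho: "\<rho> > 0"
  shows "summable (\<lambda>k. freq k powr (- \<rho>))"
proof (rule summable_comparison_test'[OF summable_freq[OF rho], of 0])
  fix k
  have "1 * freq k powr (- \<rho>) \<le> 2 ^ Suc k * freq k powr (- \<rho>)" by (intro mult_right_mono one_le_power) auto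
  then show "norm (freq k powr (- \<rho>)) \<le> 2 ^ Suc k * freq k powr (- \<rho>)" by simp
qed

lemma freq_powr_tendsto: "\<rho> > 0 \<Longrightarrow> (\<lambda>k. freq k powr (- \<rho>)) \<longlonglongrightarrow> 0"
  by (rule summable_LIMSEQ_zero[OF summable_freq_powr])

lemma freq_square_powr: "((freq k)\<^sup>2) powr e = freq k powr (2 * e)"
proof -
  have "(freq k)\<^sup>2 = freq k powr 2" using freq_pos[of k] by simp
  then show ?thesis by (simp only: powr_powr)
qed

lemma freq_away_from_powers: "2 ^ N \<le> 2 / 3 * freq k \<or> 4 / 3 * freq k \<le> 2 ^ N"
proof (cases "N \<le> Suc (4 ^ k)")
  case True
  then have "(2::real) ^ N \<le> 2 ^ Suc (4 ^ k)" by (intro power_increasing) auto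
  then show ?thesis by (simp add: freq_def)
next
  case False
  then have "(2::real) ^ (Suc (Suc (4 ^ k))) \<le> 2 ^ N" by (intro power_increasing) auto
  then show ?thesis by (simp add: freq_def)
qed

lemma admissible_fst: "0 < \<alpha> \<Longrightarrow> admissible_path \<alpha> fst"
  unfolding admissible_path_def bilipschitz_in_x_def hoelder_in_t_def
  by (auto intro!: continuous_intros exI[of _ 1])

lemma sobolev_antimono:
  assumes f: "f \<in> sobolev s'" and s: "s \<le> s'"
  shows "f \<in> sobolev s"
proof -
  have ex: "\<exists>g. has_fourier_function f g" using f by (auto simp: sobolev_def)
  then have "has_fourier_function f (fourier_function f)" unfolding fourier_function_def by (rule someI_ex)
  then have [measurable]: "fourier_function f \<in> borel_measurable borel" by (simp add: has_fourier_function_def)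
  have I: "integrable lborel (\<lambda>\<xi>. (norm (complex_of_real ((1 + \<xi>\<^sup>2) powr (s' / 2)) * fourier_function f \<xi>))\<^sup>2)"
    using f by (simp add: sobolev_def)
  have "integrable lborel (\<lambda>\<xi>. (norm (complex_of_real ((1 + \<xi>\<^sup>2) powr (s / 2)) * fourier_function f \<xi>))\<^sup>2)"
  proof (rule Bochner_Integration.integrable_bound[OF I])
    show "AE \<xi> in lborel. norm ((norm (complex_of_real ((1 + \<xi>\<^sup>2) powr (s / 2)) * fourier_function f \<xi>))\<^sup>2) \<le>
        norm ((norm (complex_of_real ((1 + \<xi>\<^sup>2) powr (s' / 2)) * fourier_function f \<xi>))\<^sup>2)"
    proof (rule AE_I2)
      fix \<xi> :: real
      have "(1 + \<xi>\<^sup>2) powr (s / 2) \<le> (1 + \<xi>\<^sup>2) powr (s' / 2)" using s by (intro powr_mono) auto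
      then have "norm (complex_of_real ((1 + \<xi>\<^sup>2) powr (s / 2)) * fourier_function f \<xi>) \<le> norm (complex_of_real ((1 + \<xi>\<^sup>2) powr (s' / 2)) * fourier_function f \<xi>)"
        unfolding norm_mult norm_of_real by (intro mult_right_mono) auto
      then show "norm ((norm (complex_of_real ((1 + \<xi>\<^sup>2) powr (s / 2)) * fourier_function f \<xi>))\<^sup>2) \<le>
        norm ((norm (complex_of_real ((1 + \<xi>\<^sup>2) powr (s' / 2)) * fourier_function f \<xi>))\<^sup>2)"
        unfolding real_norm_def abs_power2 by (intro power_mono) auto
    qed
  qed measurable
  then show ?thesis using f ex by (simp add: sobolev_def)
qed

lemma norm_iexp_minus_one: "norm (iexp y - 1) \<le> \<bar>y\<bar>"
  using iexp_approx1[of y 0] by simp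

section \<open>Evolution of one packet and of its truncations\<close>

context wave_packets begin

lemma evolution_bounds:
  "norm (evolution k x t) \<le> sqrt (2 * pi * \<sigma> k)"
  "norm (truncated_evolution N k x t) \<le> sqrt (2 * pi * \<sigma> k)"
proof -
  have "norm (evolution k x t) \<le> (LINT \<xi>|lborel. norm (complex_of_real (packet (\<omega> k) (\<sigma> k) \<xi>)))"
    unfolding evolution_def by (rule norm_chirp_le)
  also have "\<dots> = (LINT \<xi>|lborel. packet (\<omega> k) (\<sigma> k) \<xi>)"
    by (intro Bochner_Integration.integral_cong refl) (simp add: packet_le)
  finally show "norm (evolution k x t) \<le> sqrt (2 * pi * \<sigma> k)" unfolding packet_integral(2)[OF sig(1)] .
  have "norm (truncated_evolution N k x t) \<le> (LINT \<xi>|lborel. norm (complex_of_real (indicator {\<xi>. \<bar>\<xi>\<bar> \<le> 2 ^ N} \<xi> * packet (\<omega> k) (\<sigma> k) \<xi>)))"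
    unfolding truncated_evolution_def by (rule norm_chirp_le)
  also have "\<dots> \<le> (LINT \<xi>|lborel. packet (\<omega> k) (\<sigma> k) \<xi>)"
    by (intro integral_mono integrable_norm truncated_packet packet_integral(1)[OF sig(1)])
      (simp add: packet_le split: split_indicator)
  finally show "norm (truncated_evolution N k x t) \<le> sqrt (2 * pi * \<sigma> k)" unfolding packet_integral(2)[OF sig(1)] .
qed

text \<open>The phase changes by at most \<open>|t| * \<xi>^2\<close>, and the second moment of the
  packet does the rest. This controls packets that are too slow to have evolved by time
  \<open>t\<close>.\<close>

lemma evolution_difference:
  "norm (evolution k x t - evolution k x 0) \<le> \<bar>t\<bar> * (4096 * (\<omega> k)\<^sup>2 * sqrt (\<sigma> k))"
proof -
  let ?p = "packet (\<omega> k) (\<sigma> k)"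
  have pc: "integrable lborel (\<lambda>\<xi>. complex_of_real (?p \<xi>))" using packet_integral(1)[OF sig(1)] by (rule integrable_of_real)
  have om2: "\<omega> k powr (2 * 1) = (\<omega> k)\<^sup>2" using om[of k] by simp
  have m: "integrable lborel (\<lambda>\<xi>. (1 + \<xi>\<^sup>2) powr 1 * ?p \<xi>)"
    "(LINT \<xi>|lborel. (1 + \<xi>\<^sup>2) powr 1 * ?p \<xi>) \<le> 4096 * (\<omega> k)\<^sup>2 * sqrt (\<sigma> k)"
    using packet_moment[OF om[of k] sig, of 1] unfolding om2 by auto
  have "evolution k x t - evolution k x 0 = (LINT \<xi>|lborel. iexp (x * \<xi> + t * \<xi>\<^sup>2) * complex_of_real (?p \<xi>) - iexp (x * \<xi> + 0 * \<xi>\<^sup>2) * complex_of_real (?p \<xi>))"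
    unfolding evolution_def chirp_def by (intro Bochner_Integration.integral_diff[symmetric] integrable_phase pc)
  then have "norm (evolution k x t - evolution k x 0) \<le>
     (LINT \<xi>|lborel. norm (iexp (x * \<xi> + t * \<xi>\<^sup>2) * complex_of_real (?p \<xi>) - iexp (x * \<xi> + 0 * \<xi>\<^sup>2) * complex_of_real (?p \<xi>)))"
    by (simp only: integral_norm_bound)
  also have "\<dots> \<le> (LINT \<xi>|lborel. \<bar>t\<bar> * ((1 + \<xi>\<^sup>2) powr 1 * ?p \<xi>))"
  proof (rule integral_mono_bounded[OF integrable_mult_right[OF m(1)]])
    fix \<xi>
    have "iexp (x * \<xi> + t * \<xi>\<^sup>2) - iexp (x * \<xi> + 0 * \<xi>\<^sup>2) = iexp (x * \<xi>) * (iexp (t * \<xi>\<^sup>2) - 1)"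
      by (simp add: exp_add[symmetric] algebra_simps)
    then have "norm (iexp (x * \<xi> + t * \<xi>\<^sup>2) - iexp (x * \<xi> + 0 * \<xi>\<^sup>2)) = norm (iexp (t * \<xi>\<^sup>2) - 1)"
      by (simp only: norm_mult norm_exp_i_times mult_1_left)
    also have "\<dots> \<le> \<bar>t * \<xi>\<^sup>2\<bar>" by (rule norm_iexp_minus_one)
    also have "\<dots> = \<bar>t\<bar> * \<xi>\<^sup>2" by (simp add: abs_mult)
    also have "\<dots> \<le> \<bar>t\<bar> * (1 + \<xi>\<^sup>2) powr 1" by (intro mult_left_mono) (auto simp: add_nonneg_nonneg)
    finally have "norm (iexp (x * \<xi> + t * \<xi>\<^sup>2) - iexp (x * \<xi> + 0 * \<xi>\<^sup>2)) * ?p \<xi> \<le> \<bar>t\<bar> * (1 + \<xi>\<^sup>2) powr 1 * ?p \<xi>"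
      by (rule mult_right_mono) (rule packet_le)
    then show "norm (iexp (x * \<xi> + t * \<xi>\<^sup>2) * complex_of_real (?p \<xi>) - iexp (x * \<xi> + 0 * \<xi>\<^sup>2) * complex_of_real (?p \<xi>)) \<le> \<bar>t\<bar> * ((1 + \<xi>\<^sup>2) powr 1 * ?p \<xi>)"
      unfolding left_diff_distrib[symmetric] norm_mult norm_of_real abs_of_nonneg[OF packet_le(1)] by (simp only: mult.assoc)
  qed (rule norm_ge_zero)
  also have "\<dots> = \<bar>t\<bar> * (LINT \<xi>|lborel. (1 + \<xi>\<^sup>2) powr 1 * ?p \<xi>)" by (rule integral_mult_right_zero)
  also have "\<dots> \<le> \<bar>t\<bar> * (4096 * (\<omega> k)\<^sup>2 * sqrt (\<sigma> k))" by (rule mult_left_mono[OF m(2)]) simp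
  finally show ?thesis .
qed

lemma evolution_eq:
  "evolution k x t = iexp (x * \<omega> k + t * (\<omega> k)\<^sup>2) * chirp_gaussian (1 / (2 * \<sigma> k)) (x + 2 * t * \<omega> k) t"
  unfolding evolution_def by (rule packet_chirp[OF sig(1)])

text \<open>The centre is at \<open>- 2 * t * \<omega> k\<close>, and
  \<open>sqrt (1 + 4 * t^2 * (\<sigma> k)^2)\<close> is the factor by which the packet has
  spread.\<close>

lemma norm_evolution:
  "(norm (evolution k x t))\<^sup>2 = 2 * pi * \<sigma> k / sqrt (1 + 4 * t\<^sup>2 * (\<sigma> k)\<^sup>2) *
     exp (- ((x + 2 * t * \<omega> k)\<^sup>2 * \<sigma> k / (1 + 4 * t\<^sup>2 * (\<sigma> k)\<^sup>2)))"
proof -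
  let ?D = "1 + 4 * t\<^sup>2 * (\<sigma> k)\<^sup>2"
  have s: "\<sigma> k > 0" by (rule sig(1))
  have D: "?D > 0" by (simp add: add_pos_nonneg)
  have e: "(1 / (2 * \<sigma> k))\<^sup>2 + t\<^sup>2 = ?D / (2 * \<sigma> k)\<^sup>2" using s by (simp add: field_simps power2_eq_square)
  have gen: "a * (1 / (2 * b)) / (2 * (d / (2 * b)\<^sup>2)) = a * b / d" if "b > 0" "d > 0" for a b d :: real
    using that by (simp add: field_simps power2_eq_square)
  have "sqrt (?D / (2 * \<sigma> k)\<^sup>2) = sqrt ?D / (2 * \<sigma> k)"
    using s by (subst real_sqrt_divide, subst real_sqrt_abs) simp
  moreover have "(x + 2 * t * \<omega> k)\<^sup>2 * (1 / (2 * \<sigma> k)) / (2 * (?D / (2 * \<sigma> k)\<^sup>2)) = (x + 2 * t * \<omega> k)\<^sup>2 * \<sigma> k / ?D"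
    using gen[OF s D] .
  moreover have "norm (evolution k x t) = norm (chirp_gaussian (1 / (2 * \<sigma> k)) (x + 2 * t * \<omega> k) t)"
    unfolding evolution_eq norm_mult norm_exp_i_times by simp
  ultimately show ?thesis
    using norm_chirp_gaussian[of "1 / (2 * \<sigma> k)" "x + 2 * t * \<omega> k" t] s unfolding e by simp
qed

text \<open>Half of the Gaussian exponent is given up to gain the factor \<sigma>/\<omega>^2, the
  other half leaves a packet of doubled variance. The function \<open>v\<close> may be a sharp
  cutoff or the complement of one.\<close>

lemma packet_tail:
  assumes "\<And>\<xi>. v \<xi> \<noteq> 0 \<Longrightarrow> \<bar>\<xi> - \<omega> k\<bar> \<ge> \<omega> k / 3" "\<And>\<xi>. 0 \<le> v \<xi> \<and> v \<xi> \<le> (1::real)"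
  shows "(LINT \<xi>|lborel. norm (complex_of_real (v \<xi> * packet (\<omega> k) (\<sigma> k) \<xi>))) \<le> 144 * \<sigma> k * sqrt (\<sigma> k) / (\<omega> k)\<^sup>2"
proof -
  have s: "\<sigma> k > 0" by (rule sig(1))
  have o: "\<omega> k > 0" using om[of k] by linarith
  have s2: "2 * \<sigma> k > 0" using s by simp
  have "(LINT \<xi>|lborel. norm (complex_of_real (v \<xi> * packet (\<omega> k) (\<sigma> k) \<xi>))) \<le> (LINT \<xi>|lborel. (36 * \<sigma> k / (\<omega> k)\<^sup>2) * packet (\<omega> k) (2 * \<sigma> k) \<xi>)"
  proof (rule integral_mono_bounded[OF integrable_mult_right[OF packet_integral(1)[OF s2]]])
    fix \<xi>
    have rhs: "0 \<le> (36 * \<sigma> k / (\<omega> k)\<^sup>2) * packet (\<omega> k) (2 * \<sigma> k) \<xi>"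
      using s packet_bounds(1)[of "\<omega> k" "2 * \<sigma> k" \<xi>] by (intro mult_nonneg_nonneg) auto
    have n: "norm (complex_of_real (v \<xi> * packet (\<omega> k) (\<sigma> k) \<xi>)) = v \<xi> * packet (\<omega> k) (\<sigma> k) \<xi>"
      unfolding norm_of_real using assms(2)[of \<xi>] packet_le(1)[of k \<xi>] by (intro abs_of_nonneg mult_nonneg_nonneg) auto
    show "norm (complex_of_real (v \<xi> * packet (\<omega> k) (\<sigma> k) \<xi>)) \<le> (36 * \<sigma> k / (\<omega> k)\<^sup>2) * packet (\<omega> k) (2 * \<sigma> k) \<xi>"
    proof (cases "v \<xi> = 0")
      case True then show ?thesis using rhs by simp
    next
      case False
      define u where "u = (\<xi> - \<omega> k)\<^sup>2 / (4 * \<sigma> k)"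
      have "(\<omega> k / 3)\<^sup>2 \<le> \<bar>\<xi> - \<omega> k\<bar>\<^sup>2" using assms(1)[OF False] o by (intro power_mono) auto
      then have "(\<omega> k)\<^sup>2 \<le> 9 * (\<xi> - \<omega> k)\<^sup>2" by (simp add: power_divide)
      also have "\<dots> = 36 * \<sigma> k * u" using s by (simp add: u_def)
      finally have "1 \<le> 36 * \<sigma> k / (\<omega> k)\<^sup>2 * u" using o by (simp add: field_simps)
      also have "\<dots> \<le> 36 * \<sigma> k / (\<omega> k)\<^sup>2 * exp u" 
      proof (rule mult_left_mono)
        show "u \<le> exp u" using exp_ge_add_one_self[of u] by linarith
      qed (use s in simp)
      finally have "1 * exp (- (2 * u)) \<le> 36 * \<sigma> k / (\<omega> k)\<^sup>2 * exp u * exp (- (2 * u))" by (rule mult_right_mono) simp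
      also have "\<dots> = 36 * \<sigma> k / (\<omega> k)\<^sup>2 * exp (- u)" by (simp add: exp_add[symmetric])
      finally have "packet (\<omega> k) (\<sigma> k) \<xi> \<le> 36 * \<sigma> k / (\<omega> k)\<^sup>2 * packet (\<omega> k) (2 * \<sigma> k) \<xi>"
        by (simp add: packet_def u_def)
      moreover have "v \<xi> * packet (\<omega> k) (\<sigma> k) \<xi> \<le> 1 * packet (\<omega> k) (\<sigma> k) \<xi>"
        using assms(2)[of \<xi>] packet_le(1)[of k \<xi>] by (intro mult_right_mono) auto
      ultimately show ?thesis unfolding n by linarith
    qed
  qed (rule norm_ge_zero)
  also have "\<dots> = 36 * \<sigma> k / (\<omega> k)\<^sup>2 * sqrt (2 * pi * (2 * \<sigma> k))"
    unfolding integral_mult_right_zero packet_integral(2)[OF s2] ..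
  also have "\<dots> \<le> 36 * \<sigma> k / (\<omega> k)\<^sup>2 * (4 * sqrt (\<sigma> k))"
  proof (rule mult_left_mono)
    have "sqrt (2 * pi * (2 * \<sigma> k)) \<le> sqrt (16 * \<sigma> k)" using pi_less_4 s by (intro real_sqrt_le_mono) auto
    then show "sqrt (2 * pi * (2 * \<sigma> k)) \<le> 4 * sqrt (\<sigma> k)" by (simp add: real_sqrt_mult)
  qed (use s in simp)
  finally show ?thesis by simp
qed

text \<open>A truncation below the bulk keeps only a tail of the packet, and one above the bulk
  removes only a tail. The factors 2/3 and 4/3 leave the distance \<omega>/3 that
  \<open>packet_tail\<close> asks for.\<close>

lemma truncated_evolution_away:
  assumes away: "2 ^ N \<le> 2 / 3 * \<omega> k \<or> 4 / 3 * \<omega> k \<le> 2 ^ N"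
  shows "norm (truncated_evolution N k x t) \<le> norm (evolution k x t) + 144 * \<sigma> k * sqrt (\<sigma> k) / (\<omega> k)\<^sup>2"
proof -
  have o: "\<omega> k > 0" using om[of k] by linarith
  let ?p = "packet (\<omega> k) (\<sigma> k)"
  let ?I = "\<lambda>\<xi>::real. indicator {\<xi>. \<bar>\<xi>\<bar> \<le> 2 ^ N} \<xi> :: real"
  from away show ?thesis
  proof
    assume a: "2 ^ N \<le> 2 / 3 * \<omega> k"
    have "norm (truncated_evolution N k x t) \<le> (LINT \<xi>|lborel. norm (complex_of_real (?I \<xi> * ?p \<xi>)))"
      unfolding truncated_evolution_def by (rule norm_chirp_le)
    also have "\<dots> \<le> 144 * \<sigma> k * sqrt (\<sigma> k) / (\<omega> k)\<^sup>2"
      by (rule packet_tail) (use a o in \<open>auto split: split_indicator_asm split_indicator\<close>)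
    finally show ?thesis using norm_ge_zero[of "evolution k x t"] by linarith
  next
    assume a: "4 / 3 * \<omega> k \<le> 2 ^ N"
    have pc: "integrable lborel (\<lambda>\<xi>. complex_of_real (?p \<xi>))" using packet_integral(1)[OF sig(1)] by (rule integrable_of_real)
    have "evolution k x t - truncated_evolution N k x t = chirp (\<lambda>\<xi>. complex_of_real ((1 - ?I \<xi>) * ?p \<xi>)) x t"
      unfolding evolution_def truncated_evolution_def chirp_def
      by (subst Bochner_Integration.integral_diff[symmetric, OF integrable_phase[OF pc] integrable_phase[OF truncated_packet]])
        (intro Bochner_Integration.integral_cong refl, simp add: algebra_simps)
    then have "norm (evolution k x t - truncated_evolution N k x t) \<le> (LINT \<xi>|lborel. norm (complex_of_real ((1 - ?I \<xi>) * ?p \<xi>)))"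
      by (simp only: norm_chirp_le)
    also have "\<dots> \<le> 144 * \<sigma> k * sqrt (\<sigma> k) / (\<omega> k)\<^sup>2"
    proof (rule packet_tail)
      fix \<xi> assume "1 - ?I \<xi> \<noteq> 0"
      then have "\<not> \<bar>\<xi>\<bar> \<le> 2 ^ N" by (auto split: split_indicator_asm)
      then show "\<bar>\<xi> - \<omega> k\<bar> \<ge> \<omega> k / 3" using a o by linarith
    qed (auto split: split_indicator)
    finally show ?thesis
      using norm_triangle_ineq2[of "truncated_evolution N k x t" "evolution k x t"] by (simp add: norm_minus_commute)
  qed
qed

end

section \<open>The two counterexamples\<close>

lemma two_pi_sqrt: "sqrt (2 * pi * 1) \<le> 3"
proof -
  have "sqrt (2 * pi * 1) \<le> sqrt (3\<^sup>2)" using pi_less_4 by (intro real_sqrt_le_mono) simp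
  then show ?thesis by simp
qed

text \<open>At time \<open>\<pi> / \<omega>^2\<close> the carrier phase reaches \<pi> while the
  envelope moves by only \<open>2 * \<pi> / \<omega>\<close>, which is negligible against its unit
  width. The amplitude \<open>\<omega>^(-2*\<delta>)\<close> offsets the weight
  \<open>T^(-\<delta>)\<close>, and it gives finite Sobolev norm for every
  \<open>s < 2 * \<delta>\<close>.\<close>

lemma divergence_large_rate:
  assumes delta: "0 < \<delta>" "\<delta> < 1" and s: "0 \<le> s" "s < 2 * \<delta>"
  shows "\<exists>f \<in> sobolev s. \<forall>x. \<not> converges_with_rate fst \<delta> f x"
proof -
  interpret wave_packets "\<lambda>k. freq k powr (- (2 * \<delta>))" freq "\<lambda>k. 1"
  proof
    show "summable (\<lambda>k. freq k powr (- (2 * \<delta>)))" using delta by (intro summable_freq_powr) auto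
    show "1 \<le> freq k" for k using freq_ge[of k] by linarith
    then show "1 \<le> (freq k)\<^sup>2" for k by (rule one_le_power)
  qed auto
  have sob: "datum \<in> sobolev s"
  proof (rule datum_in_sobolev[OF s(1)])
    show "s \<le> 2" using s delta by linarith
    have "summable (\<lambda>k. 2 ^ Suc k * freq k powr (- (4 * \<delta> - 2 * s)))" using s by (intro summable_freq) auto
    moreover have "(freq k powr (- (2 * \<delta>)))\<^sup>2 * (freq k powr (2 * s) * sqrt 1) = freq k powr (- (4 * \<delta> - 2 * s))" for k
      by (simp add: powr_square powr_add[symmetric])
    ultimately show "summable (\<lambda>k. 2 ^ Suc k * ((freq k powr (- (2 * \<delta>)))\<^sup>2 * (freq k powr (2 * s) * sqrt 1)))" by simp
  qed
  have "\<not> converges_with_rate fst \<delta> datum x" for x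
  proof -
    define T where "T = (\<lambda>n. pi / (freq n)\<^sup>2)"
    have T0: "T n > 0" for n using freq_pos[of n] by (simp add: T_def)
    have Tpow: "T n powr e = pi powr e * freq n powr (- (2 * e))" for n e
    proof -
      have "T n powr e = pi powr e / ((freq n)\<^sup>2) powr e" unfolding T_def by (rule powr_divide)
      then show ?thesis by (simp add: freq_square_powr powr_minus_divide)
    qed
    have "(\<lambda>n. pi * freq n powr (- 2)) \<longlonglongrightarrow> pi * 0" by (intro tendsto_mult tendsto_const freq_powr_tendsto) auto
    moreover have "T = (\<lambda>n. pi * freq n powr (- 2))"
    proof
      fix n show "T n = pi * freq n powr (- 2)" using Tpow[of n 1] T0[of n] by simp
    qed
    ultimately have Tlim: "T \<longlonglongrightarrow> 0" by (simp only: mult_zero_right)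
    have evo: "norm (evolution k x t) \<le> 3" "norm (truncated_evolution N k x t) \<le> 3" for N k t
      using evolution_bounds(1)[of k x t] evolution_bounds(2)[of N k x t] two_pi_sqrt by linarith+
    define D where "D = (\<lambda>n k. complex_of_real (freq k powr (- (2 * \<delta>))) * (evolution k x (T n) - evolution k x 0) / complex_of_real (T n powr \<delta>))"
    have nD: "norm (D n k) = freq k powr (- (2 * \<delta>)) * norm (evolution k x (T n) - evolution k x 0) * T n powr (- \<delta>)" for n k
      by (simp add: D_def norm_mult norm_divide powr_minus_divide)
    have Tneg: "T n powr (- \<delta>) \<le> freq n powr (2 * \<delta>)" for n
    proof -
      have "pi powr (- \<delta>) \<le> 1 powr (- \<delta>)" using delta pi_gt3 by (intro powr_mono2') auto
      then have "pi powr (- \<delta>) * freq n powr (2 * \<delta>) \<le> 1 * freq n powr (2 * \<delta>)" by (intro mult_right_mono) auto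
      then show ?thesis by (simp add: Tpow)
    qed
    \<comment> \<open>Effective for packets slower than the n-th one, which have hardly evolved. The
      constant is \<open>4096 * 4\<close>, with
      \<open>pi powr (1 - \<delta>) \<le> 4\<close>.\<close>
    have below: "norm (D n k) \<le> 16384 * freq k powr (2 - 2 * \<delta>) * freq n powr (- (2 - 2 * \<delta>))" for n k
    proof -
      have "norm (evolution k x (T n) - evolution k x 0) \<le> T n * (4096 * (freq k)\<^sup>2)"
        using evolution_difference[of k x "T n"] T0[of n] by simp
      then have "norm (D n k) \<le> freq k powr (- (2 * \<delta>)) * (T n * (4096 * (freq k)\<^sup>2)) * T n powr (- \<delta>)"
        unfolding nD by (intro mult_right_mono mult_left_mono) auto
      also have "\<dots> = 4096 * (freq k powr (- (2 * \<delta>)) * (freq k)\<^sup>2) * (T n * T n powr (- \<delta>))" by simp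
      also have "freq k powr (- (2 * \<delta>)) * (freq k)\<^sup>2 = freq k powr (- (2 * \<delta>)) * freq k powr 2" using freq_pos[of k] by simp
      also have "\<dots> = freq k powr (2 - 2 * \<delta>)" by (simp add: powr_add[symmetric])
      also have "T n * T n powr (- \<delta>) = T n powr (1 - \<delta>)" using powr_mult_base[of "T n" "- \<delta>"] T0[of n] by simp
      also have "\<dots> = pi powr (1 - \<delta>) * freq n powr (- (2 - 2 * \<delta>))" unfolding Tpow by (simp add: algebra_simps)
      also have "4096 * freq k powr (2 - 2 * \<delta>) * (pi powr (1 - \<delta>) * freq n powr (- (2 - 2 * \<delta>))) \<le>
          4096 * freq k powr (2 - 2 * \<delta>) * (4 * freq n powr (- (2 - 2 * \<delta>)))"
      proof (intro mult_left_mono mult_right_mono)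
        have "pi powr (1 - \<delta>) \<le> pi powr 1" using delta pi_gt3 by (intro powr_mono) auto
        then show "pi powr (1 - \<delta>) \<le> 4" using pi_less_4 by simp
      qed auto
      finally show ?thesis by simp
    qed
    define M where "M = (\<lambda>k. 16384 * freq k powr (- (2 - 2 * \<delta>)) + 6 * freq k powr (- \<delta>))"
    let ?G = "\<lambda>a b. chirp_gaussian (1 / (2 * 1)) a b"
    define c where "c = norm (?G x 0)"
    have c0: "c > 0"
    proof -
      have "c\<^sup>2 > 0" unfolding c_def by (subst norm_chirp_gaussian) auto
      then show ?thesis unfolding c_def by (simp add: zero_less_power2)
    qed
    show ?thesis
    proof (rule no_rate_of_convergence[OF D_def T0 Tlim, where M=M and c="c / 4" and ?d0.0="\<lambda>k. 3 * freq k powr (- (2 * \<delta>))" and ?d1.0="\<lambda>n k. 3 * freq k powr (- (2 * \<delta>))"])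
      show sm: "summable (\<lambda>k. 3 * freq k powr (- (2 * \<delta>)))" using delta by (intro summable_mult summable_freq_powr) auto
      have tb: "freq k powr (- (2 * \<delta>)) * norm (truncated_evolution N k x t) \<le> 3 * freq k powr (- (2 * \<delta>))" for N k t
        using mult_left_mono[OF evo(2), of "freq k powr (- (2 * \<delta>))" N k t] by (simp add: mult.commute)
      show "freq k powr (- (2 * \<delta>)) * norm (truncated_evolution N k x 0) \<le> 3 * freq k powr (- (2 * \<delta>))" for N k by (rule tb)
      show "summable ((\<lambda>n k. 3 * freq k powr (- (2 * \<delta>))) n)" for n :: nat by (rule sm)
      show "freq k powr (- (2 * \<delta>)) * norm (truncated_evolution N k x (T n)) \<le> (\<lambda>n k. 3 * freq k powr (- (2 * \<delta>))) n k" for n N k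
        by (rule tb)
      show "summable M" unfolding M_def using delta by (intro summable_add summable_mult summable_freq_powr) auto
      show "norm (D n k) \<le> M k" if "n \<noteq> k" for n k
      proof (cases "k < n")
        case True
        have "freq n powr (- (2 - 2 * \<delta>)) \<le> ((freq k)\<^sup>2) powr (- (2 - 2 * \<delta>))"
          using freq_gap(2)[OF True] freq_pos[of k] delta by (intro powr_mono2') auto
        also have "\<dots> = freq k powr (- (2 - 2 * \<delta>)) * freq k powr (- (2 - 2 * \<delta>))"
          unfolding freq_square_powr by (simp add: powr_add[symmetric])
        finally have "16384 * freq k powr (2 - 2 * \<delta>) * freq n powr (- (2 - 2 * \<delta>)) \<le>
            16384 * freq k powr (2 - 2 * \<delta>) * (freq k powr (- (2 - 2 * \<delta>)) * freq k powr (- (2 - 2 * \<delta>)))"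
          by (rule mult_left_mono) simp
        also have "\<dots> = 16384 * (freq k powr (2 - 2 * \<delta>) * freq k powr (- (2 - 2 * \<delta>))) * freq k powr (- (2 - 2 * \<delta>))" by (simp only: mult.assoc)
        also have "freq k powr (2 - 2 * \<delta>) * freq k powr (- (2 - 2 * \<delta>)) = 1" unfolding powr_add[symmetric] using freq_pos[of k] by simp
        finally have "16384 * freq k powr (2 - 2 * \<delta>) * freq n powr (- (2 - 2 * \<delta>)) \<le> 16384 * freq k powr (- (2 - 2 * \<delta>))" by (simp only: mult_1_right)
        then show ?thesis using below[of n k] powr_ge_zero[of "freq k" "- \<delta>"] unfolding M_def by linarith
      next
        case False
        then have nk: "n < k" using that by simp
        \<comment> \<open>Faster packets get no cancellation; their small amplitude beats the
          weight, because \<open>freq n ^ 2 \<le> freq k\<close> bounds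
          \<open>T n powr (- \<delta>)\<close> by \<open>freq k powr \<delta>\<close>.\<close>
        have "norm (evolution k x (T n) - evolution k x 0) \<le> 6"
          using norm_triangle_ineq4[of "evolution k x (T n)" "evolution k x 0"] evo(1)[of k "T n"] evo(1)[of k 0] by linarith
        then have "norm (D n k) \<le> freq k powr (- (2 * \<delta>)) * 6 * freq n powr (2 * \<delta>)"
          unfolding nD using Tneg[of n] by (intro mult_mono) auto
        also have "freq n powr (2 * \<delta>) = ((freq n)\<^sup>2) powr \<delta>" by (rule freq_square_powr[symmetric])
        also have "\<dots> \<le> freq k powr \<delta>" using freq_gap(2)[OF nk] delta by (intro powr_mono2) auto
        finally have "norm (D n k) \<le> freq k powr (- (2 * \<delta>)) * 6 * freq k powr \<delta>" by (simp add: mult_left_mono)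
        also have "\<dots> = 6 * (freq k powr (- (2 * \<delta>)) * freq k powr \<delta>)" by simp
        also have "freq k powr (- (2 * \<delta>)) * freq k powr \<delta> = freq k powr (- \<delta>)" by (simp add: powr_add[symmetric])
        finally show ?thesis unfolding M_def by (simp add: add_increasing)
      qed
      show "(\<lambda>n. D n k) \<longlonglongrightarrow> 0" for k
      proof (rule Lim_null_comparison)
        show "\<forall>\<^sub>F n in sequentially. norm (D n k) \<le> 16384 * freq k powr (2 - 2 * \<delta>) * freq n powr (- (2 - 2 * \<delta>))"
          using below by (intro always_eventually) auto
        have "(\<lambda>n. 16384 * freq k powr (2 - 2 * \<delta>) * freq n powr (- (2 - 2 * \<delta>))) \<longlonglongrightarrow> 16384 * freq k powr (2 - 2 * \<delta>) * 0"
          using delta by (intro tendsto_mult tendsto_const freq_powr_tendsto) auto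
        then show "(\<lambda>n. 16384 * freq k powr (2 - 2 * \<delta>) * freq n powr (- (2 - 2 * \<delta>))) \<longlonglongrightarrow> 0" by simp
      qed
      show "c / 4 > 0" using c0 by simp
      have diag: "norm (D n n) = pi powr (- \<delta>) * norm (?G (x + 2 * T n * freq n) (T n) + ?G x 0)" for n
      proof -
        have Tf: "T n * (freq n)\<^sup>2 = pi" using freq_pos[of n] by (simp add: T_def)
        have "iexp (x * freq n + T n * (freq n)\<^sup>2) = iexp (x * freq n) * iexp pi"
          unfolding Tf of_real_add distrib_left exp_add ..
        also have "iexp pi = -1" by (simp add: exp_pi_i)
        finally have "evolution n x (T n) - evolution n x 0 = iexp (x * freq n) * (- (?G (x + 2 * T n * freq n) (T n) + ?G x 0))"
          unfolding evolution_eq by (simp add: algebra_simps)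
        then have "norm (evolution n x (T n) - evolution n x 0) = norm (?G (x + 2 * T n * freq n) (T n) + ?G x 0)"
          by (simp only: norm_mult norm_exp_i_times norm_minus_cancel mult_1_left)
        moreover have "freq n powr (- (2 * \<delta>)) * T n powr (- \<delta>) = pi powr (- \<delta>)"
          unfolding Tpow using freq_pos[of n] by (simp add: powr_add[symmetric] mult.left_commute)
        ultimately show ?thesis unfolding nD by (simp add: mult_ac)
      qed
      have "(\<lambda>n. (x + 2 * T n * freq n, T n)) \<longlonglongrightarrow> (x + 2 * 0, 0)"
      proof (intro tendsto_Pair tendsto_add tendsto_const Tlim)
        have "(\<lambda>n. pi * freq n powr (- 1)) \<longlonglongrightarrow> pi * 0" by (intro tendsto_mult tendsto_const freq_powr_tendsto) auto
        moreover have "T n * freq n = pi * freq n powr (- 1)" for n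
          using freq_pos[of n] by (simp add: T_def powr_minus_divide power2_eq_square)
        ultimately have "(\<lambda>n. 2 * (T n * freq n)) \<longlonglongrightarrow> 2 * 0" by (intro tendsto_mult tendsto_const) simp
        then show "(\<lambda>n. 2 * T n * freq n) \<longlonglongrightarrow> 2 * 0" by (simp only: mult.assoc)
      qed
      from continuous_on_tendsto_compose[OF continuous_chirp this]
      have "(\<lambda>n. ?G (x + 2 * T n * freq n) (T n)) \<longlonglongrightarrow> ?G x 0"
        using integrable_gaussian_complex[of "1/2"] by simp
      then have "(\<lambda>n. norm (?G (x + 2 * T n * freq n) (T n) + ?G x 0)) \<longlonglongrightarrow> norm (?G x 0 + ?G x 0)"
        by (intro tendsto_norm tendsto_add tendsto_const)
      moreover have "norm (?G x 0 + ?G x 0) > c"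
      proof -
        have "norm (?G x 0 + ?G x 0) = 2 * c" unfolding c_def by (simp add: mult_2[symmetric] norm_mult)
        then show ?thesis using c0 by simp
      qed
      ultimately have "\<forall>\<^sub>F n in sequentially. norm (?G (x + 2 * T n * freq n) (T n) + ?G x 0) > c"
        by (rule order_tendstoD)
      then show "\<forall>\<^sub>F n in sequentially. c / 4 \<le> norm (D n n)"
      proof eventually_elim
        case (elim n)
        \<comment> \<open>The envelopes add up to the limit \<open>2 * c\<close>, hence eventually
          exceed \<open>c\<close>; the remaining factor 1/4 accounts for
          \<open>pi powr (- \<delta>)\<close>.\<close>
        have "1 / 4 \<le> pi powr (- 1)" using pi_less_4 pi_gt_zero by (simp add: powr_minus_divide divide_simps)
        also have "\<dots> \<le> pi powr (- \<delta>)" using delta pi_gt3 by (intro powr_mono) auto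
        finally have "1 / 4 * c \<le> pi powr (- \<delta>) * norm (?G (x + 2 * T n * freq n) (T n) + ?G x 0)"
          using elim c0 by (intro mult_mono) auto
        then show ?case unfolding diag by simp
      qed
    qed
  qed
  with sob show ?thesis by blast
qed

text \<open>Here \<open>r\<close> is the ratio of the carrier frequencies of two packets: at the time when one of them
  passes through \<open>x\<close>, the other one is far away compared with its width.\<close>

lemma separated_packets:
  fixes x r :: real
  assumes x: "-2 \<le> x" "x \<le> -1" and r: "0 \<le> r" "r \<le> 1/2 \<or> 2 \<le> r"
  shows "(1 + x\<^sup>2 * r\<^sup>2) / 5 \<le> (x * (1 - r))\<^sup>2"
proof -
  have x2: "1 \<le> x\<^sup>2" using power_mono[of 1 "-x" 2] x by simp
  from r(2) show ?thesis
  proof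
    assume a: "r \<le> 1/2"
    have "(1/2)\<^sup>2 \<le> (1 - r)\<^sup>2" using a by (intro power_mono) auto
    then have 1: "x\<^sup>2 * (1/4) \<le> x\<^sup>2 * (1 - r)\<^sup>2" by (intro mult_left_mono) (auto simp: power2_eq_square)
    have "r\<^sup>2 \<le> (1/2)\<^sup>2" using a r(1) by (intro power_mono) auto
    then have 2: "x\<^sup>2 * r\<^sup>2 \<le> x\<^sup>2 * (1/4)" by (intro mult_left_mono) (auto simp: power2_eq_square)
    have "(1 + u) / 5 \<le> w" if "X * (1/4) \<le> w" "u \<le> X * (1/4)" "1 \<le> X" for u w X :: real
      using that by argo
    from this[OF 1 2 x2] show ?thesis unfolding power_mult_distrib .
  next
    assume a: "2 \<le> r"
    have "(r/2)\<^sup>2 \<le> (r - 1)\<^sup>2" using a by (intro power_mono) auto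
    then have 1: "x\<^sup>2 * (r\<^sup>2/4) \<le> x\<^sup>2 * (1 - r)\<^sup>2" by (intro mult_left_mono) (auto simp: power_divide power2_commute)
    have "2\<^sup>2 \<le> r\<^sup>2" using a by (intro power_mono) auto
    then have "1 * 4 \<le> x\<^sup>2 * r\<^sup>2" using x2 by (intro mult_mono) auto
    then show ?thesis unfolding power_mult_distrib using 1 by (simp add: field_simps)
  qed
qed

text \<open>With variance \<sigma> = \<omega>, times of order \<open>1 / \<omega>\<close> spread a
  packet by a bounded factor only, so its peak keeps the order \<open>\<omega>^(1/2)\<close>. The
  amplitude \<open>\<omega>^(-\<delta>-1/2)\<close> offsets this peak and the weight
  \<open>T^(-\<delta>)\<close>. The interval lies on the negative axis because the packets travel to
  the left.\<close>

lemma divergence_small_rate: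
  assumes delta: "0 \<le> \<delta>" "\<delta> \<le> 1/4" and s: "0 \<le> s" "s < 1/4 + \<delta>"
  shows "\<exists>f \<in> sobolev s. \<forall>x\<in>{-2..-1}. \<not> converges_with_rate fst \<delta> f x"
proof -
  interpret wave_packets "\<lambda>k. freq k powr (- (\<delta> + 1/2))" freq freq
  proof
    show "summable (\<lambda>k. freq k powr (- (\<delta> + 1/2)))" using delta by (intro summable_freq_powr) auto
    show f1: "1 \<le> freq k" for k using freq_ge[of k] by linarith
    show "0 < freq k" for k by (rule freq_pos)
    show "freq k \<le> (freq k)\<^sup>2" for k using mult_right_mono[OF f1[of k], of "freq k"] freq_pos[of k] by (simp add: power2_eq_square)
  qed auto
  have sob: "datum \<in> sobolev s"
  proof (rule datum_in_sobolev[OF s(1)])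
    show "s \<le> 2" using s delta by linarith
    have "summable (\<lambda>k. 2 ^ Suc k * freq k powr (- (2 * \<delta> + 1/2 - 2 * s)))" using s by (intro summable_freq) auto
    moreover have "(freq k powr (- (\<delta> + 1/2)))\<^sup>2 * (freq k powr (2 * s) * sqrt (freq k)) = freq k powr (- (2 * \<delta> + 1/2 - 2 * s))" for k
    proof -
      have "sqrt (freq k) = freq k powr (1/2)" using freq_pos[of k] by (simp add: powr_half_sqrt)
      moreover have "2 * (- (\<delta> + 1/2)) + (2 * s + 1/2) = - (2 * \<delta> + 1/2 - 2 * s)" by simp
      ultimately show ?thesis by (simp only: powr_square powr_add[symmetric])
    qed
    ultimately show "summable (\<lambda>k. 2 ^ Suc k * ((freq k powr (- (\<delta> + 1/2)))\<^sup>2 * (freq k powr (2 * s) * sqrt (freq k))))" by simp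
  qed
  have "\<not> converges_with_rate fst \<delta> datum x" if xI: "x \<in> {-2..-1}" for x
  proof -
    have x: "-2 \<le> x" "x \<le> -1" using xI by auto
    have x2: "1 \<le> x\<^sup>2" "x\<^sup>2 \<le> 4" using power_mono[of 1 "-x" 2] power_mono[of "-x" 2 2] x by auto
    \<comment> \<open>The time at which the centre of the n-th packet passes through
      \<open>x\<close>.\<close>
    define T where "T = (\<lambda>n. - x / (2 * freq n))"
    have T0: "T n > 0" for n unfolding T_def by (rule divide_pos_pos) (use freq_pos[of n] x in auto)
    have T1: "T n \<le> 1 / freq n" for n using freq_pos[of n] x by (simp add: T_def field_simps)
    have T2: "1 / (2 * freq n) \<le> T n" for n using freq_pos[of n] x by (simp add: T_def field_simps)
    have Tx: "2 * T n * freq k = - x * (freq k / freq n)" for n k using freq_pos[of n] by (simp add: T_def)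
    have finv: "1 / freq n = freq n powr (- 1)" for n using freq_pos[of n] by (simp add: powr_minus_divide)
    have Tlim: "T \<longlonglongrightarrow> 0"
    proof (rule Lim_null_comparison)
      show "\<forall>\<^sub>F n in sequentially. norm (T n) \<le> freq n powr (- 1)"
        using T0 T1 by (intro always_eventually) (auto simp: finv less_imp_le)
      show "(\<lambda>n. freq n powr (- 1)) \<longlonglongrightarrow> 0" by (rule freq_powr_tendsto) simp
    qed
    have finvpow: "(1 / freq n) powr e = freq n powr (- e)" for n e
      using freq_pos[of n] by (simp add: powr_divide powr_minus_divide)
    \<comment> \<open>Once the distance from the centre is comparable to the spread, the Gaussian
      factor is at most \<open>exp (- freq k / 5)\<close>. Only \<open>50 / (freq k)^2\<close> of
      this is kept, and \<open>8 * 50 = 20^2\<close> gives the constant.\<close>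
    have far: "norm (evolution k x t) \<le> 20 * freq k powr (- (1/2))"
      if sep: "(1 + 4 * t\<^sup>2 * (freq k)\<^sup>2) / 5 \<le> (x + 2 * t * freq k)\<^sup>2" for k t
    proof (rule power2_le_imp_le)
      let ?D = "1 + 4 * t\<^sup>2 * (freq k)\<^sup>2"
      have f: "freq k > 0" by (rule freq_pos)
      have D: "?D \<ge> 1" by simp
      have e1: "freq k / 5 \<le> (x + 2 * t * freq k)\<^sup>2 * freq k / ?D"
      proof -
        have "?D / 5 * freq k \<le> (x + 2 * t * freq k)\<^sup>2 * freq k" using sep f by (intro mult_right_mono) auto
        then have A: "?D / 5 * freq k / ?D \<le> (x + 2 * t * freq k)\<^sup>2 * freq k / ?D" using D by (intro divide_right_mono) auto
        have "d / 5 * u / d = u / 5" if "d \<ge> 1" for d u :: real using that by simp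
        note B = this[OF D, of "freq k"]
        show ?thesis using A unfolding B .
      qed
      have e2: "exp (- (freq k / 5)) \<le> 50 / (freq k)\<^sup>2"
      proof -
        have "(freq k / 5)\<^sup>2 / 2 \<le> exp (freq k / 5)"
          using exp_lower_Taylor_quadratic[of "freq k / 5"] f by (simp add: power_divide)
        then have "(freq k)\<^sup>2 / 50 \<le> exp (freq k / 5)" by (simp add: power_divide)
        then have "inverse (exp (freq k / 5)) \<le> inverse ((freq k)\<^sup>2 / 50)" using f by (intro le_imp_inverse_le) auto
        then show ?thesis by (simp add: exp_minus)
      qed
      have "(norm (evolution k x t))\<^sup>2 \<le> 2 * pi * freq k / 1 * exp (- (freq k / 5))"
        unfolding norm_evolution
      proof (intro mult_mono divide_left_mono)
        show "1 \<le> sqrt ?D" using D by simp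
        show "0 < sqrt ?D * 1" using D by (simp add: add_pos_nonneg)
        show "exp (- ((x + 2 * t * freq k)\<^sup>2 * freq k / ?D)) \<le> exp (- (freq k / 5))" using e1 by simp
      qed (use f D in auto)
      also have "\<dots> \<le> 8 * freq k * (50 / (freq k)\<^sup>2)"
        using pi_less_4 f e2 by (intro mult_mono) auto
      also have "\<dots> = 400 * freq k powr (- 1)" using f by (simp add: finv[symmetric] power2_eq_square)
      also have "\<dots> = (20 * freq k powr (- (1/2)))\<^sup>2" by (simp add: power_mult_distrib powr_square)
      finally show "(norm (evolution k x t))\<^sup>2 \<le> (20 * freq k powr (- (1/2)))\<^sup>2" .
    qed simp
    have far0: "norm (evolution k x 0) \<le> 20 * freq k powr (- (1/2))" for k
      by (rule far) (use x2 in simp)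
    have farT: "norm (evolution k x (T n)) \<le> 20 * freq k powr (- (1/2))" if "n \<noteq> k" for n k
    proof (rule far)
      let ?r = "freq k / freq n"
      have f: "freq n > 0" "freq k > 0" by (rule freq_pos)+
      have r: "?r \<le> 1/2 \<or> 2 \<le> ?r"
      proof (cases "k < n")
        case True then show ?thesis using freq_gap(3)[OF True] f by (simp add: field_simps)
      next
        case False
        then have "n < k" using that by simp
        then show ?thesis using freq_gap(3)[of n k] f by (simp add: field_simps)
      qed
      have "4 * (T n)\<^sup>2 * (freq k)\<^sup>2 = (2 * T n * freq k)\<^sup>2" by (simp add: power_mult_distrib)
      also have "\<dots> = x\<^sup>2 * ?r\<^sup>2" unfolding Tx by (simp only: power_mult_distrib power2_minus)
      finally have a: "1 + 4 * (T n)\<^sup>2 * (freq k)\<^sup>2 = 1 + x\<^sup>2 * ?r\<^sup>2" by simp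
      have b: "x + 2 * T n * freq k = x * (1 - ?r)" unfolding Tx by (simp add: algebra_simps)
      show "(1 + 4 * (T n)\<^sup>2 * (freq k)\<^sup>2) / 5 \<le> (x + 2 * T n * freq k)\<^sup>2"
        unfolding a b using f by (intro separated_packets[OF x _ r]) auto
    qed
    have trunc: "norm (truncated_evolution N k x t) \<le> norm (evolution k x t) + 144 * freq k powr (- (1/2))" for N k t
    proof -
      have "freq k * sqrt (freq k) / (freq k)\<^sup>2 = freq k powr (- (1/2))"
        using freq_pos[of k] by (simp add: powr_minus_divide powr_half_sqrt power2_eq_square real_div_sqrt field_simps)
      moreover have "144 * freq k * sqrt (freq k) / (freq k)\<^sup>2 = 144 * (freq k * sqrt (freq k) / (freq k)\<^sup>2)" by simp
      ultimately show ?thesis using truncated_evolution_away[OF freq_away_from_powers, of N k x t] by simp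
    qed
    have hpow: "freq k powr (- (\<delta> + 1/2)) * freq k powr (- (1/2)) = freq k powr (- (\<delta> + 1))" for k
      unfolding powr_add[symmetric] by (intro arg_cong[where f="(powr) (freq k)"]) simp
    define D where "D = (\<lambda>n k. complex_of_real (freq k powr (- (\<delta> + 1/2))) * (evolution k x (T n) - evolution k x 0) / complex_of_real (T n powr \<delta>))"
    have nD: "norm (D n k) = freq k powr (- (\<delta> + 1/2)) * norm (evolution k x (T n) - evolution k x 0) * T n powr (- \<delta>)" for n k
      by (simp add: D_def norm_mult norm_divide powr_minus_divide)
    define d0 where "d0 = (\<lambda>k. 164 * freq k powr (- (\<delta> + 1)))"
    \<comment> \<open>The n-th packet is large at its own time, so the majorant has an exceptional
      entry at \<open>k = n\<close>. The dependence on \<open>n\<close> is harmless, since this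
      bound is applied at one time at a time; the 164 in \<open>d0\<close> is
      \<open>20 + 144\<close>.\<close>
    define d1 where "d1 = (\<lambda>n k. d0 k + (if k = n then freq k powr (- (\<delta> + 1/2)) * sqrt (2 * pi * freq k) else 0))"
    define M where "M = (\<lambda>k. 110592 * freq k powr (- 1))"
    have below: "norm (D n k) \<le> 4096 * (freq k)\<^sup>2 * freq n powr (- (3/4))" for n k
    proof -
      have f: "freq k \<ge> 1" "freq n \<ge> 1" using freq_ge[of k] freq_ge[of n] by auto
      have "norm (evolution k x (T n) - evolution k x 0) \<le> T n * (4096 * (freq k)\<^sup>2 * sqrt (freq k))"
        using evolution_difference[of k x "T n"] T0[of n] by simp
      then have "norm (D n k) \<le> freq k powr (- (\<delta> + 1/2)) * (T n * (4096 * (freq k)\<^sup>2 * sqrt (freq k))) * T n powr (- \<delta>)"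
        unfolding nD by (intro mult_right_mono mult_left_mono) auto
      also have "\<dots> = 4096 * (freq k)\<^sup>2 * ((freq k powr (- (\<delta> + 1/2)) * sqrt (freq k)) * (T n * T n powr (- \<delta>)))" by simp
      also have "\<dots> \<le> 4096 * (freq k)\<^sup>2 * (1 * freq n powr (- (3/4)))"
      proof (intro mult_left_mono mult_mono)
        have "freq k powr (- (\<delta> + 1/2)) * sqrt (freq k) = freq k powr (- (\<delta> + 1/2)) * freq k powr (1/2)" using f by (simp add: powr_half_sqrt)
        also have "\<dots> = freq k powr (- \<delta>)" by (simp add: powr_add[symmetric])
        also have "\<dots> \<le> freq k powr 0" using f delta by (intro powr_mono) auto
        finally show "freq k powr (- (\<delta> + 1/2)) * sqrt (freq k) \<le> 1" using f by simp
        have "T n * T n powr (- \<delta>) = T n powr (1 - \<delta>)" using powr_mult_base[of "T n" "- \<delta>"] T0[of n] by simp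
        also have "\<dots> \<le> (1 / freq n) powr (1 - \<delta>)" using T0[of n] T1[of n] delta by (intro powr_mono2) auto
        also have "\<dots> = freq n powr (- (1 - \<delta>))" by (rule finvpow)
        \<comment> \<open>From \<open>\<delta> \<le> 1/4\<close>.\<close>
        also have "\<dots> \<le> freq n powr (- (3/4))" using f delta by (intro powr_mono) auto
        finally show "T n * T n powr (- \<delta>) \<le> freq n powr (- (3/4))" .
      qed (use T0[of n] f in auto)
      finally show ?thesis by simp
    qed
    show ?thesis
    proof (rule no_rate_of_convergence[OF D_def T0 Tlim, where M=M and c=1 and ?d0.0=d0 and ?d1.0=d1])
      show sd0: "summable d0" unfolding d0_def using delta by (intro summable_mult summable_freq_powr) auto
      have bound: "freq k powr (- (\<delta> + 1/2)) * norm (truncated_evolution N k x t) \<le> d0 k"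
        if "norm (evolution k x t) \<le> 20 * freq k powr (- (1/2))" for N k t
      proof -
        have "norm (truncated_evolution N k x t) \<le> 164 * freq k powr (- (1/2))" using trunc[of N k t] that by linarith
        then have "freq k powr (- (\<delta> + 1/2)) * norm (truncated_evolution N k x t) \<le> freq k powr (- (\<delta> + 1/2)) * (164 * freq k powr (- (1/2)))"
          by (rule mult_left_mono) simp
        also have "\<dots> = d0 k" unfolding d0_def hpow[symmetric] by simp
        finally show ?thesis .
      qed
      show "freq k powr (- (\<delta> + 1/2)) * norm (truncated_evolution N k x 0) \<le> d0 k" for N k
        by (rule bound[OF far0])
      have "summable (\<lambda>k. if k = n then freq k powr (- (\<delta> + 1/2)) * sqrt (2 * pi * freq k) else 0)" for n
        using sums_If_finite[of "\<lambda>k. k = n" "\<lambda>k. freq k powr (- (\<delta> + 1/2)) * sqrt (2 * pi * freq k)"] by (auto simp: sums_iff)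
      then show "summable (d1 n)" for n unfolding d1_def by (intro summable_add sd0)
      show "freq k powr (- (\<delta> + 1/2)) * norm (truncated_evolution N k x (T n)) \<le> d1 n k" for n N k
      proof (cases "k = n")
        case True
        have "freq k powr (- (\<delta> + 1/2)) * norm (truncated_evolution N k x (T n)) \<le> freq k powr (- (\<delta> + 1/2)) * sqrt (2 * pi * freq k)"
          by (intro mult_left_mono evolution_bounds) simp
        moreover have "0 \<le> d0 k" by (simp add: d0_def)
        ultimately show ?thesis using True by (simp add: d1_def)
      next
        case False
        then have "n \<noteq> k" by simp
        from bound[OF farT[OF this], of N] show ?thesis using False by (simp add: d1_def)
      qed
      show "summable M" unfolding M_def by (intro summable_mult summable_freq_powr) auto
      show "norm (D n k) \<le> M k" if nk: "n \<noteq> k" for n k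
      proof (cases "k < n")
        case True
        have f: "freq k > 0" by (rule freq_pos)
        \<comment> \<open>The quartic gap turns the exponent -3/4 into -3, which outweighs the
          factor \<open>(freq k)^2\<close> in \<open>below\<close>; the constant of \<open>M\<close>
          is \<open>4096 * 27\<close>.\<close>
        have "freq n powr (- (3/4)) \<le> (freq k ^ 4 / 27) powr (- (3/4))"
          using freq_gap(1)[OF True] f by (intro powr_mono2') auto
        also have "\<dots> = (freq k ^ 4) powr (- (3/4)) * 27 powr (3/4)" by (simp add: powr_divide powr_minus_divide)
        also have "(freq k ^ 4) powr (- (3/4)) = (freq k powr 4) powr (- (3/4))" using f by simp
        also have "\<dots> = freq k powr (- 3)" by (simp only: powr_powr) simp
        also have "freq k powr (- 3) * 27 powr (3/4) \<le> freq k powr (- 3) * 27 powr 1" by (intro mult_left_mono powr_mono) auto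
        finally have "freq n powr (- (3/4)) \<le> freq k powr (- 3) * 27" by simp
        then have "4096 * (freq k)\<^sup>2 * freq n powr (- (3/4)) \<le> 4096 * (freq k)\<^sup>2 * (freq k powr (- 3) * 27)"
          by (rule mult_left_mono) simp
        also have "\<dots> = 110592 * (freq k powr 2 * freq k powr (- 3))" using f by simp
        also have "freq k powr 2 * freq k powr (- 3) = freq k powr (- 1)" unfolding powr_add[symmetric] by simp
        finally show ?thesis using below[of n k] unfolding M_def by linarith
      next
        case False
        then have "n < k" using nk by simp
        then have fm: "freq n \<le> freq k" by (intro freq_mono) auto
        have fp: "freq n > 0" "freq k \<ge> 1" using freq_pos[of n] freq_ge[of k] by auto
        have "T n powr (- \<delta>) \<le> (1 / (2 * freq n)) powr (- \<delta>)" using T2[of n] fp delta by (intro powr_mono2') auto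
        also have "\<dots> = (2 * freq n) powr \<delta>" using fp by (simp add: powr_divide powr_minus_divide)
        also have "\<dots> = 2 powr \<delta> * freq n powr \<delta>" by (rule powr_mult)
        also have "\<dots> \<le> 2 powr 1 * freq k powr \<delta>" using fm fp delta by (intro mult_mono powr_mono powr_mono2) auto
        finally have t: "T n powr (- \<delta>) \<le> 2 * freq k powr \<delta>" by simp
        have "norm (evolution k x (T n) - evolution k x 0) \<le> 40 * freq k powr (- (1/2))"
          using norm_triangle_ineq4[of "evolution k x (T n)" "evolution k x 0"] farT[OF nk] far0[of k] by linarith
        then have "norm (D n k) \<le> freq k powr (- (\<delta> + 1/2)) * (40 * freq k powr (- (1/2))) * (2 * freq k powr \<delta>)"
          unfolding nD using t by (intro mult_mono) auto
        also have "\<dots> = 80 * (freq k powr (- (\<delta> + 1/2)) * freq k powr (- (1/2)) * freq k powr \<delta>)" by simp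
        also have "freq k powr (- (\<delta> + 1/2)) * freq k powr (- (1/2)) * freq k powr \<delta> = freq k powr (- 1)"
          unfolding hpow powr_add[symmetric] by simp
        also have "80 * freq k powr (- 1) \<le> M k" unfolding M_def by (intro mult_right_mono) auto
        finally show ?thesis .
      qed
      show "(\<lambda>n. D n k) \<longlonglongrightarrow> 0" for k
      proof (rule Lim_null_comparison)
        show "\<forall>\<^sub>F n in sequentially. norm (D n k) \<le> 4096 * (freq k)\<^sup>2 * freq n powr (- (3/4))"
          using below by (intro always_eventually) auto
        have "(\<lambda>n. 4096 * (freq k)\<^sup>2 * freq n powr (- (3/4))) \<longlonglongrightarrow> 4096 * (freq k)\<^sup>2 * 0"
          by (intro tendsto_mult tendsto_const freq_powr_tendsto) auto
        then show "(\<lambda>n. 4096 * (freq k)\<^sup>2 * freq n powr (- (3/4))) \<longlonglongrightarrow> 0" by simp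
      qed
      show "(1::real) > 0" by simp
      have "1 \<le> norm (D n n)" if n: "n \<ge> 1" for n
      proof -
        \<comment> \<open>Starting at \<open>n = 1\<close>, the subtracted initial value costs at
          most \<open>20 / 48 <= 1/2\<close> after normalisation, while the peak contributes 3/2,
          which leaves 1.\<close>
        have "freq 1 = 48" by (simp add: freq_def)
        then have f: "freq n \<ge> 48" using freq_mono[OF n] by simp
        have fp: "freq n > 0" using f by simp
        have "x + 2 * T n * freq n = 0" unfolding Tx using fp by simp
        moreover have "4 * (T n)\<^sup>2 * (freq n)\<^sup>2 = x\<^sup>2"
        proof -
          have "4 * (T n)\<^sup>2 * (freq n)\<^sup>2 = (2 * T n * freq n)\<^sup>2" by (simp add: power_mult_distrib)
          then show ?thesis unfolding Tx using fp by simp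
        qed
        ultimately have ev: "(norm (evolution n x (T n)))\<^sup>2 = 2 * pi * freq n / sqrt (1 + x\<^sup>2)"
          unfolding norm_evolution by simp
        \<comment> \<open>The bound 8/3 exceeds \<open>sqrt 5\<close> and makes
          \<open>6 / (8/3)\<close> the square of 3/2.\<close>
        have "sqrt (1 + x\<^sup>2) \<le> sqrt ((8/3)\<^sup>2)" using x2 by (intro real_sqrt_le_mono) (simp add: power2_eq_square)
        then have sq: "sqrt (1 + x\<^sup>2) \<le> 8/3" by simp
        have "0 < 1 + x\<^sup>2" by (simp add: add_pos_nonneg)
        then have sq0: "0 < sqrt (1 + x\<^sup>2)" by simp
        have "(3/2 * freq n powr (1/2))\<^sup>2 = 6 * freq n / (8/3)" using fp by (simp add: power_mult_distrib power_divide powr_square)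
        also have "\<dots> \<le> 2 * pi * freq n / sqrt (1 + x\<^sup>2)"
          using sq sq0 pi_gt3 fp by (intro frac_le mult_right_mono) auto
        finally have "(3/2 * freq n powr (1/2))\<^sup>2 \<le> (norm (evolution n x (T n)))\<^sup>2" unfolding ev .
        then have e1: "3/2 * freq n powr (1/2) \<le> norm (evolution n x (T n))" by (rule power2_le_imp_le) simp
        have e2: "3/2 * freq n powr (1/2) - 20 * freq n powr (- (1/2)) \<le> norm (evolution n x (T n) - evolution n x 0)"
          using e1 far0[of n] norm_triangle_ineq2[of "evolution n x (T n)" "evolution n x 0"] by linarith
        have "(1 / freq n) powr (- \<delta>) \<le> T n powr (- \<delta>)" using T1[of n] T0[of n] delta by (intro powr_mono2') auto
        then have t: "freq n powr \<delta> \<le> T n powr (- \<delta>)" unfolding finvpow by simp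
        have h1: "freq n powr (- (\<delta> + 1/2)) * freq n powr \<delta> = freq n powr (- (1/2))" by (simp add: powr_add[symmetric])
        have "20 * freq n powr (- 1) \<le> 1/2" using f by (simp add: finv[symmetric] field_simps)
        moreover have "freq n powr (- (1/2)) * freq n powr (1/2) = 1" unfolding powr_add[symmetric] using fp by simp
        moreover have "freq n powr (- (1/2)) * freq n powr (- (1/2)) = freq n powr (- 1)" by (simp add: powr_add[symmetric])
        ultimately have "1 \<le> freq n powr (- (1/2)) * (3/2 * freq n powr (1/2) - 20 * freq n powr (- (1/2)))"
          by (simp add: right_diff_distrib)
        also have "\<dots> \<le> freq n powr (- (1/2)) * norm (evolution n x (T n) - evolution n x 0)"
          using e2 by (rule mult_left_mono) simp
        also have "\<dots> = freq n powr (- (\<delta> + 1/2)) * norm (evolution n x (T n) - evolution n x 0) * freq n powr \<delta>"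
          unfolding h1[symmetric] by simp
        also have "\<dots> \<le> norm (D n n)" unfolding nD using t by (intro mult_left_mono) auto
        finally show ?thesis .
      qed
      then show "\<forall>\<^sub>F n in sequentially. 1 \<le> norm (D n n)" unfolding eventually_sequentially by blast
    qed
  qed
  with sob show ?thesis by blast
qed

lemma AE_in_interval:
  assumes "AE x in lborel. P x" and "a < (b::real)"
  shows "\<exists>x\<in>{a..b}. P x"
proof (rule ccontr)
  assume neg: "\<not> (\<exists>x\<in>{a..b}. P x)"
  have "AE x in lborel. x \<notin> {a..b}"
    using assms(1) by eventually_elim (use neg in blast)
  then have "emeasure lborel {a..b} = 0" by (subst (asm) AE_iff_null_sets[symmetric]) (auto simp: null_sets_def)
  then show False using assms(2) by simp
qed

theorem theorem1p2:
  fixes \<alpha> \<delta> :: real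
  assumes "1 / 2 \<le> \<alpha>" and "\<alpha> < 1" and "0 \<le> \<delta>" and "\<delta> < \<alpha>"
  shows "(\<forall>\<gamma>. admissible_path \<alpha> \<gamma> \<longrightarrow>
            (\<forall>s > critical_exponent \<delta>. \<forall>f \<in> sobolev s.
               AE x in lborel. converges_with_rate \<gamma> \<delta> f x)) \<and>
         (\<exists>\<gamma>. admissible_path \<alpha> \<gamma> \<and>
            (\<forall>s < critical_exponent \<delta>.
               \<not> (\<forall>f \<in> sobolev s. AE x in lborel. converges_with_rate \<gamma> \<delta> f x)))"
proof (intro conjI allI impI ballI)
  fix \<gamma> s f assume "admissible_path \<alpha> \<gamma>" "critical_exponent \<delta> < s" "f \<in> sobolev s"
  then show "AE x in lborel. converges_with_rate \<gamma> \<delta> f x"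
    using assms by (intro convergence_above_critical_exponent[of \<alpha>])
next
  have "\<not> (\<forall>f \<in> sobolev s. AE x in lborel. converges_with_rate fst \<delta> f x)" if s: "s < critical_exponent \<delta>" for s
  proof -
    \<comment> \<open>Negative orders are raised to 0, which is still subcritical, since the
      critical exponent is at least 1/4. The Sobolev spaces are nested, so a counterexample of order
      \<open>s'\<close> is one of order \<open>s\<close>.\<close>
    define s' where "s' = max s 0"
    have s': "0 \<le> s'" "s \<le> s'" "s' < critical_exponent \<delta>"
      using s assms(3) critical_exponent_ge(2)[OF assms(3)] by (auto simp: s'_def)
    have "\<exists>f \<in> sobolev s'. \<forall>x\<in>{-2..-1}. \<not> converges_with_rate fst \<delta> f x"
    proof (cases "\<delta> \<le> 1/4")
      case True
      then show ?thesis using s' assms by (intro divergence_small_rate) (auto simp: critical_exponent_def)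
    next
      case False
      then have "\<exists>f \<in> sobolev s'. \<forall>x. \<not> converges_with_rate fst \<delta> f x"
        using s' assms by (intro divergence_large_rate) (auto simp: critical_exponent_def)
      then show ?thesis by blast
    qed
    then obtain f where f: "f \<in> sobolev s'" "\<And>x. x \<in> {-2..-1} \<Longrightarrow> \<not> converges_with_rate fst \<delta> f x" by blast
    have "\<not> (AE x in lborel. converges_with_rate fst \<delta> f x)"
      using AE_in_interval[of "\<lambda>x. converges_with_rate fst \<delta> f x" "-2" "-1"] f(2) by auto
    then show ?thesis using sobolev_antimono[OF f(1) s'(2)] by blast
  qed
  moreover have "admissible_path \<alpha> fst" using assms by (intro admissible_fst) auto
  ultimately show "\<exists>\<gamma>. admissible_path \<alpha> \<gamma> \<and>
      (\<forall>s < critical_exponent \<delta>. \<not> (\<forall>f \<in> sobolev s. AE x in lborel. converges_with_rate \<gamma> \<delta> f x))" by blast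
qed



end
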